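(* (1) There is an absolute constant $c>0$ such that the following holds. Let $\varepsilon>0$ and let $K\subset\mathbb{R}^2$ be a convex body, with Santaló point $s(K)$, whose Banach–Mazur distance from the ellipses is at least $1+\varepsilon$. Then $$V(K)\,V\big((K-s(K))^*\big)\le \pi^2\,(1-c\,\varepsilon^6).$$ (2) There is a function $\eta(\varepsilon)$ (independent of $K$) with $\eta(\varepsilon)\to 0$ as $\varepsilon\to 0^+$ such that, if in addition $K$ is $o$-symmetric, then $$V(K)\,V\big((K-s(K))^*\big)=V(K)\,V(K^* )\le \pi^2\big(1-(8+\eta(\varepsilon))\,\varepsilon^3\big).$$
   Context: $o$ denotes the origin of $\mathbb{R}^2$; $K$ is $o$-symmetric if $K=-K$. A convex body is a compact convex set with nonempty interior. $V(\cdot)$ denotes area. For a convex body $M$ with $o\in\operatorname{int}M$, $M^*=\{x\in\mathbb{R}^2:\langle x,y\rangle\le 1\text{ for all }y\in M\}$ is the polar body. The Santaló point $s(K)$ is the unique point $z\in\operatorname{int}K$ at which the function $z\mapsto V((K-z)^* )$ on $\operatorname{int}K$ attains its minimum. The Banach–Mazur distance of planar convex bodies $K$ and $M$ is the minimal $\lambda\ge 1$ such that $K-x\subset\Phi(M-y)\subset\lambda(K-x)$ for some $x,y\in\mathbb{R}^2$ and some non-singular linear map $\Phi$; the Banach–Mazur distance of $K$ from the ellipses is its Banach–Mazur distance from the unit disc. *)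

theory Defs
  imports "HOL-Analysis.Analysis"
begin

definition convex_body :: "(real^2) set \<Rightarrow> bool" where
  "convex_body K \<longleftrightarrow> compact K \<and> convex K \<and> interior K \<noteq> {}"

definition o_symmetric :: "(real^2) set \<Rightarrow> bool" where
  "o_symmetric K \<longleftrightarrow> K = uminus ` K"

definition translate_by :: "(real^2) set \<Rightarrow> real^2 \<Rightarrow> (real^2) set" (infixl "\<ominus>" 65) where
  "K \<ominus> z = (\<lambda>p. p - z) ` K"

abbreviation area :: "(real^2) set \<Rightarrow> real" where
  "area \<equiv> measure lebesgue"

definition polar :: "(real^2) set \<Rightarrow> (real^2) set" where
  "polar M = {x. \<forall>y\<in>M. x \<bullet> y \<le> 1}"

definition santalo_point :: "(real^2) set \<Rightarrow> real^2" where
  "santalo_point K = (THE z. z \<in> interior K \<and>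
     (\<forall>w \<in> interior K. area (polar (K \<ominus> z)) \<le> area (polar (K \<ominus> w))))"

text \<open>For convex bodies the infimum below is attained, so it is the minimal such factor.\<close>

definition banach_mazur :: "(real^2) set \<Rightarrow> (real^2) set \<Rightarrow> real" where
  "banach_mazur K M = Inf {t. t \<ge> 1 \<and> (\<exists>x y \<Phi>. linear \<Phi> \<and> inj \<Phi> \<and>
     K \<ominus> x \<subseteq> \<Phi> ` (M \<ominus> y) \<and> \<Phi> ` (M \<ominus> y) \<subseteq> (\<lambda>p. t *\<^sub>R p) ` (K \<ominus> x))}"

abbreviation banach_mazur_ellipse :: "(real^2) set \<Rightarrow> real" where
  "banach_mazur_ellipse K \<equiv> banach_mazur K (cball 0 1)"

end

theory Submission
  imports Defs
begin

text \<open>Two lines through a point \<open>z\<close> cut \<open>K\<close> into four parts of equal area. After an affine map \<open>z\<close> is the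
  origin and the lines are the coordinate axes, so that the open quadrants are their own dual cones.
  In each quadrant the areas of \<open>K\<close> and of its polar body have product at most \<open>(pi / 4)\<^sup>2\<close>: if two
  points \<open>x\<close> and \<open>y\<close> on the boundary curves sweep out both areas at the same relative rate, then the
  angle of their coordinatewise geometric mean grows from \<open>0\<close> to \<open>pi / 2\<close>, and by \<open>x \<bullet> y \<le> 1\<close> and the
  inequality of arithmetic and geometric means its speed is bounded from below. Summing over the
  quadrants gives the Blaschke-Santalo inequality, since the Santalo point minimises the area of the
  polar body.

  If the deficit is at most \<open>m ^ 5\<close>, up to a constant, then the speed is almost constant except on a
  set of measure \<open>m\<close>; this forces the boundary of \<open>K\<close> in each quadrant to be within \<open>m\<^sup>2\<close> of
  an ellipse with the coordinate axes as its axes, except for arcs of length \<open>m\<close>. Convexity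
  fills these arcs and glues the four quarters, at the cost of a further multiple of \<open>m\<^sup>2\<close>. Hence the
  deficit is at least of the order \<open>\<epsilon>\<close> to the power \<open>5 / 2\<close>, which for small \<open>\<epsilon>\<close> beats both \<open>8 \<epsilon> ^ 3\<close>
  and \<open>c \<epsilon> ^ 6\<close>. In particular \<open>\<eta>\<close> vanishes near \<open>0\<close>.\<close>

section \<open>Areas in the plane\<close>

text \<open>The exponent 5 balances two errors. The excess speed \<open>f\<close> has total integral
  \<open>pi / 2 - \<Sigma> \<le> m ^ 5\<close>, so every time interval of length
  \<open>2 * m\<close> contains an instant with \<open>f \<le> m ^ 4\<close>. The excess acts on the
  curve through its square root, so at such instants the deviation from an ellipse is of order
  \<open>m\<^sup>2\<close>; and convexity extends an estimate from points with gaps of order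
  \<open>m\<close> to all points at a cost of the same order. Logarithmic slopes are used because a
  diagonal linear map merely shifts them: \<open>X\<close> and \<open>Y\<close> move by opposite
  amounts, \<open>X + Y\<close> stays, and \<open>X - Y\<close> is constant along an ellipse with
  the coordinate axes as its axes, its value fixing the ratio of the semi-axes. Equal quarters serve
  twice. The polar body need not be cut equally, yet the four products share the factor
  \<open>area M / 4\<close> and can be added. Moreover the four ellipses have nearly the same
  product of semi-axes; once convexity makes two of them agree along a common axis, they agree along
  the other axis too.\<close>

definition v2 :: "real \<Rightarrow> real \<Rightarrow> real^2" where
  "v2 x y = vector [x, y]"

lemma v2_nth [simp]: "v2 x y $ 1 = x" "v2 x y $ 2 = y"
  by (simp_all add: v2_def)

lemma v2_eta [simp]: "v2 (v $ 1) (v $ 2) = v"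
  by (simp add: vec_eq_iff forall_2)

lemma v2_inner [simp]: "v2 x y \<bullet> v2 x' y' = x * x' + y * y'"
  by (simp add: inner_vec_def sum_2)

lemma v2_algebra: "v2 x y + v2 x' y' = v2 (x + x') (y + y')" "v2 x y - v2 x' y' = v2 (x - x') (y - y')"
  "r *\<^sub>R v2 x y = v2 (r * x) (r * y)" "- v2 x y = v2 (-x) (-y)"
  by (simp_all add: vec_eq_iff forall_2)

lemma v2_eq_iff [simp]: "v2 x y = v2 x' y' \<longleftrightarrow> x = x' \<and> y = y'"
  by (simp add: vec_eq_iff forall_2)

lemma v2_zero: "v2 0 0 = 0"
  by (simp add: vec_eq_iff forall_2)

lemma v2_eq_0_iff [simp]: "v2 x y = 0 \<longleftrightarrow> x = 0 \<and> y = 0"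
  by (simp flip: v2_zero)

lemma norm_v2: "norm (v2 x y) = sqrt (x\<^sup>2 + y\<^sup>2)"
  by (simp add: norm_eq_sqrt_inner power2_eq_square)

lemma continuous_v2 [continuous_intros]:
  assumes "continuous_on S f" "continuous_on S g"
  shows "continuous_on S (\<lambda>x. v2 (f x) (g x))"
proof -
  have "continuous_on S (\<lambda>x. \<chi> i. v2 (f x) (g x) $ i)"
  proof (rule continuous_on_vec_lambda)
    fix i :: 2
    show "continuous_on S (\<lambda>x. v2 (f x) (g x) $ i)"
      using exhaust_2[of i] assms by auto
  qed
  then show ?thesis by simp
qed

lemma v2_measurable [measurable]:
  assumes "f \<in> borel_measurable M" "g \<in> borel_measurable M"
  shows "(\<lambda>x. v2 (f x) (g x)) \<in> borel_measurable M"
proof -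
  have "continuous_on UNIV (\<lambda>p::real\<times>real. v2 (fst p) (snd p))"
    by (intro continuous_intros)
  then have "(\<lambda>p::real\<times>real. v2 (fst p) (snd p)) \<in> borel_measurable borel"
    by (rule borel_measurable_continuous_onI)
  moreover have "(\<lambda>x. (f x, g x)) \<in> M \<rightarrow>\<^sub>M borel"
    using assms by (rule borel_measurable_Pair)
  ultimately show ?thesis
    using measurable_compose[of "\<lambda>x. (f x, g x)" M borel "\<lambda>p. v2 (fst p) (snd p)" borel] by simp
qed

text \<open>Boxes determine Lebesgue measure, and the preimage of a box is a product of intervals.
  The purpose is to have Fubini on \<open>real^2\<close>.\<close>

lemma lborel_v2: "lborel = distr (lborel \<Otimes>\<^sub>M lborel) borel (\<lambda>(x,y). v2 x y)"
proof (rule lborel_eqI)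
  fix l u :: "real^2"
  assume le: "\<And>b. b \<in> Basis \<Longrightarrow> l \<bullet> b \<le> u \<bullet> b"
  have B: "(Basis :: (real^2) set) = {axis 1 1, axis 2 1}"
    by (auto simp: Basis_vec_def UNIV_2)
  have ne: "axis 1 1 \<noteq> (axis 2 1 :: real^2)"
    by (simp add: axis_eq_axis)
  have le': "l $ 1 \<le> u $ 1" "l $ 2 \<le> u $ 2"
    using le[of "axis 1 1"] le[of "axis 2 1"] by (auto simp: B inner_axis)
  have "emeasure (distr (lborel \<Otimes>\<^sub>M lborel) borel (\<lambda>(x,y). v2 x y)) (box l u) =
     emeasure (lborel \<Otimes>\<^sub>M lborel) ((\<lambda>(x,y). v2 x y) -` box l u \<inter> space (lborel \<Otimes>\<^sub>M lborel))"
    by (rule emeasure_distr) auto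
  also have "(\<lambda>(x,y). v2 x y) -` box l u \<inter> space (lborel \<Otimes>\<^sub>M lborel) = {l$1<..<u$1} \<times> {l$2<..<u$2}"
    by (auto simp: mem_box B inner_axis space_pair_measure)
  also have "emeasure (lborel \<Otimes>\<^sub>M lborel) \<dots> = emeasure lborel {l$1<..<u$1} * emeasure lborel {l$2<..<u$2}"
    by (rule lborel.emeasure_pair_measure_Times) auto
  also have "\<dots> = ennreal (\<Prod>b\<in>Basis. (u - l) \<bullet> b)"
    using le' ne by (simp add: B inner_axis ennreal_mult' inner_diff_left)
  finally show "emeasure (distr (lborel \<Otimes>\<^sub>M lborel) borel (\<lambda>(x,y). v2 x y)) (box l u) =
      ennreal (\<Prod>b\<in>Basis. (u - l) \<bullet> b)" .
qed simp

lemma nn_integral_lborel_v2: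
  assumes f [measurable]: "f \<in> borel_measurable borel"
  shows "(\<integral>\<^sup>+v. f v \<partial>(lborel :: (real^2) measure)) = (\<integral>\<^sup>+y. (\<integral>\<^sup>+x. f (v2 x y) \<partial>lborel) \<partial>lborel)"
proof -
  have [measurable]: "(\<lambda>(x,y). v2 x y) \<in> borel_measurable (lborel \<Otimes>\<^sub>M lborel)"
    by measurable
  have "(\<integral>\<^sup>+v. f v \<partial>(lborel :: (real^2) measure)) = (\<integral>\<^sup>+p. f (case p of (x,y) \<Rightarrow> v2 x y) \<partial>(lborel \<Otimes>\<^sub>M lborel))"
    by (subst lborel_v2, rule nn_integral_distr) auto
  also have "\<dots> = (\<integral>\<^sup>+y. (\<integral>\<^sup>+x. f (v2 x y) \<partial>lborel) \<partial>lborel)"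
    by (subst lborel_pair.nn_integral_snd[symmetric]) auto
  finally show ?thesis .
qed

section \<open>Area of a star-shaped set in a quadrant as a radial integral\<close>

lemma emeasure_radial:
  fixes K :: real
  assumes "K > 0"
  shows "(\<integral>\<^sup>+r. ennreal r * indicator {0<..} r * indicator {r. r * K \<le> 1} r \<partial>lborel) = ennreal (1 / (2 * K\<^sup>2))"
proof -
  have "(\<integral>\<^sup>+r. ennreal r * indicator {0<..} r * indicator {r. r * K \<le> 1} r \<partial>lborel)
      = (\<integral>\<^sup>+r. ennreal r * indicator {0..1/K} r \<partial>lborel)"
    using assms by (intro nn_integral_cong) (auto simp: indicator_def field_simps)
  also have "\<dots> = ennreal ((1/K)\<^sup>2 / 2 - 0\<^sup>2 / 2)"
    using assms by (intro nn_integral_FTC_Icc) (auto intro!: derivative_eq_intros)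
  also have "(1/K)\<^sup>2 / 2 - 0\<^sup>2 / 2 = 1 / (2 * K\<^sup>2)"
    by (simp add: power_divide)
  finally show ?thesis .
qed

text \<open>The substitution \<open>x + y = r\<close>, \<open>y = r s\<close> parametrises the quadrant over the compact interval
  \<open>0 \<le> s \<le> 1\<close>, so that no improper integral occurs.\<close>

lemma emeasure_quadrant:
  fixes N :: "real^2 \<Rightarrow> real" and \<sigma> \<tau> :: real
  assumes cont: "continuous_on UNIV N" and pos: "\<And>v. v \<noteq> 0 \<Longrightarrow> N v > 0"
    and hom: "\<And>r v. r \<ge> 0 \<Longrightarrow> N (r *\<^sub>R v) = r * N v"
    and sgn: "\<bar>\<sigma>\<bar> = 1" "\<bar>\<tau>\<bar> = 1"
  shows "emeasure lborel {v. N v \<le> 1 \<and> \<sigma> * v $ 1 > 0 \<and> \<tau> * v $ 2 > 0}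
       = (\<integral>\<^sup>+s. ennreal (1 / (2 * (N (v2 (\<sigma> * (1 - s)) (\<tau> * s)))\<^sup>2)) * indicator {0<..<1} s \<partial>lborel)"
proof -
  have [measurable]: "N \<in> borel_measurable borel"
    using cont by (rule borel_measurable_continuous_onI)
  have ss: "\<sigma> * \<sigma> = 1" "\<tau> * \<tau> = 1" "\<sigma> \<noteq> 0" "\<tau> \<noteq> 0"
    using sgn by (cases "\<sigma> < 0"; cases "\<tau> < 0"; simp)+
  have ss': "\<sigma> * (\<sigma> * x) = x" "\<tau> * (\<tau> * x) = x" for x
    using ss by (metis mult.assoc mult_1)+
  let ?A = "{v. N v \<le> 1 \<and> \<sigma> * v $ 1 > 0 \<and> \<tau> * v $ 2 > 0}"
  have [measurable]: "?A \<in> sets borel" by measurable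
  define g :: "real \<Rightarrow> real \<Rightarrow> ennreal" where "g x y = indicator ?A (v2 (\<sigma> * x) (\<tau> * y))" for x y
  have g: "g x y = (if N (v2 (\<sigma> * x) (\<tau> * y)) \<le> 1 \<and> x > 0 \<and> y > 0 then 1 else 0)" for x y
    by (simp add: g_def indicator_def ss')
  have [measurable]: "(\<lambda>p. g (f p) (h p)) \<in> borel_measurable M"
    if [measurable]: "f \<in> borel_measurable M" "h \<in> borel_measurable M" for f h and M :: "'b measure"
    unfolding g_def by measurable
  have "emeasure lborel ?A = (\<integral>\<^sup>+v. indicator ?A v \<partial>lborel)"
    by simp
  also have "\<dots> = (\<integral>\<^sup>+y. (\<integral>\<^sup>+x. indicator ?A (v2 x y) \<partial>lborel) \<partial>lborel)"
    by (rule nn_integral_lborel_v2) simp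
  also have "\<dots> = (\<integral>\<^sup>+y. (\<integral>\<^sup>+x. g x y \<partial>lborel) \<partial>lborel)"
  proof -
    have "(\<integral>\<^sup>+x. indicator ?A (v2 x y) \<partial>lborel) = (\<integral>\<^sup>+x. indicator ?A (v2 (\<sigma> * x) y) \<partial>lborel)" for y
      by (subst nn_integral_real_affine[where c = \<sigma> and t = 0]) (use ss sgn in auto)
    moreover have "(\<integral>\<^sup>+y. (\<integral>\<^sup>+x. indicator ?A (v2 (\<sigma> * x) y) \<partial>lborel) \<partial>lborel)
      = (\<integral>\<^sup>+y. (\<integral>\<^sup>+x. indicator ?A (v2 (\<sigma> * x) (\<tau> * y)) \<partial>lborel) \<partial>lborel)"
      by (subst nn_integral_real_affine[where c = \<tau> and t = 0]) (use ss sgn in auto)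
    ultimately show ?thesis by (simp only: g_def)
  qed
  \<comment> \<open>The Jacobian arises from two one-dimensional affine substitutions: the shift
    \<open>x = r - y\<close> at fixed \<open>y\<close> and, after exchanging the integrals, the
    scaling \<open>y = r * s\<close> at fixed \<open>r\<close>.\<close>
  also have "\<dots> = (\<integral>\<^sup>+y. (\<integral>\<^sup>+r. g (r - y) y \<partial>lborel) \<partial>lborel)"
    using nn_integral_real_affine[of "\<lambda>x. g x y" 1 "- y" for y] by simp
  also have "\<dots> = (\<integral>\<^sup>+r. (\<integral>\<^sup>+y. g (r - y) y \<partial>lborel) \<partial>lborel)"
    by (rule lborel_pair.Fubini') simp
  also have "\<dots> = (\<integral>\<^sup>+r. (\<integral>\<^sup>+s. ennreal r * indicator {0<..} r * g (r * (1 - s)) (r * s) \<partial>lborel) \<partial>lborel)"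
  proof (rule nn_integral_cong)
    fix r :: real
    show "(\<integral>\<^sup>+y. g (r - y) y \<partial>lborel) = (\<integral>\<^sup>+s. ennreal r * indicator {0<..} r * g (r * (1 - s)) (r * s) \<partial>lborel)"
    proof (cases "r > 0")
      case True
      then show ?thesis
        by (subst nn_integral_real_affine[where c = r and t = 0])
           (simp_all add: nn_integral_cmult right_diff_distrib)
    next
      case False
      then have "g (r - y) y = 0" for y by (auto simp: g)
      then show ?thesis using False by simp
    qed
  qed
  also have "\<dots> = (\<integral>\<^sup>+s. (\<integral>\<^sup>+r. ennreal r * indicator {0<..} r * g (r * (1 - s)) (r * s) \<partial>lborel) \<partial>lborel)"
    by (rule lborel_pair.Fubini') simp
  also have "\<dots> = (\<integral>\<^sup>+s. ennreal (1 / (2 * (N (v2 (\<sigma> * (1 - s)) (\<tau> * s)))\<^sup>2)) * indicator {0<..<1} s \<partial>lborel)"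
  proof (rule nn_integral_cong)
    fix s :: real
    let ?K = "N (v2 (\<sigma> * (1 - s)) (\<tau> * s))"
    show "(\<integral>\<^sup>+r. ennreal r * indicator {0<..} r * g (r * (1 - s)) (r * s) \<partial>lborel) =
        ennreal (1 / (2 * ?K\<^sup>2)) * indicator {0<..<1} s"
    proof (cases "0 < s \<and> s < 1")
      case True
      have K: "?K > 0" using True ss by (intro pos) auto
      have "(\<integral>\<^sup>+r. ennreal r * indicator {0<..} r * g (r * (1 - s)) (r * s) \<partial>lborel)
        = (\<integral>\<^sup>+r. ennreal r * indicator {0<..} r * indicator {r. r * ?K \<le> 1} r \<partial>lborel)"
      proof (rule nn_integral_cong)
        fix r :: real
        have "N (v2 (\<sigma> * (r * (1 - s))) (\<tau> * (r * s))) = r * ?K" if "r > 0"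
          using hom[of r "v2 (\<sigma> * (1 - s)) (\<tau> * s)"] that by (simp add: v2_algebra algebra_simps)
        then show "ennreal r * indicator {0<..} r * g (r * (1 - s)) (r * s) =
          ennreal r * indicator {0<..} r * indicator {r. r * ?K \<le> 1} r"
          using True by (auto simp: indicator_def g)
      qed
      then show ?thesis using emeasure_radial[OF K] True by simp
    next
      case False
      then have "r > 0 \<Longrightarrow> g (r * (1 - s)) (r * s) = 0" for r
        by (auto simp: g zero_less_mult_iff)
      then have "(\<lambda>r. ennreal r * indicator {0<..} r * g (r * (1 - s)) (r * s)) = (\<lambda>r. 0)"
        by (auto simp: indicator_def fun_eq_iff)
      then show ?thesis using False by simp
    qed
  qed
  finally show ?thesis .
qed

lemma area_quadrant:
  fixes N :: "real^2 \<Rightarrow> real" and \<sigma> \<tau> :: real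
  assumes cont: "continuous_on UNIV N" and pos: "\<And>v. v \<noteq> 0 \<Longrightarrow> N v > 0"
    and hom: "\<And>r v. r \<ge> 0 \<Longrightarrow> N (r *\<^sub>R v) = r * N v"
    and sgn: "\<bar>\<sigma>\<bar> = 1" "\<bar>\<tau>\<bar> = 1"
  shows "area {v. N v \<le> 1 \<and> \<sigma> * v $ 1 > 0 \<and> \<tau> * v $ 2 > 0}
       = integral {0..1} (\<lambda>s. 1 / (2 * (N (v2 (\<sigma> * (1 - s)) (\<tau> * s)))\<^sup>2))"
proof -
  let ?h = "\<lambda>s. 1 / (2 * (N (v2 (\<sigma> * (1 - s)) (\<tau> * s)))\<^sup>2)"
  have [measurable]: "N \<in> borel_measurable borel"
    using cont by (rule borel_measurable_continuous_onI)
  have nz: "\<sigma> \<noteq> 0" "\<tau> \<noteq> 0" using sgn by auto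
  have p: "N (v2 (\<sigma> * (1 - s)) (\<tau> * s)) \<noteq> 0" for s
    using pos[of "v2 (\<sigma> * (1 - s)) (\<tau> * s)"] nz by (cases "s = 0") auto
  have c: "continuous_on {0..1} ?h"
    using p by (intro continuous_intros continuous_on_compose2[OF cont]) auto
  have ae: "AE s in lborel. ennreal (?h s) * indicator {0<..<1} s = ennreal (?h s) * indicator {0..1} s"
    using AE_lborel_singleton[of 0] AE_lborel_singleton[of 1]
    by eventually_elim (auto simp: indicator_def)
  have "emeasure lborel {v. N v \<le> 1 \<and> \<sigma> * v $ 1 > 0 \<and> \<tau> * v $ 2 > 0}
       = (\<integral>\<^sup>+s. ennreal (?h s) * indicator {0<..<1} s \<partial>lborel)"
    by (rule emeasure_quadrant[OF assms])
  also have "\<dots> = (\<integral>\<^sup>+s. ennreal (?h s) * indicator {0..1} s \<partial>lborel)"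
    by (rule nn_integral_cong_AE[OF ae])
  also have "\<dots> = ennreal (integral {0..1} ?h)"
    by (rule nn_integral_has_integral_lebesgue')
       (use integrable_integral[OF integrable_continuous_real[OF c]] in simp_all)
  finally have "emeasure lborel {v. N v \<le> 1 \<and> \<sigma> * v $ 1 > 0 \<and> \<tau> * v $ 2 > 0} = ennreal (integral {0..1} ?h)" .
  moreover have "{v. N v \<le> 1 \<and> \<sigma> * v $ 1 > 0 \<and> \<tau> * v $ 2 > 0} \<in> sets lborel"
    by measurable
  moreover have "integral {0..1} ?h \<ge> 0"
    by (rule integral_nonneg) (use c in \<open>auto intro!: integrable_continuous_real\<close>)
  ultimately show ?thesis
    by (simp add: measure_def emeasure_completion main_part_sets)
qed

section \<open>Transport in a quadrant\<close>

text \<open>\<open>arctan (exp q)\<close> is the polar angle of a point whose slope has the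
  logarithm \<open>q\<close>.\<close>

lemma arctan_exp_has_real_derivative:
  fixes q :: "real \<Rightarrow> real"
  assumes "(q has_real_derivative q') (at u)"
  shows "((\<lambda>u. arctan (exp (q u))) has_real_derivative q' / (2 * cosh (q u))) (at u)"
proof -
  define e where "e = exp (q u)"
  have e: "e > 0" by (simp add: e_def)
  have "2 * cosh (q u) = e + 1 / e"
    by (simp add: cosh_field_def e_def exp_minus inverse_eq_divide)
  then have "1 + e\<^sup>2 = e * (2 * cosh (q u))"
    using e by (simp add: distrib_left power2_eq_square)
  moreover have "((\<lambda>u. arctan (exp (q u))) has_real_derivative inverse (1 + e\<^sup>2) * (e * q')) (at u)"
  proof -
    have "((\<lambda>u. exp (q u)) has_real_derivative exp (q u) * q') (at u)"
      using DERIV_fun_exp[OF assms] .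
    from DERIV_chain2[where f = arctan and g = "\<lambda>u. exp (q u)" and x = u, OF DERIV_arctan this]
    show ?thesis unfolding e_def .
  qed
  moreover have "inverse (e * (2 * cosh (q u))) * (e * q') = q' / (2 * cosh (q u))"
    using e by (simp add: field_simps)
  ultimately show ?thesis by (simp only:)
qed

lemma arctan_exp_lipschitz: "\<bar>arctan (exp x) - arctan (exp y)\<bar> \<le> \<bar>x - y\<bar>" for x y :: real
proof -
  have *: "arctan (exp b) - arctan (exp a) \<le> b - a" if "a \<le> b" for a b :: real
  proof -
    have "a - arctan (exp a) \<le> b - arctan (exp b)"
    proof (rule DERIV_nonneg_imp_nondecreasing[OF that])
      fix x :: real
      have "((\<lambda>x. x - arctan (exp x)) has_real_derivative 1 - 1 / (2 * cosh x)) (at x)"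
        using DERIV_diff[OF DERIV_ident arctan_exp_has_real_derivative[where q = "\<lambda>x. x"]] DERIV_ident by blast
      moreover have "1 / (2 * cosh x) \<le> 1"
        using cosh_real_ge_1[of x] by (simp add: field_simps)
      ultimately show "\<exists>y. ((\<lambda>x. x - arctan (exp x)) has_real_derivative y) (at x) \<and> y \<ge> 0"
        by (intro exI conjI) auto
    qed
    then show ?thesis by simp
  qed
  show ?thesis
  proof (cases "x \<le> y")
    case True
    then show ?thesis using *[OF True] arctan_monotone'[of "exp x" "exp y"] by simp
  next
    case False
    then have "y \<le> x" by simp
    then show ?thesis using *[of y x] arctan_monotone'[of "exp y" "exp x"] by simp
  qed
qed

text \<open>Since \<open>arctan x \<le> x\<close>, a direction at an angle of at least
  \<open>m\<close> from both axes has its slope between \<open>m\<close> and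
  \<open>1 / m\<close>.\<close>

lemma cosh_le_of_arctan_exp:
  fixes q m :: real
  assumes "m \<le> arctan (exp q)" "arctan (exp q) \<le> pi / 2 - m" "0 < m"
  shows "cosh q \<le> 1 / m" "\<bar>sinh q\<bar> \<le> 1 / m"
proof -
  have 1: "exp q \<ge> m"
    using assms arctan_le_self[of "exp q"] by simp
  have "arctan (exp (- q)) = pi / 2 - arctan (exp q)"
    using arctan_inverse[of "exp q"] by (simp add: exp_minus inverse_eq_divide)
  then have 2: "exp (- q) \<ge> m"
    using assms arctan_le_self[of "exp (-q)"] by simp
  have 3: "exp (- q) \<le> 1 / m" "exp q \<le> 1 / m"
    using 1 2 assms by (simp_all add: exp_minus field_simps)
  show "cosh q \<le> 1 / m"
    using 3 by (simp add: cosh_field_def)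
  show "\<bar>sinh q\<bar> \<le> 1 / m"
  proof -
    define r where "r = 1 / m"
    define x y where "x = exp q" and "y = exp (- q)"
    have "y \<le> r" "x \<le> r" using 3 by (simp_all add: r_def x_def y_def)
    moreover have "x > 0" "y > 0" by (simp_all add: x_def y_def)
    moreover have "sinh q = (x - y) / 2" by (simp add: sinh_field_def x_def y_def)
    ultimately have "\<bar>sinh q\<bar> \<le> r" by (simp add: abs_le_iff)
    then show ?thesis by (simp add: r_def)
  qed
qed

lemma cosh_add_le: "cosh (x + h) \<le> cosh x * exp \<bar>h\<bar>" for x h :: real
proof -
  have "exp (x + h) \<le> exp x * exp \<bar>h\<bar>" "exp (- (x + h)) \<le> exp (- x) * exp \<bar>h\<bar>"
    by (simp_all flip: exp_add)
  then show ?thesis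
    by (simp add: cosh_field_def algebra_simps)
qed

text \<open>\<open>X\<close> and \<open>Y\<close> are the logarithms of the slopes of two points moving through a quadrant;
  \<open>\<omega>\<close> is the angle of the point that is their coordinatewise geometric mean.\<close>

locale transport =
  fixes X Y X' Y' :: "real \<Rightarrow> real" and \<Sigma> :: real
  assumes X: "\<And>u. 0 < u \<Longrightarrow> u < 1 \<Longrightarrow> (X has_real_derivative X' u) (at u)"
    and Y: "\<And>u. 0 < u \<Longrightarrow> u < 1 \<Longrightarrow> (Y has_real_derivative Y' u) (at u)"
    and pos: "\<And>u. 0 < u \<Longrightarrow> u < 1 \<Longrightarrow> X' u > 0" "\<And>u. 0 < u \<Longrightarrow> u < 1 \<Longrightarrow> Y' u > 0"
    and \<Sigma>: "\<Sigma> > 0"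
    and prod: "\<And>u. 0 < u \<Longrightarrow> u < 1 \<Longrightarrow> X' u * Y' u \<ge> (2 * \<Sigma> * cosh ((X u + Y u) / 2))\<^sup>2"
    and lim0: "filterlim X at_bot (at_right 0)" "filterlim Y at_bot (at_right 0)"
    and lim1: "filterlim X at_top (at_left 1)" "filterlim Y at_top (at_left 1)"
begin

definition q where "q u = (X u + Y u) / 2"
definition q' where "q' u = (X' u + Y' u) / 2"
definition z where "z u = X u - Y u"
definition z' where "z' u = X' u - Y' u"
definition \<omega> where "\<omega> u = arctan (exp (q u))"
text \<open>The excess of the speed of \<open>\<omega>\<close> over \<open>\<Sigma>\<close>. As
  \<open>\<omega>\<close> climbs from 0 to \<open>pi / 2\<close> in unit time, its integral is
  \<open>pi / 2 - \<Sigma>\<close>, which measures the deficit.\<close>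

definition f where "f u = q' u / (2 * cosh (q u)) - \<Sigma>"

lemma q_deriv: "0 < u \<Longrightarrow> u < 1 \<Longrightarrow> (q has_real_derivative q' u) (at u)"
  unfolding q_def q'_def by (auto intro!: derivative_eq_intros X Y)

lemma z_deriv: "0 < u \<Longrightarrow> u < 1 \<Longrightarrow> (z has_real_derivative z' u) (at u)"
  unfolding z_def z'_def by (auto intro!: derivative_eq_intros X Y)

lemma \<omega>_deriv: "0 < u \<Longrightarrow> u < 1 \<Longrightarrow> (\<omega> has_real_derivative \<Sigma> + f u) (at u)"
  using arctan_exp_has_real_derivative[OF q_deriv] unfolding \<omega>_def f_def by simp

lemma q'_eq: "q' u = 2 * cosh (q u) * (\<Sigma> + f u)"
  by (simp add: f_def)

text \<open>The square of the arithmetic mean of \<open>X'\<close> and \<open>Y'\<close> exceeds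
  their product by the square of half the difference. The loss in the inequality of the means
  therefore controls \<open>z'\<close>.\<close>

lemma q'_sq: "0 < u \<Longrightarrow> u < 1 \<Longrightarrow> (q' u)\<^sup>2 \<ge> (2 * \<Sigma> * cosh (q u))\<^sup>2 + (z' u / 2)\<^sup>2"
proof -
  assume u: "0 < u" "u < 1"
  have "(q' u)\<^sup>2 = X' u * Y' u + (z' u / 2)\<^sup>2"
    by (simp add: q'_def z'_def power2_eq_square field_simps)
  then show ?thesis using prod[OF u] by (simp add: q_def)
qed

lemma f_nonneg: "0 < u \<Longrightarrow> u < 1 \<Longrightarrow> f u \<ge> 0"
proof -
  assume u: "0 < u" "u < 1"
  have "(q' u)\<^sup>2 \<ge> (2 * \<Sigma> * cosh (q u))\<^sup>2"
    using q'_sq[OF u] by (smt (verit) zero_le_power2)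
  moreover have "q' u \<ge> 0" using pos[OF u] by (simp add: q'_def)
  ultimately have "2 * \<Sigma> * cosh (q u) \<le> q' u"
    by (rule power2_le_imp_le)
  then show ?thesis by (simp add: f_def field_simps)
qed

lemma z'_sq: "0 < u \<Longrightarrow> u < 1 \<Longrightarrow> (z' u / 2)\<^sup>2 \<le> 4 * (cosh (q u))\<^sup>2 * (f u * (f u + 2 * \<Sigma>))"
  using q'_sq[of u] unfolding q'_eq by (simp add: power2_eq_square algebra_simps)

text \<open>\<open>\<omega> u - \<Sigma> * u\<close> is an antiderivative of \<open>f\<close>;
  below, its increments stand in for integrals of \<open>f\<close>.\<close>

lemma \<omega>_mono: 
  assumes "0 < a" "a \<le> b" "b < 1"
  shows "\<omega> a - \<Sigma> * a \<le> \<omega> b - \<Sigma> * b"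
proof (rule DERIV_nonneg_imp_nondecreasing[OF \<open>a \<le> b\<close>])
  fix u assume "a \<le> u" "u \<le> b"
  then have u: "0 < u" "u < 1" using assms by auto
  have "((\<lambda>u. \<omega> u - \<Sigma> * u) has_real_derivative (\<Sigma> + f u) - \<Sigma>) (at u)"
    by (auto intro!: derivative_eq_intros \<omega>_deriv u)
  then show "\<exists>y. ((\<lambda>u. \<omega> u - \<Sigma> * u) has_real_derivative y) (at u) \<and> 0 \<le> y"
    using f_nonneg[OF u] by auto
qed

lemma \<omega>_lim0: "(\<omega> \<longlongrightarrow> 0) (at_right 0)"
proof -
  have "filterlim (\<lambda>u. - X u + - Y u) at_top (at_right 0)"
    using lim0 unfolding filterlim_uminus_at_bot by (rule filterlim_at_top_add_at_top)
  then have "filterlim (\<lambda>u. X u + Y u) at_bot (at_right 0)"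
    unfolding filterlim_uminus_at_bot by simp
  then have "filterlim q at_bot (at_right 0)"
    unfolding q_def filterlim_at_bot by (simp add: field_simps)
  then have "((\<lambda>u. exp (q u)) \<longlongrightarrow> 0) (at_right 0)"
    by (rule filterlim_compose[OF exp_at_bot])
  then have "((\<lambda>u. arctan (exp (q u))) \<longlongrightarrow> arctan 0) (at_right 0)"
    by (rule tendsto_arctan)
  then show ?thesis by (simp add: \<omega>_def[abs_def])
qed

lemma \<omega>_lim1: "(\<omega> \<longlongrightarrow> pi / 2) (at_left 1)"
proof -
  have "filterlim (\<lambda>u. X u + Y u) at_top (at_left 1)"
    by (rule filterlim_at_top_add_at_top[OF lim1])
  then have "filterlim q at_top (at_left 1)"
    unfolding q_def filterlim_at_top by (simp add: field_simps)
  then have "filterlim (\<lambda>u. exp (q u)) at_top (at_left 1)"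
    by (rule filterlim_compose[OF exp_at_top])
  then have "((\<lambda>u. arctan (exp (q u))) \<longlongrightarrow> pi / 2) (at_left 1)"
    by (rule filterlim_compose[OF tendsto_arctan_at_top])
  then show ?thesis by (simp add: \<omega>_def[abs_def])
qed

lemma \<omega>_lower:
  assumes u: "0 < u" "u < 1"
  shows "\<Sigma> * u \<le> \<omega> u"
proof -
  have "((\<lambda>a. \<omega> a - \<Sigma> * a) \<longlongrightarrow> 0 - \<Sigma> * 0) (at_right 0)"
    by (intro tendsto_intros \<omega>_lim0)
  then have "0 - \<Sigma> * 0 \<le> \<omega> u - \<Sigma> * u"
  proof (rule tendsto_upperbound)
    show "\<forall>\<^sub>F a in at_right 0. \<omega> a - \<Sigma> * a \<le> \<omega> u - \<Sigma> * u"
      using eventually_at_right_less[of "0::real"] order_tendstoD(2)[OF tendsto_ident_at u(1)]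
      by eventually_elim (use \<omega>_mono u in auto)
  qed auto
  then show ?thesis by simp
qed

lemma \<omega>_upper:
  assumes u: "0 < u" "u < 1"
  shows "\<omega> u \<le> \<Sigma> * u + (pi / 2 - \<Sigma>)"
proof -
  have "((\<lambda>b. \<omega> b - \<Sigma> * b) \<longlongrightarrow> pi / 2 - \<Sigma> * 1) (at_left 1)"
    by (intro tendsto_intros \<omega>_lim1)
  then have "\<omega> u - \<Sigma> * u \<le> pi / 2 - \<Sigma> * 1"
  proof (rule tendsto_lowerbound)
    show "\<forall>\<^sub>F b in at_left 1. \<omega> u - \<Sigma> * u \<le> \<omega> b - \<Sigma> * b"
      using eventually_at_left_real[OF u(2)]
      by eventually_elim (use \<omega>_mono u in auto)
  qed auto
  then show ?thesis by simp
qed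

text \<open>The Blaschke-Santalo inequality of one quadrant: \<open>\<omega>\<close> has a right
  angle to cover in unit time, at speed at least \<open>\<Sigma>\<close>.\<close>

lemma \<Sigma>_le: "\<Sigma> \<le> pi / 2"
  using \<omega>_lower[of "1/2"] \<omega>_upper[of "1/2"] by simp

text \<open>For small \<open>f\<close>, \<open>\<bar>z'\<bar>\<close> is of order
  \<open>cosh (q u) * sqrt (f u)\<close>. The inequality of the means splits this into
  \<open>f / m ^ 3\<close> and a multiple of \<open>m ^ 3 * (cosh (q u))\<^sup>2\<close>; with this
  weight both terms have integrals of order \<open>m\<^sup>2\<close>.\<close>

lemma z_lipschitz_aux:
  assumes m: "0 < m" and u: "0 < u" "u < 1" and c: "cosh (q u) \<le> 1 / m" and S1: "\<Sigma> \<ge> 1"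
  shows "\<bar>z' u\<bar> \<le> (4 / m + 1 / m ^ 3) * f u + 8 * m ^ 3 * (cosh (q u) * q' u)"
proof -
  define C where "C = cosh (q u)"
  define F where "F = f u"
  have F: "F \<ge> 0" using f_nonneg[OF u] by (simp add: F_def)
  have C: "C > 0" by (simp add: C_def)
  have "F * (F + 2 * \<Sigma>) \<le> F * (F + 4)"
    by (rule mult_left_mono[OF _ F]) (use \<Sigma>_le pi_less_4 in linarith)
  then have "4 * C\<^sup>2 * (F * (F + 2 * \<Sigma>)) \<le> 4 * C\<^sup>2 * (F * (F + 4))"
    by (rule mult_left_mono) simp
  then have "(z' u / 2)\<^sup>2 \<le> 4 * C\<^sup>2 * (F * (F + 4))"
    using z'_sq[OF u, folded C_def F_def] by (rule order_trans[rotated])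
  then have "(z' u)\<^sup>2 \<le> 16 * C\<^sup>2 * (F * (F + 4))"
    by (simp add: power_divide)
  also have "16 * C\<^sup>2 * (F * (F + 4)) = (4 * C * F)\<^sup>2 + 4 * (F / m ^ 3) * (16 * m ^ 3 * C\<^sup>2)"
    using m by (simp add: power2_eq_square field_simps)
  also have "\<dots> \<le> (4 * C * F + (F / m ^ 3 + 16 * m ^ 3 * C\<^sup>2))\<^sup>2"
  proof -
    have "4 * x * y \<le> (x + y)\<^sup>2" for x y :: real
      using zero_le_power2[of "x - y"] by (simp add: power2_eq_square algebra_simps)
    then have "4 * (F / m ^ 3) * (16 * m ^ 3 * C\<^sup>2) \<le> (F / m ^ 3 + 16 * m ^ 3 * C\<^sup>2)\<^sup>2" .
    moreover have "0 \<le> 4 * C * F * (F / m ^ 3 + 16 * m ^ 3 * C\<^sup>2)"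
      using C F m by simp
    ultimately show ?thesis by (simp add: power2_sum)
  qed
  finally have "\<bar>z' u\<bar> \<le> 4 * C * F + (F / m ^ 3 + 16 * m ^ 3 * C\<^sup>2)"
    by (rule abs_le_square_iff[THEN iffD2, THEN order_trans]) (use C F m in auto)
  moreover have "4 * C * F \<le> 4 * (1 / m) * F"
    using c F by (intro mult_right_mono mult_left_mono) (auto simp: C_def)
  \<comment> \<open>Multiplying by \<open>\<Sigma> + F\<close>, which is at least 1, completes one
    factor \<open>C\<close> to \<open>q'\<close>, and \<open>C * q' u\<close> is the derivative of
    \<open>sinh (q u)\<close>.\<close>
  moreover have "16 * m ^ 3 * C\<^sup>2 \<le> 16 * m ^ 3 * C\<^sup>2 * (\<Sigma> + F)"
    using m S1 F C by simp
  moreover have "16 * m ^ 3 * C\<^sup>2 * (\<Sigma> + F) = 8 * m ^ 3 * (C * q' u)"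
    by (simp add: q'_eq C_def F_def power2_eq_square algebra_simps)
  ultimately show ?thesis
    unfolding C_def[symmetric] F_def[symmetric] by (simp add: algebra_simps)
qed

text \<open>Of the bound, \<open>16 * m\<^sup>2\<close> is the variation of
  \<open>8 * m ^ 3 * sinh (q u)\<close>, since \<open>\<bar>sinh (q u)\<bar> \<le> 1 / m\<close> in
  this range of angles; the remaining \<open>2 * m\<^sup>2\<close> comes from the integral of
  \<open>f\<close>.\<close>

lemma z_lipschitz:
  assumes m: "0 < m" "m \<le> 1 / 2" and ab: "0 < a" "a \<le> b" "b < 1" and S1: "\<Sigma> \<ge> 1"
    and d: "pi / 2 - \<Sigma> \<le> m ^ 5"
    and \<omega>: "m \<le> \<omega> a" "\<omega> b \<le> pi / 2 - m"
  shows "\<bar>z b - z a\<bar> \<le> 18 * m\<^sup>2"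
proof -
  \<comment> \<open>An antiderivative of the bound for \<open>\<bar>z'\<bar>\<close>, so that both
    \<open>G - z\<close> and \<open>G + z\<close> are nondecreasing on
    \<open>{a..b}\<close>.\<close>
  define G where "G u = (4 / m + 1 / m ^ 3) * (\<omega> u - \<Sigma> * u) + 8 * m ^ 3 * sinh (q u)" for u
  define G' where "G' u = (4 / m + 1 / m ^ 3) * f u + 8 * m ^ 3 * (cosh (q u) * q' u)" for u
  have range: "m \<le> \<omega> u \<and> \<omega> u \<le> pi / 2 - m" if "a \<le> u" "u \<le> b" for u
  proof -
    have "\<Sigma> * (u - a) \<ge> 0" "\<Sigma> * (b - u) \<ge> 0" using that \<Sigma> by auto
    then show ?thesis
      using \<omega>_mono[of a u] \<omega>_mono[of u b] that ab \<omega> by (simp add: algebra_simps)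
  qed
  have G: "(G has_real_derivative G' u) (at u)" and le: "\<bar>z' u\<bar> \<le> G' u" and u: "0 < u" "u < 1"
    if "a \<le> u" "u \<le> b" for u
  proof -
    show u: "0 < u" "u < 1" using that ab by auto
    have "((\<lambda>u. \<omega> u - \<Sigma> * u) has_real_derivative f u) (at u)"
      by (auto intro!: derivative_eq_intros \<omega>_deriv u)
    moreover have "((\<lambda>u. sinh (q u)) has_real_derivative cosh (q u) * q' u) (at u)"
      by (rule derivative_eq_intros q_deriv u refl)+
    ultimately show "(G has_real_derivative G' u) (at u)"
      unfolding G_def G'_def by (intro DERIV_add DERIV_cmult)
    have "cosh (q u) \<le> 1 / m"
      using cosh_le_of_arctan_exp(1)[of m "q u"] range[OF that] m by (simp add: \<omega>_def)
    then show "\<bar>z' u\<bar> \<le> G' u"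
      unfolding G'_def by (intro z_lipschitz_aux m u S1)
  qed
  have "G a - z a \<le> G b - z b"
  proof (rule DERIV_nonneg_imp_nondecreasing[OF \<open>a \<le> b\<close>])
    fix u assume *: "a \<le> u" "u \<le> b"
    show "\<exists>y. ((\<lambda>u. G u - z u) has_real_derivative y) (at u) \<and> 0 \<le> y"
      using DERIV_diff[OF G[OF *] z_deriv[OF u[OF *]]] le[OF *] by (intro exI conjI) auto
  qed
  moreover have "G a + z a \<le> G b + z b"
  proof (rule DERIV_nonneg_imp_nondecreasing[OF \<open>a \<le> b\<close>])
    fix u assume *: "a \<le> u" "u \<le> b"
    show "\<exists>y. ((\<lambda>u. G u + z u) has_real_derivative y) (at u) \<and> 0 \<le> y"
      using DERIV_add[OF G[OF *] z_deriv[OF u[OF *]]] le[OF *] by (intro exI conjI) auto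
  qed
  moreover have "G b - G a \<le> 18 * m\<^sup>2"
  proof -
    have "\<omega> b - \<Sigma> * b - (\<omega> a - \<Sigma> * a) \<le> m ^ 5"
      using \<omega>_upper[of b] \<omega>_lower[of a] ab d by simp
    then have "(4 / m + 1 / m ^ 3) * (\<omega> b - \<Sigma> * b - (\<omega> a - \<Sigma> * a)) \<le> (4 / m + 1 / m ^ 3) * m ^ 5"
      using m by (intro mult_left_mono) auto
    also have "(4 / m + 1 / m ^ 3) * m ^ 5 = (4 * m\<^sup>2 + 1) * m\<^sup>2"
      using m by (simp add: field_simps eval_nat_numeral)
    also have "\<dots> \<le> 2 * m\<^sup>2"
    proof -
      have "m\<^sup>2 \<le> (1/2)\<^sup>2" using m by (intro power_mono) auto
      then show ?thesis by (intro mult_right_mono) (auto simp: power2_eq_square)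
    qed
    finally have 1: "(4 / m + 1 / m ^ 3) * (\<omega> b - \<Sigma> * b - (\<omega> a - \<Sigma> * a)) \<le> 2 * m\<^sup>2" .
    have "sinh (q b) - sinh (q a) \<le> 2 / m"
      using cosh_le_of_arctan_exp(2)[of m "q a"] cosh_le_of_arctan_exp(2)[of m "q b"]
        range[of a] range[of b] ab m by (simp add: \<omega>_def)
    then have "8 * m ^ 3 * (sinh (q b) - sinh (q a)) \<le> 8 * m ^ 3 * (2 / m)"
      using m by (intro mult_left_mono) auto
    also have "\<dots> = 16 * m\<^sup>2" using m by (simp add: field_simps eval_nat_numeral)
    finally show ?thesis using 1 by (simp add: G_def algebra_simps)
  qed
  ultimately show ?thesis by linarith
qed

text \<open>An excess above \<open>m ^ 4\<close> on the whole interval would add up to at least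
  \<open>2 * m ^ 5\<close>, twice what is available.\<close>

lemma good_point:
  assumes m: "0 < m" and d: "pi / 2 - \<Sigma> \<le> m ^ 5" and ab: "0 < a" "b < 1" "b - a = 2 * m"
  shows "\<exists>u\<in>{a..b}. f u \<le> m ^ 4"
proof (rule ccontr)
  assume "\<not> ?thesis"
  then have *: "f u > m ^ 4" if "a \<le> u" "u \<le> b" for u using that by force
  have "a \<le> b" using ab m by simp
  then have "\<omega> a - (\<Sigma> + m ^ 4) * a \<le> \<omega> b - (\<Sigma> + m ^ 4) * b"
  proof (rule DERIV_nonneg_imp_nondecreasing)
    fix u assume u: "a \<le> u" "u \<le> b"
    have "((\<lambda>u. \<omega> u - (\<Sigma> + m ^ 4) * u) has_real_derivative (\<Sigma> + f u) - (\<Sigma> + m ^ 4)) (at u)"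
      using u ab by (auto intro!: derivative_eq_intros \<omega>_deriv)
    then show "\<exists>y. ((\<lambda>u. \<omega> u - (\<Sigma> + m ^ 4) * u) has_real_derivative y) (at u) \<and> 0 \<le> y"
      using *[OF u] by (intro exI conjI) auto
  qed
  then have "m ^ 4 * (b - a) \<le> (\<omega> b - \<Sigma> * b) - (\<omega> a - \<Sigma> * a)"
    by (simp add: algebra_simps)
  also have "\<dots> \<le> m ^ 5"
    using \<omega>_upper[of b] \<omega>_lower[of a] ab d m by simp
  finally have "2 * m ^ 5 \<le> m ^ 5" unfolding ab(3) by (simp add: eval_nat_numeral)
  then show False using m by simp
qed

text \<open>\<open>X' = 2 * \<Sigma> * cosh (X - c / 2)\<close> is the law of motion along an
  ellipse. There are two sources of error: \<open>z'\<close> is of order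
  \<open>cosh (q u) * sqrt (f u)\<close>, and replacing \<open>q u\<close> by
  \<open>X u - c / 2\<close> shifts the argument of \<open>cosh\<close> by
  \<open>(z u - c) / 2\<close>. Both are of relative order \<open>m\<^sup>2\<close>.\<close>

lemma X'_good:
  assumes m: "0 < m" "m \<le> 1 / 100" and u: "0 < u" "u < 1" and S: "\<Sigma> \<ge> 7 / 5"
    and good: "f u \<le> m ^ 4" and zc: "\<bar>z u - c\<bar> \<le> 18 * m\<^sup>2"
  shows "\<bar>X' u / (2 * \<Sigma> * cosh (X u - c / 2)) - 1\<bar> \<le> 25 * m\<^sup>2"
proof -
  define C where "C = cosh (q u)"
  have C: "C > 0" by (simp add: C_def)
  define M where "M = m\<^sup>2"
  have M: "0 < M" "M \<le> 1 / 10000"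
    using m power_mono[of m "1/100" 2] by (auto simp: M_def power2_eq_square)
  have F: "0 \<le> f u" "f u \<le> M\<^sup>2" using good f_nonneg[OF u] by (auto simp: M_def)
  have M2: "M\<^sup>2 \<le> M / 100" using M by (simp add: power2_eq_square)
  have "f u * (f u + 2 * \<Sigma>) \<le> M\<^sup>2 * (441 / 100)"
    using F \<Sigma>_le \<Sigma> pi_less_4 M2 M by (intro mult_mono) linarith+
  then have "4 * C\<^sup>2 * (f u * (f u + 2 * \<Sigma>)) \<le> 4 * C\<^sup>2 * (M\<^sup>2 * (441 / 100))"
    by (intro mult_left_mono) auto
  also have "\<dots> = (42 / 10 * C * M)\<^sup>2" by (simp add: power2_eq_square)
  finally have "(z' u / 2)\<^sup>2 \<le> (42 / 10 * C * M)\<^sup>2"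
    using z'_sq[OF u] by (simp add: C_def)
  then have z': "\<bar>z' u / 2\<bar> \<le> 42 / 10 * C * M"
    using C M by (simp add: abs_le_square_iff[symmetric])
  define P where "P = X' u / (2 * \<Sigma> * C)"
  have *: "X' u = 2 * C * (\<Sigma> + f u) + z' u / 2"
    using q'_eq[of u] by (simp add: q'_def z'_def C_def field_simps)
  have **: "P = (2 * \<Sigma> * C + 2 * C * f u + z' u / 2) / (2 * \<Sigma> * C)"
    unfolding P_def * by (simp add: algebra_simps)
  have "P - 1 = f u / \<Sigma> + (z' u / 2) / (2 * \<Sigma> * C)"
  proof -
    have "2 * \<Sigma> * C / (2 * \<Sigma> * C) = 1" "2 * C * f u / (2 * \<Sigma> * C) = f u / \<Sigma>"
      using C \<Sigma> by simp_all
    then show ?thesis unfolding ** add_divide_distrib by linarith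
  qed
  moreover have "\<bar>f u / \<Sigma>\<bar> \<le> M / 100"
  proof -
    have "M / 100 * 1 \<le> M / 100 * \<Sigma>" using S M by (intro mult_left_mono) auto
    then have "f u \<le> M / 100 * \<Sigma>" using F(2) M2 by linarith
    then show ?thesis using F(1) \<Sigma> by (simp add: field_simps)
  qed
  moreover have "\<bar>(z' u / 2) / (2 * \<Sigma> * C)\<bar> \<le> 15 / 10 * M"
  proof -
    have "\<bar>(z' u / 2) / (2 * \<Sigma> * C)\<bar> = \<bar>z' u / 2\<bar> / (2 * \<Sigma> * C)"
      using C \<Sigma> by (simp add: abs_mult)
    also have "\<dots> \<le> (42 / 10 * C * M) / (2 * \<Sigma> * C)"
      using C \<Sigma> by (intro divide_right_mono z') auto
    also have "\<dots> = 21 / 10 * M / \<Sigma>" using C \<Sigma> by (simp add: field_simps)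
    also have "\<dots> \<le> 21 / 10 * M / (7 / 5)" using S M by (intro divide_left_mono) auto
    finally show ?thesis by simp
  qed
  ultimately have P: "\<bar>P - 1\<bar> \<le> 2 * M" using M by linarith
  define h where "h = (z u - c) / 2"
  have h: "\<bar>h\<bar> \<le> 9 * M" using zc by (simp add: h_def M_def)
  define D where "D = cosh (X u - c / 2)"
  have D: "D > 0" by (simp add: D_def)
  have Dq: "X u - c / 2 = q u + h" by (simp add: q_def z_def h_def field_simps)
  have "D \<le> C * exp \<bar>h\<bar>" "C \<le> D * exp \<bar>h\<bar>"
    using cosh_add_le[of "q u" h] cosh_add_le[of "q u + h" "-h"] by (simp_all add: D_def C_def Dq)
  moreover have e: "exp \<bar>h\<bar> \<le> 1 + 18 * M"
  proof -
    have "exp \<bar>h\<bar> \<le> 1 + \<bar>h\<bar> + \<bar>h\<bar>\<^sup>2" using h M by (intro exp_bound) auto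
    moreover have "\<bar>h\<bar>\<^sup>2 \<le> \<bar>h\<bar> * 1" unfolding power2_eq_square using h M by (intro mult_left_mono) auto
    ultimately show ?thesis using h by linarith
  qed
  ultimately have "D \<le> C * (1 + 18 * M)" "C \<le> D * (1 + 18 * M)"
    using C D by (meson mult_left_mono order_trans less_imp_le)+
  then have R: "C / D \<le> 1 + 18 * M" "1 \<le> (C / D) * (1 + 18 * M)"
    using D by (simp_all add: field_simps)
  have R2: "C / D \<ge> 1 - 18 * M"
  proof -
    have "(1 - 18 * M) * (1 + 18 * M) \<le> 1" using M by (simp add: algebra_simps)
    then have "(1 - 18 * M) * (1 + 18 * M) \<le> (C / D) * (1 + 18 * M)" using R(2) by linarith
    then show ?thesis by (rule mult_right_le_imp_le) (use M in simp)
  qed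
  have "X' u / (2 * \<Sigma> * D) = P * (C / D)" using C D \<Sigma> by (simp add: P_def)
  then have "X' u / (2 * \<Sigma> * D) - 1 = (P - 1) * (C / D) + (C / D - 1)"
    by (simp only: left_diff_distrib)
  moreover have "\<bar>(P - 1) * (C / D)\<bar> \<le> 2 * M * 2"
    unfolding abs_mult using P R R2 C D M by (intro mult_mono) auto
  ultimately have "\<bar>X' u / (2 * \<Sigma> * D) - 1\<bar> \<le> 25 * M" using R(1) R2 M by linarith
  then show ?thesis by (simp add: D_def M_def)
qed

lemma dense_good_points:
  assumes m: "0 < m" "m \<le> 1 / 100" and d: "pi / 2 - \<Sigma> \<le> m ^ 5"
  shows "\<exists>c. \<forall>\<theta>. 6 * m \<le> \<theta> \<and> \<theta> \<le> pi / 2 - 6 * m \<longrightarrow>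
    (\<exists>u. 0 < u \<and> u < 1 \<and> \<bar>arctan (exp (X u - c / 2)) - \<theta>\<bar> \<le> 5 * m \<and>
      \<bar>X' u / (2 * \<Sigma> * cosh (X u - c / 2)) - 1\<bar> \<le> 25 * m\<^sup>2)"
\<comment> \<open>\<open>z\<close> is nearly constant away from the axes; the constant is read off
  at half time, where \<open>\<omega>\<close> is close to \<open>pi / 4\<close>.\<close>
proof (rule exI[of _ "z (1/2)"], intro allI impI)
  fix \<theta> assume \<theta>: "6 * m \<le> \<theta> \<and> \<theta> \<le> pi / 2 - 6 * m"
  have m5: "m ^ 5 \<le> m / 100"
  proof -
    have "m ^ 4 \<le> (1/100) ^ 4" using m by (intro power_mono) auto
    also have "\<dots> \<le> (1/100 :: real)" by (simp add: eval_nat_numeral)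
    finally have "m * m ^ 4 \<le> m * (1/100)" using m by (intro mult_left_mono) auto
    then show ?thesis by (simp add: eval_nat_numeral)
  qed
  have m2: "m\<^sup>2 \<le> m / 100" using m by (simp add: power2_eq_square)
  have S: "\<Sigma> \<ge> 7 / 5" using d m5 m pi_gt3 by linarith
  \<comment> \<open>As \<open>\<omega> u\<close> is \<open>\<Sigma> * u\<close> up to
    \<open>m ^ 5\<close>, the time \<open>\<theta> / \<Sigma>\<close> aims at the angle
    \<open>\<theta>\<close>. Waiting up to \<open>2 * m\<close> for a good instant turns
    \<open>\<omega>\<close> by little more than \<open>4 * m\<close>, and the margin
    \<open>6 * m\<close> at the end absorbs this.\<close>
  define a where "a = \<theta> / \<Sigma>"
  define b where "b = a + 2 * m"
  have Sa: "\<Sigma> * a = \<theta>" using \<Sigma> by (simp add: a_def)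
  have Sm: "\<Sigma> * m \<le> 2 * m" using \<Sigma>_le pi_less_4 m by (intro mult_right_mono) auto
  have Sb: "\<Sigma> * b \<le> \<theta> + 4 * m" using Sa Sm by (simp add: b_def algebra_simps)
  have a: "0 < a" using \<theta> m \<Sigma> by (simp add: a_def)
  have b: "b < 1"
  proof -
    have "\<Sigma> * b < \<Sigma> * 1" using Sb \<theta> d m5 m by linarith
    then show ?thesis using \<Sigma> by (metis mult_less_cancel_left_pos)
  qed
  obtain u where u: "a \<le> u" "u \<le> b" and good: "f u \<le> m ^ 4"
    using good_point[OF m(1) d a b] by (auto simp: b_def)
  have u01: "0 < u" "u < 1" using a b u by auto
  have Su: "\<theta> \<le> \<Sigma> * u" "\<Sigma> * u \<le> \<theta> + 4 * m"
    using mult_left_mono[OF u(1), of \<Sigma>] mult_left_mono[OF u(2), of \<Sigma>] Sa Sb \<Sigma> by linarith+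
  have \<omega>u: "\<theta> \<le> \<omega> u" "\<omega> u \<le> \<theta> + 4 * m + m / 100"
    using \<omega>_lower[OF u01] \<omega>_upper[OF u01] Su d m5 by auto
  have \<omega>h: "\<Sigma> / 2 \<le> \<omega> (1/2)" "\<omega> (1/2) \<le> \<Sigma> / 2 + m / 100"
    using \<omega>_lower[of "1/2"] \<omega>_upper[of "1/2"] d m5 by auto
  have h: "m \<le> \<omega> (1/2)" "\<omega> (1/2) \<le> pi / 2 - m"
    using \<omega>h S m \<Sigma>_le pi_gt3 by linarith+
  have r: "m \<le> \<omega> u" "\<omega> u \<le> pi / 2 - m"
    using \<omega>u \<theta> m by linarith+
  have zc: "\<bar>z u - z (1/2)\<bar> \<le> 18 * m\<^sup>2"
  proof (cases "u \<le> 1/2")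
    case True
    then show ?thesis
      using z_lipschitz[of m u "1/2"] m u01 S d h r by (simp add: abs_minus_commute)
  next
    case False
    then show ?thesis
      using z_lipschitz[of m "1/2" u] m u01 S d h r by simp
  qed
  have "X u - z (1/2) / 2 = q u + (z u - z (1/2)) / 2"
    by (simp add: q_def z_def field_simps)
  then have "\<bar>arctan (exp (X u - z (1/2) / 2)) - \<omega> u\<bar> \<le> 9 * m\<^sup>2"
    using arctan_exp_lipschitz[of "X u - z (1/2) / 2" "q u"] zc by (simp add: \<omega>_def)
  then have "\<bar>arctan (exp (X u - z (1/2) / 2)) - \<theta>\<bar> \<le> 5 * m"
    using \<omega>u m2 m by linarith
  then show "\<exists>u. 0 < u \<and> u < 1 \<and> \<bar>arctan (exp (X u - z (1/2) / 2)) - \<theta>\<bar> \<le> 5 * m \<and>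
      \<bar>X' u / (2 * \<Sigma> * cosh (X u - z (1/2) / 2)) - 1\<bar> \<le> 25 * m\<^sup>2"
    using u01 X'_good[OF m u01 S good zc] by blast
qed

end

section \<open>Sweeping area at a constant rate, in logarithmic slopes\<close>

lemma transport_map:
  fixes K :: "real \<Rightarrow> real"
  assumes cont: "continuous_on {0..1} K" and pos: "\<And>x. x \<in> {0..1} \<Longrightarrow> K x > 0"
    and S: "S = integral {0..1} (\<lambda>x. 1 / (2 * (K x)\<^sup>2))"
  shows "S > 0" and "\<exists>s. (\<forall>u. 0 < u \<and> u < 1 \<longrightarrow> 0 < s u \<and> s u < 1 \<and>
      (s has_real_derivative 2 * S * (K (s u))\<^sup>2) (at u)) \<and>
      (s \<longlongrightarrow> 0) (at_right 0) \<and> (s \<longlongrightarrow> 1) (at_left 1)"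
proof -
  define \<phi> where "\<phi> x = 1 / (2 * (K x)\<^sup>2)" for x
  have \<phi>_pos: "\<phi> x > 0" if "x \<in> {0..1}" for x
    using pos[OF that] by (simp add: \<phi>_def)
  have c\<phi>: "continuous_on {0..1} \<phi>"
    unfolding \<phi>_def using pos by (intro continuous_intros cont) force
  have S': "S = integral {0..1} \<phi>" by (simp add: S \<phi>_def[abs_def])
  have "S \<ge> 0"
    unfolding S' by (intro integral_nonneg integrable_continuous_real c\<phi>) (use \<phi>_pos in force)
  moreover have "S \<noteq> 0"
    unfolding S' using \<phi>_pos by (subst integral_eq_0_iff[OF c\<phi>]) force+
  ultimately show S0: "S > 0" by simp
  \<comment> \<open>When \<open>K\<close> is a gauge along the segment from \<open>v2 1 0\<close> to
    \<open>v2 0 1\<close>, \<open>\<phi>\<close> is the density of area with respect to the segment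
    parameter. \<open>\<Phi>\<close> is then the fraction of area swept so far, and its inverse
    sweeps area at a constant rate.\<close>
  define \<Phi> where "\<Phi> x = integral {0..x} \<phi> / S" for x
  have d: "(\<Phi> has_real_derivative \<phi> x / S) (at x within {0..1})" if "x \<in> {0..1}" for x
    unfolding \<Phi>_def by (intro DERIV_cdivide integral_has_real_derivative c\<phi> that)
  have d': "(\<Phi> has_real_derivative \<phi> x / S) (at x)" if "0 < x" "x < 1" for x
    using d[of x] that at_within_Icc_at[of 0 x 1] by simp
  have c\<Phi>: "continuous_on {0..1} \<Phi>"
    using d by (rule DERIV_continuous_on)
  have \<Phi>0: "\<Phi> 0 = 0" and \<Phi>1: "\<Phi> 1 = 1"
    using S0 by (simp_all add: \<Phi>_def S'[symmetric])
  have mono: "\<Phi> a < \<Phi> b" if "a < b" "0 \<le> a" "b \<le> 1" for a b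
  proof (rule DERIV_pos_imp_increasing_open[OF that(1)])
    show "continuous_on {a..b} \<Phi>"
      by (rule continuous_on_subset[OF c\<Phi>]) (use that in auto)
    show "\<exists>y. (\<Phi> has_real_derivative y) (at x) \<and> 0 < y" if "a < x" "x < b" for x
      using d'[of x] \<phi>_pos[of x] S0 that \<open>0 \<le> a\<close> \<open>b \<le> 1\<close> by (intro exI[of _ "\<phi> x / S"]) auto
  qed
  have inj: "inj_on \<Phi> {0..1}"
  proof (rule inj_onI)
    fix x y assume "x \<in> {0..1}" "y \<in> {0..1}" "\<Phi> x = \<Phi> y"
    then show "x = y"
      using mono[of x y] mono[of y x] by (cases x y rule: linorder_cases) auto
  qed
  have img: "\<Phi> ` {0..1} = {0..1}"
  proof
    have "\<Phi> x \<in> {0..1}" if "x \<in> {0..1}" for x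
      using mono[of 0 x] mono[of x 1] that \<Phi>0 \<Phi>1 by (cases "x = 0"; cases "x = 1") auto
    then show "\<Phi> ` {0..1} \<subseteq> {0..1}" by auto
    show "{0..1} \<subseteq> \<Phi> ` {0..1}"
    proof
      fix y :: real assume "y \<in> {0..1}"
      then obtain x where "0 \<le> x" "x \<le> 1" "\<Phi> x = y"
        using IVT'[of \<Phi> 0 y 1] c\<Phi> \<Phi>0 \<Phi>1 by auto
      then show "y \<in> \<Phi> ` {0..1}" by force
    qed
  qed
  define s where "s = inv_into {0..1} \<Phi>"
  have s_in: "s u \<in> {0..1}" and s_eq: "\<Phi> (s u) = u" if "u \<in> {0..1}" for u
    using that inv_into_into[of u \<Phi> "{0..1}"] f_inv_into_f[of u \<Phi> "{0..1}"] by (auto simp: s_def img)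
  have s_inv: "s (\<Phi> x) = x" if "x \<in> {0..1}" for x
    using that inj by (simp add: s_def)
  have cs: "continuous_on {0..1} s"
    using continuous_on_inv[of "{0..1}" \<Phi> s] c\<Phi> s_inv img by simp
  have s0: "s 0 = 0" and s1: "s 1 = 1" using s_inv[of 0] s_inv[of 1] \<Phi>0 \<Phi>1 by auto
  have lims: "(s \<longlongrightarrow> 0) (at_right 0)" "(s \<longlongrightarrow> 1) (at_left 1)"
    using cs s0 s1 unfolding continuous_on_def
    by (metis at_within_Icc_at_right at_within_Icc_at_left atLeastAtMost_iff order_refl zero_less_one zero_le_one)+
  have s_pos: "0 < s u \<and> s u < 1" if "0 < u" "u < 1" for u
  proof -
    have "s u \<noteq> 0" "s u \<noteq> 1" using s_eq[of u] that \<Phi>0 \<Phi>1 by auto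
    then show ?thesis using s_in[of u] that by auto
  qed
  have s_deriv: "(s has_real_derivative 2 * S * (K (s u))\<^sup>2) (at u)" if u: "0 < u" "u < 1" for u
  proof -
    have "isCont s u"
      using cs u by (intro continuous_on_interior[of "{0..1}"]) auto
    moreover have "\<phi> (s u) / S \<noteq> 0"
      using \<phi>_pos[OF s_in] u S0 by (metis atLeastAtMost_iff divide_eq_0_iff less_eq_real_def less_irrefl)
    ultimately have "(s has_real_derivative inverse (\<phi> (s u) / S)) (at u)"
      by (intro DERIV_inverse_function[where f = \<Phi> and a = 0 and b = 1] d' u)
         (use s_eq s_pos u in auto)
    moreover have "inverse (\<phi> (s u) / S) = 2 * S * (K (s u))\<^sup>2"
      by (simp add: \<phi>_def)
    ultimately show ?thesis by simp
  qed
  show "\<exists>s. (\<forall>u. 0 < u \<and> u < 1 \<longrightarrow> 0 < s u \<and> s u < 1 \<and>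
      (s has_real_derivative 2 * S * (K (s u))\<^sup>2) (at u)) \<and>
      (s \<longlongrightarrow> 0) (at_right 0) \<and> (s \<longlongrightarrow> 1) (at_left 1)"
    using lims s_pos s_deriv by (intro exI[of _ s]) auto
qed

text \<open>\<open>ln s - ln (1 - s)\<close> is the logarithm of the slope of the point
  \<open>v2 (1 - s) s\<close>.\<close>

lemma logit_has_real_derivative:
  fixes s :: "real \<Rightarrow> real"
  assumes "0 < s u" "s u < 1" "(s has_real_derivative s') (at u)"
  shows "((\<lambda>u. ln (s u) - ln (1 - s u)) has_real_derivative s' / (s u * (1 - s u))) (at u)"
proof -
  have "((\<lambda>u. ln (s u) - ln (1 - s u)) has_real_derivative s' / s u - (- s') / (1 - s u)) (at u)"
    using assms by (auto intro!: derivative_eq_intros)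
  moreover have "s' / s u - (- s') / (1 - s u) = s' / (s u * (1 - s u))"
    using assms by (simp add: field_simps)
  ultimately show ?thesis by simp
qed

lemma logit_lims:
  fixes s :: "real \<Rightarrow> real"
  assumes s: "\<And>u. 0 < u \<Longrightarrow> u < 1 \<Longrightarrow> 0 < s u \<and> s u < 1"
    and lims: "(s \<longlongrightarrow> 0) (at_right 0)" "(s \<longlongrightarrow> 1) (at_left 1)"
  shows "filterlim (\<lambda>u. ln (s u) - ln (1 - s u)) at_bot (at_right 0)"
    and "filterlim (\<lambda>u. ln (s u) - ln (1 - s u)) at_top (at_left 1)"
proof -
  have ev0: "\<forall>\<^sub>F u in at_right 0. 0 < u \<and> u < (1::real)"
    using eventually_at_right_real[of 0 "1::real"] by simp
  have ev1: "\<forall>\<^sub>F u in at_left 1. 0 < u \<and> u < (1::real)"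
    using eventually_at_left_real[of 0 "1::real"] by simp
  have "filterlim s (at_right 0) (at_right 0)"
    using lims(1) ev0 by (auto simp: filterlim_at elim!: eventually_mono dest: s)
  then have 1: "filterlim (\<lambda>u. ln (s u)) at_bot (at_right 0)"
    by (rule filterlim_compose[OF ln_at_0])
  have 2: "((\<lambda>u. - ln (1 - s u)) \<longlongrightarrow> - ln (1 - 0)) (at_right 0)"
    by (intro tendsto_intros lims) auto
  show "filterlim (\<lambda>u. ln (s u) - ln (1 - s u)) at_bot (at_right 0)"
    using filterlim_tendsto_add_at_top[OF tendsto_minus[OF 2], of "\<lambda>u. - ln (s u)"] 1
    by (simp add: filterlim_uminus_at_bot)
  have "((\<lambda>u. 1 - s u) \<longlongrightarrow> 1 - 1) (at_left 1)"
    by (intro tendsto_intros lims)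
  then have "filterlim (\<lambda>u. 1 - s u) (at_right 0) (at_left 1)"
    using ev1 by (auto simp: filterlim_at elim!: eventually_mono dest: s)
  then have "filterlim (\<lambda>u. ln (1 - s u)) at_bot (at_left 1)"
    by (rule filterlim_compose[OF ln_at_0])
  then have 3: "filterlim (\<lambda>u. - ln (1 - s u)) at_top (at_left 1)"
    by (simp add: filterlim_uminus_at_bot)
  have 4: "((\<lambda>u. ln (s u)) \<longlongrightarrow> ln 1) (at_left 1)"
    by (intro tendsto_intros lims) auto
  show "filterlim (\<lambda>u. ln (s u) - ln (1 - s u)) at_top (at_left 1)"
    using filterlim_tendsto_add_at_top[OF 4 3] by simp
qed

text \<open>\<open>(1 - s) * (1 - r) + s * r\<close> is the inner product of
  \<open>v2 (1 - s) s\<close> and \<open>v2 (1 - r) r\<close>. Divided by the square root of the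
  product of all four coordinates, it depends only on the product of the two slopes.\<close>

lemma cosh_half_logit_sum:
  fixes s r :: real
  assumes "0 < s" "s < 1" "0 < r" "r < 1"
  shows "(2 * cosh ((ln s - ln (1 - s) + (ln r - ln (1 - r))) / 2))\<^sup>2 =
    ((1 - s) * (1 - r) + s * r)\<^sup>2 / (s * (1 - s) * (r * (1 - r)))"
proof -
  define a where "a = ln s - ln (1 - s) + (ln r - ln (1 - r))"
  define p where "p = s * r"
  define n where "n = (1 - s) * (1 - r)"
  have pn: "p > 0" "n > 0" using assms by (simp_all add: p_def n_def)
  have e: "exp a = p / n"
    using assms by (simp add: a_def p_def n_def exp_add exp_diff)
  have "(2 * cosh (a / 2))\<^sup>2 = exp a + 2 + exp (- a)"
    by (simp add: cosh_field_def power2_eq_square algebra_simps flip: exp_add)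
  also have "\<dots> = p / n + 2 + n / p" by (simp add: e exp_minus)
  also have "\<dots> = (n + p)\<^sup>2 / (p * n)"
    using pn by (simp add: field_simps power2_eq_square)
  also have "p * n = s * (1 - s) * (r * (1 - r))" by (simp add: p_def n_def)
  finally show ?thesis by (simp add: a_def n_def p_def)
qed

text \<open>The lower bound on \<open>K s * L r\<close> is the duality of a gauge and a support
  function along the segment. The constant \<open>2 * sqrt (S * S')\<close> is the geometric mean of
  the factors \<open>2 * S\<close> and \<open>2 * S'\<close> in the two sweeping rates.\<close>

lemma transport_exists:
  fixes K L :: "real \<Rightarrow> real"
  assumes K: "continuous_on {0..1} K" "\<And>x. x \<in> {0..1} \<Longrightarrow> K x > 0"
    and L: "continuous_on {0..1} L" "\<And>x. x \<in> {0..1} \<Longrightarrow> L x > 0"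
    and KL: "\<And>s r. s \<in> {0..1} \<Longrightarrow> r \<in> {0..1} \<Longrightarrow> K s * L r \<ge> (1 - s) * (1 - r) + s * r"
    and S: "S = integral {0..1} (\<lambda>x. 1 / (2 * (K x)\<^sup>2))"
    and S': "S' = integral {0..1} (\<lambda>x. 1 / (2 * (L x)\<^sup>2))"
  shows "\<exists>X Y X' Y' s. transport X Y X' Y' (2 * sqrt (S * S')) \<and>
    (\<forall>u. 0 < u \<and> u < 1 \<longrightarrow> 0 < s u \<and> s u < 1 \<and> exp (X u) = s u / (1 - s u) \<and>
       X' u = 2 * S * (K (s u))\<^sup>2 / (s u * (1 - s u)))"
proof -
  have S0: "S > 0" "S' > 0"
    using transport_map(1)[OF K S] transport_map(1)[OF L S'] by simp_all
  obtain s where s: "\<And>u. 0 < u \<Longrightarrow> u < 1 \<Longrightarrow> 0 < s u \<and> s u < 1"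
      "\<And>u. 0 < u \<Longrightarrow> u < 1 \<Longrightarrow> (s has_real_derivative 2 * S * (K (s u))\<^sup>2) (at u)"
      "(s \<longlongrightarrow> 0) (at_right 0)" "(s \<longlongrightarrow> 1) (at_left 1)"
    using transport_map(2)[OF K S] by blast
  obtain r where r: "\<And>u. 0 < u \<Longrightarrow> u < 1 \<Longrightarrow> 0 < r u \<and> r u < 1"
      "\<And>u. 0 < u \<Longrightarrow> u < 1 \<Longrightarrow> (r has_real_derivative 2 * S' * (L (r u))\<^sup>2) (at u)"
      "(r \<longlongrightarrow> 0) (at_right 0)" "(r \<longlongrightarrow> 1) (at_left 1)"
    using transport_map(2)[OF L S'] by blast
  define X where "X u = ln (s u) - ln (1 - s u)" for u
  define Y where "Y u = ln (r u) - ln (1 - r u)" for u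
  define X' where "X' u = 2 * S * (K (s u))\<^sup>2 / (s u * (1 - s u))" for u
  define Y' where "Y' u = 2 * S' * (L (r u))\<^sup>2 / (r u * (1 - r u))" for u
  have "transport X Y X' Y' (2 * sqrt (S * S'))"
  proof
    fix u :: real assume u: "0 < u" "u < 1"
    note su = s(1)[OF u] and ru = r(1)[OF u]
    show "(X has_real_derivative X' u) (at u)"
      unfolding X_def X'_def using s(1,2)[OF u] by (intro logit_has_real_derivative) auto
    show "(Y has_real_derivative Y' u) (at u)"
      unfolding Y_def Y'_def using r(1,2)[OF u] by (intro logit_has_real_derivative) auto
    have Kp: "K (s u) > 0" and Lp: "L (r u) > 0" using K(2) L(2) su ru by auto
    show "X' u > 0" "Y' u > 0"
      using su ru Kp Lp S0 by (simp_all add: X'_def Y'_def)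
    let ?D = "(1 - s u) * (1 - r u) + s u * r u"
    let ?p = "s u * (1 - s u) * (r u * (1 - r u))"
    have D0: "?D \<ge> 0" using su ru by simp
    have p0: "?p > 0" using su ru by simp
    have "?D \<le> K (s u) * L (r u)" using su ru by (intro KL) auto
    then have "?D\<^sup>2 \<le> (K (s u) * L (r u))\<^sup>2" using D0 by (rule power_mono)
    then have "4 * (S * S') * ?D\<^sup>2 \<le> 4 * (S * S') * (K (s u) * L (r u))\<^sup>2"
      using S0 by (intro mult_left_mono) auto
    then have "4 * (S * S') * ?D\<^sup>2 / ?p \<le> 4 * (S * S') * (K (s u) * L (r u))\<^sup>2 / ?p"
      using p0 by (intro divide_right_mono) auto
    moreover have "(2 * (2 * sqrt (S * S')) * cosh ((X u + Y u) / 2))\<^sup>2 = 4 * (S * S') * (?D\<^sup>2 / ?p)"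
    proof -
      have "(2 * (2 * sqrt (S * S')) * cosh ((X u + Y u) / 2))\<^sup>2 =
        4 * (sqrt (S * S'))\<^sup>2 * (2 * cosh ((X u + Y u) / 2))\<^sup>2"
        by (simp add: power_mult_distrib)
      also have "(sqrt (S * S'))\<^sup>2 = S * S'" using S0 by simp
      also have "(2 * cosh ((X u + Y u) / 2))\<^sup>2 = ?D\<^sup>2 / ?p"
        unfolding X_def Y_def using su ru by (intro cosh_half_logit_sum) auto
      finally show ?thesis by simp
    qed
    moreover have "4 * (S * S') * (K (s u) * L (r u))\<^sup>2 / ?p = X' u * Y' u"
      by (simp add: X'_def Y'_def power_mult_distrib)
    ultimately show "(2 * (2 * sqrt (S * S')) * cosh ((X u + Y u) / 2))\<^sup>2 \<le> X' u * Y' u"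
      by simp
  next
    show "0 < 2 * sqrt (S * S')" using S0 by simp
    show "filterlim X at_bot (at_right 0)" "filterlim X at_top (at_left 1)"
      unfolding X_def by (intro logit_lims s(1,3,4); assumption)+
    show "filterlim Y at_bot (at_right 0)" "filterlim Y at_top (at_left 1)"
      unfolding Y_def by (intro logit_lims r(1,3,4); assumption)+
  qed
  moreover have "exp (X u) = s u / (1 - s u)" if "0 < u" "u < 1" for u
    using s(1)[OF that] by (simp add: X_def exp_diff)
  ultimately show ?thesis
    using s(1) by (intro exI[of _ X] exI[of _ Y] exI[of _ X'] exI[of _ Y'] exI[of _ s] conjI allI impI)
      (simp_all add: X'_def)
qed

lemma quadrant_santalo:
  fixes K L :: "real \<Rightarrow> real"
  assumes K: "continuous_on {0..1} K" "\<And>x. x \<in> {0..1} \<Longrightarrow> K x > 0"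
    and L: "continuous_on {0..1} L" "\<And>x. x \<in> {0..1} \<Longrightarrow> L x > 0"
    and KL: "\<And>s r. s \<in> {0..1} \<Longrightarrow> r \<in> {0..1} \<Longrightarrow> K s * L r \<ge> (1 - s) * (1 - r) + s * r"
  shows "integral {0..1} (\<lambda>x. 1 / (2 * (K x)\<^sup>2)) * integral {0..1} (\<lambda>x. 1 / (2 * (L x)\<^sup>2)) \<le> (pi / 4)\<^sup>2"
    (is "?S * ?S' \<le> _")
proof -
  obtain X Y X' Y' where "transport X Y X' Y' (2 * sqrt (?S * ?S'))"
    using transport_exists[OF K L KL refl refl] by blast
  then have "2 * sqrt (?S * ?S') \<le> pi / 2"
    by (rule transport.\<Sigma>_le)
  then have "(sqrt (?S * ?S'))\<^sup>2 \<le> (pi / 4)\<^sup>2"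
    using transport_map(1)[OF K refl] transport_map(1)[OF L refl] by (intro power_mono) auto
  then show ?thesis
    using transport_map(1)[OF K refl] transport_map(1)[OF L refl] by simp
qed

text \<open>The quotient of \<open>X'\<close> by its model value, which
  \<open>dense_good_points\<close> controls, turns out to be the square of the gauge
  \<open>N\<close> at the point of the ellipse with eccentric angle \<open>\<phi>\<close>.\<close>

lemma quadrant_stability:
  fixes N L :: "real \<Rightarrow> real \<Rightarrow> real"
  assumes K: "continuous_on {0..1} (\<lambda>s. N (1 - s) s)" "\<And>x. x \<in> {0..1} \<Longrightarrow> N (1 - x) x > 0"
    and L: "continuous_on {0..1} (\<lambda>s. L (1 - s) s)" "\<And>x. x \<in> {0..1} \<Longrightarrow> L (1 - x) x > 0"
    and KL: "\<And>s r. s \<in> {0..1} \<Longrightarrow> r \<in> {0..1} \<Longrightarrow> N (1 - s) s * L (1 - r) r \<ge> (1 - s) * (1 - r) + s * r"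
    and hom: "\<And>r x y. r \<ge> 0 \<Longrightarrow> N (r * x) (r * y) = r * N x y"
    and S: "S = integral {0..1} (\<lambda>s. 1 / (2 * (N (1 - s) s)\<^sup>2))"
    and S': "S' = integral {0..1} (\<lambda>s. 1 / (2 * (L (1 - s) s)\<^sup>2))"
    and m: "0 < m" "m \<le> 1 / 100" and d: "pi / 2 - 2 * sqrt (S * S') \<le> m ^ 5"
  shows "\<exists>a b. a > 0 \<and> b > 0 \<and> a * b = sqrt (S * S') / S \<and>
     (\<forall>\<theta>. 6 * m \<le> \<theta> \<and> \<theta> \<le> pi / 2 - 6 * m \<longrightarrow>
       (\<exists>\<phi>. 0 < \<phi> \<and> \<phi> < pi / 2 \<and> \<bar>\<phi> - \<theta>\<bar> \<le> 5 * m \<and> \<bar>N (cos \<phi> / a) (sin \<phi> / b) - 1\<bar> \<le> 25 * m\<^sup>2))"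
proof -
  define \<Sigma> where "\<Sigma> = 2 * sqrt (S * S')"
  have S0: "S > 0" "S' > 0"
    using transport_map(1)[OF K S] transport_map(1)[OF L S'] by simp_all
  then have \<Sigma>0: "\<Sigma> > 0" by (simp add: \<Sigma>_def)
  obtain X Y X' Y' s where T: "transport X Y X' Y' \<Sigma>"
    and s: "\<And>u. 0 < u \<Longrightarrow> u < 1 \<Longrightarrow> 0 < s u \<and> s u < 1 \<and> exp (X u) = s u / (1 - s u) \<and>
       X' u = 2 * S * (N (1 - s u) (s u))\<^sup>2 / (s u * (1 - s u))"
    using transport_exists[OF K L KL S S'] unfolding \<Sigma>_def by blast
  obtain c where c: "\<And>\<theta>. 6 * m \<le> \<theta> \<and> \<theta> \<le> pi / 2 - 6 * m \<Longrightarrow>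
    (\<exists>u. 0 < u \<and> u < 1 \<and> \<bar>arctan (exp (X u - c / 2)) - \<theta>\<bar> \<le> 5 * m \<and>
      \<bar>X' u / (2 * \<Sigma> * cosh (X u - c / 2)) - 1\<bar> \<le> 25 * m\<^sup>2)"
    using transport.dense_good_points[OF T m] d unfolding \<Sigma>_def by blast
  \<comment> \<open>The product \<open>a * b = g\<^sup>2\<close> is dictated by the areas. The ratio
    \<open>a / b = E\<^sup>2 = exp (c / 2)\<close> is dictated by \<open>c\<close>, because along
    the ellipse the difference of the logarithmic slopes is \<open>2 * ln (a / b)\<close>.\<close>
  define g where "g = sqrt (\<Sigma> / (2 * S))"
  define E where "E = exp (c / 4)"
  have g: "g > 0" "g\<^sup>2 = \<Sigma> / (2 * S)" using \<Sigma>0 S0 by (simp_all add: g_def)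
  have E: "E > 0" by (simp add: E_def)
  have E2: "exp (c / 2) = E\<^sup>2" by (simp add: E_def power2_eq_square flip: exp_add)
  define a where "a = g * E"
  define b where "b = g / E"
  show ?thesis
  proof (rule exI[of _ a], rule exI[of _ b], intro conjI allI impI)
    show "a > 0" "b > 0" using g E by (simp_all add: a_def b_def)
    have "a * b = g\<^sup>2" using E by (simp add: a_def b_def power2_eq_square)
    also have "\<dots> = sqrt (S * S') / S" by (simp add: g(2) \<Sigma>_def)
    finally show "a * b = sqrt (S * S') / S" .
  next
    fix \<theta> assume "6 * m \<le> \<theta> \<and> \<theta> \<le> pi / 2 - 6 * m"
    then obtain u where u: "0 < u" "u < 1" and \<theta>: "\<bar>arctan (exp (X u - c / 2)) - \<theta>\<bar> \<le> 5 * m"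
      and close: "\<bar>X' u / (2 * \<Sigma> * cosh (X u - c / 2)) - 1\<bar> \<le> 25 * m\<^sup>2"
      using c by blast
    define e where "e = exp (X u - c / 2)"
    define \<phi> where "\<phi> = arctan e"
    define t where "t = s u"
    define A where "A = N (1 - t) t"
    have t: "0 < t" "t < 1" and X': "X' u = 2 * S * A\<^sup>2 / (t * (1 - t))" and eX: "exp (X u) = t / (1 - t)"
      using s[OF u] by (simp_all add: t_def A_def)
    have e0: "e > 0" by (simp add: e_def)
    have \<phi>: "0 < \<phi>" "\<phi> < pi / 2" using e0 arctan_ubound[of e] by (simp_all add: \<phi>_def)
    have cp: "cos \<phi> > 0" using \<phi> by (intro cos_gt_zero) auto
    have sin: "sin \<phi> = e * cos \<phi>"
    proof -
      have "tan \<phi> = e" by (simp add: \<phi>_def tan_arctan)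
      then show ?thesis using cp by (simp add: tan_def field_simps)
    qed
    have cos2: "(cos \<phi>)\<^sup>2 * (1 + e\<^sup>2) = 1"
      using sin_cos_squared_add[of \<phi>] unfolding sin by (simp add: power_mult_distrib algebra_simps)
    have eE: "e = t / ((1 - t) * E\<^sup>2)" by (simp add: e_def exp_diff eX E2)
    \<comment> \<open>The ellipse point with eccentric angle \<open>\<phi>\<close> has the slope
      \<open>tan \<phi> * (a / b) = e * E\<^sup>2 = t / (1 - t)\<close>, so it is a multiple of
      \<open>v2 (1 - t) t\<close>; \<open>\<rho>\<close> is the factor.\<close>
    define \<rho> where "\<rho> = cos \<phi> / (a * (1 - t))"
    have \<rho>0: "\<rho> > 0" using cp t g E by (simp add: \<rho>_def a_def)
    have "cos \<phi> / a = \<rho> * (1 - t)"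
      using t by (simp add: \<rho>_def)
    moreover have "sin \<phi> / b = \<rho> * t"
      using t g E unfolding sin eE \<rho>_def a_def b_def by (simp add: divide_simps power2_eq_square)
    ultimately have "N (cos \<phi> / a) (sin \<phi> / b) = N (\<rho> * (1 - t)) (\<rho> * t)" by simp
    also have "\<dots> = \<rho> * A" using hom \<rho>0 by (simp add: A_def)
    finally have N: "N (cos \<phi> / a) (sin \<phi> / b) = \<rho> * A" .
    have A0: "A > 0" unfolding A_def using t by (intro K) auto
    have "exp (- (X u - c / 2)) = 1 / e"
      unfolding e_def exp_minus by (rule inverse_eq_divide)
    then have "2 * cosh (X u - c / 2) = e + 1 / e"
      unfolding cosh_field_def e_def by simp
    then have ch: "2 * cosh (X u - c / 2) = (1 + e\<^sup>2) / e"
      using e0 by (simp add: add_divide_distrib power2_eq_square)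
    have "X' u / (2 * \<Sigma> * cosh (X u - c / 2)) = X' u / (\<Sigma> * ((1 + e\<^sup>2) / e))"
      by (simp flip: ch)
    also have "\<dots> = X' u * e / \<Sigma> * (1 / (1 + e\<^sup>2))" by simp
    also have "1 / (1 + e\<^sup>2) = (cos \<phi>)\<^sup>2"
    proof -
      have "1 + e\<^sup>2 \<noteq> 0" by (simp add: add_nonneg_eq_0_iff)
      then show ?thesis using cos2 by (simp add: field_simps)
    qed
    also have "X' u * e / \<Sigma> * (cos \<phi>)\<^sup>2 = (\<rho> * A)\<^sup>2"
    proof -
      have "X' u * e = 2 * S * A\<^sup>2 / ((1 - t)\<^sup>2 * E\<^sup>2)"
        using t E by (simp add: X' eE power2_eq_square)
      moreover have "\<Sigma> = 2 * S * g\<^sup>2" using g S0 by simp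
      ultimately show ?thesis
        using S0 by (simp add: \<rho>_def a_def power_mult_distrib power_divide mult_ac)
    qed
    finally have "\<bar>(\<rho> * A)\<^sup>2 - 1\<bar> \<le> 25 * m\<^sup>2" using close by simp
    moreover have "\<bar>(\<rho> * A)\<^sup>2 - 1\<bar> = \<bar>\<rho> * A - 1\<bar> * (\<rho> * A + 1)"
    proof -
      have "(\<rho> * A)\<^sup>2 - 1 = (\<rho> * A - 1) * (\<rho> * A + 1)" by (simp add: power2_eq_square algebra_simps)
      moreover have "\<bar>\<rho> * A + 1\<bar> = \<rho> * A + 1" using \<rho>0 A0 by simp
      ultimately show ?thesis by (simp only: abs_mult)
    qed
    moreover have "\<bar>\<rho> * A - 1\<bar> * 1 \<le> \<bar>\<rho> * A - 1\<bar> * (\<rho> * A + 1)"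
      using \<rho>0 A0 by (intro mult_left_mono) auto
    ultimately show "\<exists>\<phi>. 0 < \<phi> \<and> \<phi> < pi / 2 \<and> \<bar>\<phi> - \<theta>\<bar> \<le> 5 * m \<and> \<bar>N (cos \<phi> / a) (sin \<phi> / b) - 1\<bar> \<le> 25 * m\<^sup>2"
      using \<phi> \<theta> N by (intro exI[of _ \<phi>]) (simp add: \<phi>_def e_def)
  qed
qed

section \<open>Gluing quadrants of ellipses\<close>

lemma cos_ge_quadratic: "1 - x\<^sup>2 / 2 \<le> cos x" for x :: real
proof -
  have "(sin (x / 2))\<^sup>2 \<le> (x / 2)\<^sup>2"
    using abs_sin_x_le_abs_x[of "x / 2"] by (subst abs_le_square_iff[symmetric])
  then show ?thesis
    using cos_double_sin[of "x / 2"] by (simp add: power_divide)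
qed

lemma sin_ge_half:
  fixes x :: real
  assumes "0 \<le> x" "x \<le> 1"
  shows "x / 2 \<le> sin x"
proof -
  have "sin 0 - 0 / 2 \<le> sin x - x / 2"
  proof (rule DERIV_nonneg_imp_nondecreasing[OF assms(1)])
    fix t assume t: "0 \<le> t" "t \<le> x"
    have "((\<lambda>t. sin t - t / 2) has_real_derivative cos t - 1 / 2) (at t)"
      by (auto intro!: derivative_eq_intros)
    moreover have "t\<^sup>2 \<le> 1" using t assms by (simp add: power_le_one)
    then have "cos t \<ge> 1 / 2" using cos_ge_quadratic[of t] by simp
    ultimately show "\<exists>y. ((\<lambda>t. sin t - t / 2) has_real_derivative y) (at t) \<and> 0 \<le> y"
      by (intro exI conjI) auto
  qed
  then show ?thesis by simp
qed

text \<open>Two real arguments instead of a vector, so that reflections, the exchange of the axes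
  and axial scalings are plain substitutions.\<close>

locale sublinear =
  fixes N :: "real \<Rightarrow> real \<Rightarrow> real"
  assumes hom: "\<And>r x y. r \<ge> 0 \<Longrightarrow> N (r * x) (r * y) = r * N x y"
    and sub: "\<And>x y x' y'. N (x + x') (y + y') \<le> N x y + N x' y'"
begin

lemma sublinear_comb:
  assumes "\<alpha> \<ge> 0" "\<beta> \<ge> 0" "x = \<alpha> * x1 + \<beta> * x2" "y = \<alpha> * y1 + \<beta> * y2"
  shows "N x y \<le> \<alpha> * N x1 y1 + \<beta> * N x2 y2"
  using sub[of "\<alpha> * x1" "\<beta> * x2" "\<alpha> * y1" "\<beta> * y2"] hom[OF assms(1)] hom[OF assms(2)] assms by simp

lemma sublinear_signs:
  shows "sublinear (\<lambda>x y. N x (- y))" "sublinear (\<lambda>x y. N (- x) y)" "sublinear (\<lambda>x y. N (- x) (- y))"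
    "sublinear (\<lambda>x y. N y x)"
    "sublinear (\<lambda>x y. N (x / a) (y / b))"
proof -
  show "sublinear (\<lambda>x y. N x (- y))"
  proof
    show "N (r * x) (- (r * y)) = r * N x (- y)" if "r \<ge> 0" for r x y
      using hom[OF that, of x "- y"] by simp
    show "N (x + x') (- (y + y')) \<le> N x (- y) + N x' (- y')" for x y x' y'
      using sub[of x x' "-y" "-y'"] by simp
  qed
  show "sublinear (\<lambda>x y. N (- x) y)"
  proof
    show "N (- (r * x)) (r * y) = r * N (- x) y" if "r \<ge> 0" for r x y
      using hom[OF that, of "- x" y] by simp
    show "N (- (x + x')) (y + y') \<le> N (- x) y + N (- x') y'" for x y x' y'
      using sub[of "-x" "-x'" y y'] by simp
  qed
  show "sublinear (\<lambda>x y. N (- x) (- y))"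
  proof
    show "N (- (r * x)) (- (r * y)) = r * N (- x) (- y)" if "r \<ge> 0" for r x y
      using hom[OF that, of "- x" "- y"] by simp
    show "N (- (x + x')) (- (y + y')) \<le> N (- x) (- y) + N (- x') (- y')" for x y x' y'
      using sub[of "-x" "-x'" "-y" "-y'"] by simp
  qed
  show "sublinear (\<lambda>x y. N y x)"
    by unfold_locales (simp_all add: hom sub)
  show "sublinear (\<lambda>x y. N (x / a) (y / b))"
  proof
    show "N (r * x / a) (r * y / b) = r * N (x / a) (y / b)" if "r \<ge> 0" for r x y
      using hom[OF that, of "x / a" "y / b"] by simp
    show "N ((x + x') / a) ((y + y') / b) \<le> N (x / a) (y / b) + N (x' / a) (y' / b)" for x y x' y'
      using sub[of "x / a" "x' / a" "y / b" "y' / b"] by (simp add: add_divide_distrib)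
  qed
qed

text \<open>A sublinear function that is close to 1 at a dense set of unit vectors is close to 1 at all of
  them: interpolation bounds it from above, extrapolation from below.\<close>

lemma dense_directions:
  assumes \<delta>: "0 < \<delta>" "\<delta> \<le> 1 / 100" and e: "0 \<le> e" "e \<le> 1"
    and dense: "\<And>\<theta>. \<exists>\<psi>. \<bar>\<psi> - \<theta>\<bar> \<le> \<delta> \<and> \<bar>N (cos \<psi>) (sin \<psi>) - 1\<bar> \<le> e"
  shows "\<bar>N (cos \<theta>) (sin \<theta>) - 1\<bar> \<le> 20 * \<delta>\<^sup>2 + 10 * e"
proof -
  define D where "D = \<delta>\<^sup>2"
  have D: "0 < D" "D \<le> 1 / 10000"
    using \<delta> power_mono[of \<delta> "1/100" 2] by (auto simp: D_def power2_eq_square)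
  have cosD: "1 - k\<^sup>2 / 2 * D \<le> cos t" if "\<bar>t\<bar> \<le> k * \<delta>" for t k
  proof -
    have "t\<^sup>2 \<le> (k * \<delta>)\<^sup>2" using that by (intro power2_le_iff_abs_le[THEN iffD2]) auto
    then show ?thesis using cos_ge_quadratic[of t] by (simp add: D_def power_mult_distrib)
  qed
  have "N (cos \<theta>) (sin \<theta>) \<le> 1 + (20 * D + 10 * e)"
  proof -
    \<comment> \<open>Aiming \<open>2 * \<delta>\<close> to either side leaves \<open>p\<close> and
      \<open>q\<close> on opposite sides of \<open>\<theta>\<close>, at distances between
      \<open>\<delta>\<close> and \<open>3 * \<delta>\<close>. The coefficients that follow come
      from the sine rule.\<close>
    obtain p where p: "\<bar>p - (\<theta> - 2 * \<delta>)\<bar> \<le> \<delta>" "\<bar>N (cos p) (sin p) - 1\<bar> \<le> e" using dense by blast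
    obtain q where q: "\<bar>q - (\<theta> + 2 * \<delta>)\<bar> \<le> \<delta>" "\<bar>N (cos q) (sin q) - 1\<bar> \<le> e" using dense by blast
    define x y where "x = \<theta> - p" and "y = q - \<theta>"
    have xy: "\<delta> \<le> x" "x \<le> 3 * \<delta>" "\<delta> \<le> y" "y \<le> 3 * \<delta>" using p q by (auto simp: x_def y_def abs_le_iff)
    have s: "sin x > 0" "sin y > 0" "sin ((x + y) / 2) > 0" "sin (x + y) > 0"
      using xy \<delta> pi_gt3 by (auto intro!: sin_gt_zero)
    define \<alpha> \<beta> where "\<alpha> = sin y / sin (x + y)" and "\<beta> = sin x / sin (x + y)"
    have ab0: "\<alpha> \<ge> 0" "\<beta> \<ge> 0" using s by (simp_all add: \<alpha>_def \<beta>_def)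
    have pq: "p = \<theta> - x" "q = \<theta> + y" by (simp_all add: x_def y_def)
    have 1: "sin (x + y) * cos \<theta> = sin y * cos p + sin x * cos q"
      unfolding pq by (simp add: cos_add cos_diff sin_add algebra_simps)
    have 2: "sin (x + y) * sin \<theta> = sin y * sin p + sin x * sin q"
      unfolding pq by (simp add: sin_diff sin_add algebra_simps)
    have "N (cos \<theta>) (sin \<theta>) \<le> \<alpha> * N (cos p) (sin p) + \<beta> * N (cos q) (sin q)"
      using 1 2 s by (intro sublinear_comb ab0) (simp_all add: \<alpha>_def \<beta>_def field_simps)
    also have "\<dots> \<le> \<alpha> * (1 + e) + \<beta> * (1 + e)"
      using p(2) q(2) ab0 by (intro add_mono mult_left_mono) (auto simp: abs_le_iff)
    also have "\<dots> = (\<alpha> + \<beta>) * (1 + e)" by (simp add: algebra_simps)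
    \<comment> \<open>\<open>\<alpha> + \<beta>\<close> equals
      \<open>cos ((x - y) / 2) / cos ((x + y) / 2)\<close>. It exceeds 1 only to second order, just
      as a chord deviates from its arc.\<close>
    also have "\<dots> \<le> (1 + 9 * D) * (1 + e)"
    proof (intro mult_right_mono)
      let ?h = "(x + y) / 2"
      have c: "cos ?h \<ge> 1 - 9 / 2 * D" using cosD[of ?h 3] xy by simp
      have c0: "cos ?h > 0" using c D by linarith
      have "\<alpha> + \<beta> = (sin x + sin y) / sin (x + y)" using s by (simp add: \<alpha>_def \<beta>_def add_divide_distrib)
      also have "\<dots> = (2 * sin ?h * cos ((x - y) / 2)) / (2 * sin ?h * cos ?h)"
      proof -
        have "2 * ?h = x + y" by simp
        then show ?thesis using sin_double[of ?h] by (simp only: sin_plus_sin)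
      qed
      also have "\<dots> = cos ((x - y) / 2) / cos ?h" using s by simp
      also have "\<dots> \<le> 1 / cos ?h" using c0 by (intro divide_right_mono) auto
      also have "\<dots> \<le> 1 / (1 - 9 / 2 * D)" using c D by (intro divide_left_mono) auto
      also have "\<dots> \<le> 1 + 9 * D"
      proof -
        have "D * D \<le> D * (1 / 10000)" using D by (intro mult_left_mono) auto
        then show ?thesis using D by (simp add: field_simps)
      qed
      finally show "\<alpha> + \<beta> \<le> 1 + 9 * D" .
    qed (use e in auto)
    also have "\<dots> \<le> 1 + (20 * D + 10 * e)"
    proof -
      have "D * e \<le> D * 1" using D e by (intro mult_left_mono) auto
      moreover have "(1 + 9 * D) * (1 + e) = 1 + e + 9 * D + 9 * (D * e)" by (simp add: algebra_simps)
      ultimately show ?thesis using D e by linarith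
    qed
    finally show ?thesis .
  qed
  moreover have "N (cos \<theta>) (sin \<theta>) \<ge> 1 - (20 * D + 10 * e)"
  proof -
    \<comment> \<open>Now both directions lie on the same side, with \<open>p\<close> between
      \<open>\<theta>\<close> and \<open>q\<close>; the gap of at least \<open>2 * \<delta>\<close>
      from \<open>p\<close> to \<open>q\<close> limits the amplification of \<open>e\<close> to the
      factor 10.\<close>
    obtain p where p: "\<bar>p - (\<theta> + 2 * \<delta>)\<bar> \<le> \<delta>" "\<bar>N (cos p) (sin p) - 1\<bar> \<le> e" using dense by blast
    obtain q where q: "\<bar>q - (\<theta> + 6 * \<delta>)\<bar> \<le> \<delta>" "\<bar>N (cos q) (sin q) - 1\<bar> \<le> e" using dense by blast
    define x y where "x = p - \<theta>" and "y = q - \<theta>"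
    have xy: "\<delta> \<le> x" "x \<le> 3 * \<delta>" "5 * \<delta> \<le> y" "y \<le> 7 * \<delta>" using p q by (auto simp: x_def y_def abs_le_iff)
    have s: "sin x > 0" "sin y > 0" "sin ((y - x) / 2) > 0" "sin (y - x) > 0"
      using xy \<delta> pi_gt3 by (auto intro!: sin_gt_zero)
    define \<alpha> \<beta> where "\<alpha> = sin (y - x) / sin y" and "\<beta> = sin x / sin y"
    have ab0: "\<alpha> > 0" "\<beta> \<ge> 0" using s by (simp_all add: \<alpha>_def \<beta>_def)
    have pq: "p = \<theta> + x" "q = \<theta> + y" by (simp_all add: x_def y_def)
    have 1: "sin y * cos p = sin (y - x) * cos \<theta> + sin x * cos q"
      unfolding pq by (simp add: cos_add sin_diff algebra_simps)
    have 2: "sin y * sin p = sin (y - x) * sin \<theta> + sin x * sin q"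
      unfolding pq by (simp add: sin_diff sin_add algebra_simps)
    have "N (cos p) (sin p) \<le> \<alpha> * N (cos \<theta>) (sin \<theta>) + \<beta> * N (cos q) (sin q)"
      using 1 2 s ab0 by (intro sublinear_comb) (simp_all add: \<alpha>_def \<beta>_def field_simps)
    also have "\<dots> \<le> \<alpha> * N (cos \<theta>) (sin \<theta>) + \<beta> * (1 + e)"
      using q(2) ab0 by (intro add_mono mult_left_mono) (auto simp: abs_le_iff)
    finally have "1 - e - \<beta> * (1 + e) \<le> \<alpha> * N (cos \<theta>) (sin \<theta>)" using p(2) by (simp add: abs_le_iff)
    then have "(1 - e - \<beta> * (1 + e)) / \<alpha> \<le> N (cos \<theta>) (sin \<theta>)" using ab0 by (simp add: field_simps)
    moreover have "(1 - e - \<beta> * (1 + e)) / \<alpha> = (sin y - sin x) / sin (y - x) - e * ((sin x + sin y) / sin (y - x))"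
      using s by (simp add: \<alpha>_def \<beta>_def field_simps)
    moreover have "(sin y - sin x) / sin (y - x) \<ge> 1 - 25 / 2 * D"
    proof -
      let ?h = "(y - x) / 2"
      have c: "cos ((x + y) / 2) \<ge> 1 - 25 / 2 * D" using cosD[of "(x + y) / 2" 5] xy by simp
      have c0: "cos ?h > 0" using xy \<delta> pi_gt3 by (intro cos_gt_zero) auto
      have "(sin y - sin x) / sin (y - x) = (2 * sin ?h * cos ((x + y) / 2)) / (2 * sin ?h * cos ?h)"
      proof -
        have "2 * ?h = y - x" by simp
        then show ?thesis using sin_double[of ?h] by (simp only: sin_diff_sin add.commute)
      qed
      also have "\<dots> = cos ((x + y) / 2) / cos ?h" using s by simp
      finally have eq: "(sin y - sin x) / sin (y - x) = cos ((x + y) / 2) / cos ?h" .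
      have "cos ((x + y) / 2) / 1 \<le> cos ((x + y) / 2) / cos ?h"
        using c0 c D by (intro divide_left_mono) auto
      then show ?thesis using c unfolding eq by simp
    qed
    moreover have "e * ((sin x + sin y) / sin (y - x)) \<le> e * 10"
    proof (intro mult_left_mono e)
      have "sin x + sin y \<le> 10 * \<delta>"
        using sin_x_le_x[of x] sin_x_le_x[of y] xy \<delta> by simp
      moreover have "sin (y - x) \<ge> \<delta>" using sin_ge_half[of "y - x"] xy \<delta> by simp
      ultimately show "(sin x + sin y) / sin (y - x) \<le> 10" using s by (simp add: field_simps)
    qed
    ultimately show ?thesis using D by linarith
  qed
  ultimately show ?thesis by (simp add: D_def abs_le_iff)
qed

end

text \<open>On a quadrant, the unit ball of \<open>N\<close> is close to that of the ellipse with semi-axes \<open>1 / a\<close> and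
  \<open>1 / b\<close>, except for short arcs and for arcs near the axes.\<close>

definition near_ellipse :: "(real \<Rightarrow> real \<Rightarrow> real) \<Rightarrow> real \<Rightarrow> real \<Rightarrow> real \<Rightarrow> bool" where
  "near_ellipse N m a b \<longleftrightarrow> a > 0 \<and> b > 0 \<and>
     (\<forall>\<theta>. 6 * m \<le> \<theta> \<and> \<theta> \<le> pi / 2 - 6 * m \<longrightarrow>
       (\<exists>\<phi>. 0 < \<phi> \<and> \<phi> < pi / 2 \<and> \<bar>\<phi> - \<theta>\<bar> \<le> 5 * m \<and> \<bar>N (cos \<phi> / a) (sin \<phi> / b) - 1\<bar> \<le> 25 * m\<^sup>2))"

lemma near_ellipseD:
  assumes "near_ellipse N m a b" "6 * m \<le> \<theta>" "\<theta> \<le> pi / 2 - 6 * m"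
  obtains \<phi> where "0 < \<phi>" "\<phi> < pi / 2" "\<bar>\<phi> - \<theta>\<bar> \<le> 5 * m" "\<bar>N (cos \<phi> / a) (sin \<phi> / b) - 1\<bar> \<le> 25 * m\<^sup>2"
  using assms unfolding near_ellipse_def by blast

lemma near_ellipse_swap:
  assumes "near_ellipse N m a b"
  shows "near_ellipse (\<lambda>x y. N y x) m b a"
  unfolding near_ellipse_def
proof (intro conjI allI impI)
  show "b > 0" "a > 0" using assms by (auto simp: near_ellipse_def)
  fix \<theta> assume "6 * m \<le> \<theta> \<and> \<theta> \<le> pi / 2 - 6 * m"
  then have "6 * m \<le> pi / 2 - \<theta> \<and> pi / 2 - \<theta> \<le> pi / 2 - 6 * m" by auto
  then obtain \<phi> where \<phi>: "0 < \<phi>" "\<phi> < pi / 2" "\<bar>\<phi> - (pi / 2 - \<theta>)\<bar> \<le> 5 * m" "\<bar>N (cos \<phi> / a) (sin \<phi> / b) - 1\<bar> \<le> 25 * m\<^sup>2"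
    using assms unfolding near_ellipse_def by blast
  show "\<exists>\<phi>. 0 < \<phi> \<and> \<phi> < pi / 2 \<and> \<bar>\<phi> - \<theta>\<bar> \<le> 5 * m \<and> \<bar>N (sin \<phi> / a) (cos \<phi> / b) - 1\<bar> \<le> 25 * m\<^sup>2"
    using \<phi> by (intro exI[of _ "pi / 2 - \<phi>"]) (auto simp: cos_diff sin_diff)
qed

section \<open>Agreement of the semi-axes of neighbouring quadrants\<close>

lemma small_square:
  fixes m :: real
  assumes "0 < m" "m \<le> 1 / 1000000"
  shows "0 < m\<^sup>2" "m\<^sup>2 \<le> 1 / 1000000000000"
  using assms power_mono[of m "1 / 1000000" 2] by (auto simp: power2_eq_square)

text \<open>On the common axis the two ellipses have the semi-axes \<open>1 / a\<close> and
  \<open>1 / a'\<close>. Were the first much longer, the segment from an arc point just across the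
  axis to one well inside the other quadrant would pass beyond the arc point between them, against
  convexity.\<close>

lemma near_ellipse_adjacent_aux:
  assumes N: "sublinear N" and m: "0 < m" "m \<le> 1 / 1000000"
    and g1: "near_ellipse N m a b" and g4: "near_ellipse (\<lambda>x y. N x (- y)) m a' b'"
    and p: "1 - m\<^sup>2 \<le> a * b" "a' * b' \<le> 1" and le: "a \<le> a'"
  shows "a' \<le> a * (1 + 35000 * m\<^sup>2)"
proof -
  define M where "M = m\<^sup>2"
  have M: "0 < M" "M \<le> 1 / 1000000000000" using small_square[OF m] by (simp_all add: M_def)
  have pos: "a > 0" "b > 0" "a' > 0" "b' > 0" using g1 g4 by (auto simp: near_ellipse_def)
  \<comment> \<open>\<open>7 * m\<close> is barely above the admissible margin, hence close to the
    axis. \<open>60 * m\<close> makes the sine of \<open>p2\<close> at least twice those of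
    \<open>p1\<close> and \<open>p3\<close>, while all cosines stay within order
    \<open>m\<^sup>2\<close> of 1.\<close>
  have small: "7 * m \<le> pi / 2 - 6 * m" "60 * m \<le> pi / 2 - 6 * m" using m pi_gt3 by auto
  obtain p1 where p1: "0 < p1" "p1 < pi / 2" "\<bar>p1 - 7 * m\<bar> \<le> 5 * m" "\<bar>N (cos p1 / a') (- (sin p1 / b')) - 1\<bar> \<le> 25 * M"
    using near_ellipseD[OF g4, of "7 * m"] small m unfolding M_def by auto
  obtain p2 where p2: "0 < p2" "p2 < pi / 2" "\<bar>p2 - 60 * m\<bar> \<le> 5 * m" "\<bar>N (cos p2 / a') (- (sin p2 / b')) - 1\<bar> \<le> 25 * M"
    using near_ellipseD[OF g4, of "60 * m"] small m unfolding M_def by auto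
  obtain p3 where p3: "0 < p3" "p3 < pi / 2" "\<bar>p3 - 7 * m\<bar> \<le> 5 * m" "\<bar>N (cos p3 / a) (sin p3 / b) - 1\<bar> \<le> 25 * M"
    using near_ellipseD[OF g1, of "7 * m"] small m unfolding M_def by auto
  define A B where "A = a' / a" and "B = b' / b"
  have A: "A \<ge> 1" using le pos by (simp add: A_def)
  have B0: "B > 0" using pos by (simp add: B_def)
  have B: "B \<le> 2"
  proof -
    have "A * B = (a' * b') / (a * b)" using pos by (simp add: A_def B_def)
    also have "\<dots> \<le> 1 / (a * b)" using p pos by (intro divide_right_mono) auto
    also have "\<dots> \<le> 1 / (1 / 2)" using p pos M unfolding M_def[symmetric] by (intro divide_left_mono) auto
    finally have "A * B \<le> 2" by simp
    moreover have "1 * B \<le> A * B" using A B0 by (intro mult_right_mono) auto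
    ultimately show ?thesis by simp
  qed
  define c1 s1 c2 s2 c3 s3 where "c1 = cos p1" and "s1 = sin p1" and "c2 = cos p2" and "s2 = sin p2"
    and "c3 = cos p3" and "s3 = sin p3"
  note defs = c1_def s1_def c2_def s2_def c3_def s3_def
  have range: "2 * m \<le> p1" "p1 \<le> 12 * m" "55 * m \<le> p2" "p2 \<le> 65 * m" "2 * m \<le> p3" "p3 \<le> 12 * m"
    using p1 p2 p3 by (auto simp: abs_le_iff)
  have spos: "s1 > 0" "s2 > 0" "s3 > 0" using p1 p2 p3 by (auto simp: defs intro!: sin_gt_zero)
  have s12: "s1 \<le> 12 * m" "s3 \<le> 12 * m" using sin_x_le_x[of p1] sin_x_le_x[of p3] range p1 p3 by (auto simp: defs)
  have s2: "s2 \<ge> 24 * m" using sin_ge_half[of p2] range m p2 by (simp add: defs)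
  have c: "1 - 2113 * M \<le> cos t" if "0 \<le> t" "t \<le> 65 * m" for t
  proof -
    have "t\<^sup>2 \<le> (65 * m)\<^sup>2" using that by (intro power_mono) auto
    then have "t\<^sup>2 \<le> 4225 * M" by (simp add: M_def power_mult_distrib)
    then show ?thesis using cos_ge_quadratic[of t] M by linarith
  qed
  have cc: "1 - 2113 * M \<le> c2" "1 - 2113 * M \<le> c3" "c1 \<le> 1" "c1 > 0" "c2 > 0" "c3 > 0"
    using c[of p2] c[of p3] range p1 p2 p3 by (auto simp: defs intro!: cos_gt_zero)
  define \<Delta> where "\<Delta> = A * c3 * s2 + B * s3 * c2"
  have \<Delta>: "\<Delta> > 0" using A B0 spos cc unfolding \<Delta>_def by (intro add_pos_pos mult_pos_pos) auto
  define \<alpha> where "\<alpha> = (c1 * s2 - s1 * c2) / \<Delta>"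
  define \<beta> where "\<beta> = (A * c3 * s1 + B * s3 * c1) / \<Delta>"
  have "c1 * s2 - s1 * c2 = sin (p2 - p1)" by (simp add: defs sin_diff algebra_simps)
  also have "\<dots> \<ge> 0" using range p2 m pi_gt3 by (intro sin_ge_zero) auto
  finally have \<alpha>0: "\<alpha> \<ge> 0" using \<Delta> by (simp add: \<alpha>_def)
  have \<beta>0: "\<beta> \<ge> 0" using A B0 spos cc \<Delta> unfolding \<beta>_def by (intro divide_nonneg_pos add_nonneg_nonneg mult_nonneg_nonneg) auto
  have e1: "c1 = \<alpha> * (A * c3) + \<beta> * c2"
  proof -
    have "c1 * \<Delta> = (c1 * s2 - s1 * c2) * (A * c3) + (A * c3 * s1 + B * s3 * c1) * c2"
      by (simp add: \<Delta>_def algebra_simps)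
    then show ?thesis using \<Delta> by (simp add: \<alpha>_def \<beta>_def field_simps)
  qed
  have e2: "s1 + \<alpha> * (B * s3) = \<beta> * s2"
  proof -
    have "s1 * \<Delta> + (c1 * s2 - s1 * c2) * (B * s3) = (A * c3 * s1 + B * s3 * c1) * s2"
      by (simp add: \<Delta>_def algebra_simps)
    then show ?thesis using \<Delta> by (simp add: \<alpha>_def \<beta>_def field_simps)
  qed
  have "N (c1 / a') (- (s1 / b')) \<le> \<alpha> * N (c3 / a) (s3 / b) + \<beta> * N (c2 / a') (- (s2 / b'))"
  proof (rule sublinear.sublinear_comb[OF N \<alpha>0 \<beta>0])
    have "c1 / a' = \<alpha> * (A * c3 / a') + \<beta> * (c2 / a')" by (subst e1) (simp add: add_divide_distrib)
    also have "A * c3 / a' = c3 / a" using pos by (simp add: A_def)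
    finally show "c1 / a' = \<alpha> * (c3 / a) + \<beta> * (c2 / a')" .
    have "- (s1 / b') = \<alpha> * (B * s3 / b') + \<beta> * (- (s2 / b'))"
      using e2 pos by (simp add: field_simps)
    also have "B * s3 / b' = s3 / b" using pos by (simp add: B_def)
    finally show "- (s1 / b') = \<alpha> * (s3 / b) + \<beta> * (- (s2 / b'))" .
  qed
  also have "\<dots> \<le> \<alpha> * (1 + 25 * M) + \<beta> * (1 + 25 * M)"
    using p3(4) p2(4) \<alpha>0 \<beta>0 by (intro add_mono mult_left_mono) (auto simp: abs_le_iff defs)
  finally have "1 - 25 * M \<le> (\<alpha> + \<beta>) * (1 + 25 * M)"
    using p1(4) by (simp add: abs_le_iff defs algebra_simps)
  moreover have "(1 - 50 * M) * (1 + 25 * M) \<le> 1 - 25 * M" using M by (simp add: algebra_simps)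
  ultimately have "(1 - 50 * M) * (1 + 25 * M) \<le> (\<alpha> + \<beta>) * (1 + 25 * M)" by linarith
  then have sum: "1 - 50 * M \<le> \<alpha> + \<beta>" by (rule mult_right_le_imp_le) (use M in simp)
  \<comment> \<open>The second coordinates bound \<open>\<beta>\<close> by
    \<open>1 / 2 + \<alpha>\<close>: the point \<open>p2\<close> is too far from the axis to carry
    nearly all the weight.\<close>
  have \<alpha>8: "\<alpha> \<ge> 1 / 8"
  proof -
    have "\<beta> * s2 \<le> s2 / 2 + \<alpha> * (2 * (s2 / 2))"
      unfolding e2[symmetric] using s12 s2 \<alpha>0 B B0 spos
      by (intro add_mono mult_left_mono mult_mono) auto
    then have "\<beta> * s2 \<le> (1 / 2 + \<alpha>) * s2" by (simp add: algebra_simps)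
    then have "\<beta> \<le> 1 / 2 + \<alpha>" by (rule mult_right_le_imp_le) (use spos in simp)
    then show ?thesis using sum M by linarith
  qed
  \<comment> \<open>In the first coordinates, \<open>p3\<close> counts with the factor
    \<open>A\<close> and \<open>p1\<close> has at most 1, whence
    \<open>\<alpha> * A + \<beta>\<close> is at most 1 up to order \<open>M\<close>; compare with
    the lower bound on \<open>\<alpha> + \<beta>\<close>.\<close>
  have "\<alpha> * (A - 1) \<le> 4276 * M"
  proof -
    have "(\<alpha> * A + \<beta>) * (1 - 2113 * M) = \<alpha> * (A * (1 - 2113 * M)) + \<beta> * (1 - 2113 * M)"
      by (simp add: algebra_simps)
    also have "\<dots> \<le> c1" using cc A \<alpha>0 \<beta>0 by (subst e1) (intro add_mono mult_left_mono, auto)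
    also have "\<dots> \<le> 1" by (rule cc)
    also have "1 \<le> (1 + 4226 * M) * (1 - 2113 * M)" 
    proof -
      have "M * M \<le> M * (1 / 1000000000000)" using M by (intro mult_left_mono) auto
      then show ?thesis using M by (simp add: algebra_simps)
    qed
    finally have "\<alpha> * A + \<beta> \<le> 1 + 4226 * M" by (rule mult_right_le_imp_le) (use M in simp)
    then show ?thesis using sum by (simp add: algebra_simps)
  qed
  moreover have "1 / 8 * (A - 1) \<le> \<alpha> * (A - 1)" using \<alpha>8 A by (intro mult_right_mono) auto
  ultimately have "1 / 8 * (A - 1) \<le> 4276 * M" by (rule order_trans[rotated])
  then have "A \<le> 1 + 35000 * M" using M(1) by simp
  then show ?thesis using pos by (simp add: A_def M_def field_simps)
qed

text \<open>Relative error in a symmetric form, which survives positive common factors and, for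
  positive numbers, reciprocals.\<close>

definition close :: "real \<Rightarrow> real \<Rightarrow> real \<Rightarrow> bool" where
  "close \<eta> x y \<longleftrightarrow> x \<le> y * (1 + \<eta>) \<and> y \<le> x * (1 + \<eta>)"

lemma close_trans:
  assumes "close \<eta> x y" "close \<eta>' y w" "0 \<le> \<eta>" "0 \<le> \<eta>'" "\<eta> + \<eta>' + \<eta> * \<eta>' \<le> \<eta>''" "0 < x" "0 < w"
  shows "close \<eta>'' x w"
proof -
  have "x \<le> y * (1 + \<eta>)" using assms by (simp add: close_def)
  also have "\<dots> \<le> w * (1 + \<eta>') * (1 + \<eta>)" using assms by (intro mult_right_mono) (auto simp: close_def)
  also have "\<dots> = w * (1 + (\<eta> + \<eta>' + \<eta> * \<eta>'))" by (simp add: algebra_simps)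
  also have "\<dots> \<le> w * (1 + \<eta>'')" using assms by (intro mult_left_mono) auto
  finally have 1: "x \<le> w * (1 + \<eta>'')" .
  have "w \<le> y * (1 + \<eta>')" using assms by (simp add: close_def)
  also have "\<dots> \<le> x * (1 + \<eta>) * (1 + \<eta>')" using assms by (intro mult_right_mono) (auto simp: close_def)
  also have "\<dots> = x * (1 + (\<eta> + \<eta>' + \<eta> * \<eta>'))" by (simp add: algebra_simps)
  also have "\<dots> \<le> x * (1 + \<eta>'')" using assms by (intro mult_left_mono) auto
  finally show ?thesis using 1 by (simp add: close_def)
qed

text \<open>Reflection in the first axis exchanges the two quadrants, so that
  \<open>a \<le> a'\<close> may be assumed.\<close>

lemma near_ellipse_adjacent:
  assumes N: "sublinear N" and m: "0 < m" "m \<le> 1 / 1000000"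
    and g1: "near_ellipse N m a b" and g4: "near_ellipse (\<lambda>x y. N x (- y)) m a' b'"
    and p: "1 - m\<^sup>2 \<le> a * b" "a * b \<le> 1" "1 - m\<^sup>2 \<le> a' * b'" "a' * b' \<le> 1"
  shows "close (35000 * m\<^sup>2) a a'"
proof -
  have "a > 0" "a' > 0" using g1 g4 by (auto simp: near_ellipse_def)
  then have *: "a \<le> a * (1 + 35000 * m\<^sup>2)" "a' \<le> a' * (1 + 35000 * m\<^sup>2)" by simp_all
  show ?thesis
  proof (cases "a \<le> a'")
    case True
    then show ?thesis
      using near_ellipse_adjacent_aux[OF N m g1 g4 p(1,4)] * unfolding close_def by linarith
  next
    case False
    then have "a' \<le> a" by simp
    moreover have "sublinear (\<lambda>x y. N x (- y))" by (rule sublinear.sublinear_signs[OF N])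
    moreover have "near_ellipse (\<lambda>x y. N x (- (- y))) m a b" using g1 by simp
    ultimately show ?thesis
      using near_ellipse_adjacent_aux[of "\<lambda>x y. N x (- y)" m a' b' a b] m g4 p * unfolding close_def by linarith
  qed
qed

text \<open>With both products close to 1, each parameter is almost the reciprocal of its partner.
  Agreement along one axis thus passes to the other axis without another convexity argument.\<close>

lemma close_partner:
  assumes c: "close \<eta> a a'" and pos: "0 < a" "0 < a'" "0 < b" "0 < b'"
    and p: "1 - M \<le> a * b" "a * b \<le> 1" "1 - M \<le> a' * b'" "a' * b' \<le> 1"
    and \<eta>: "0 \<le> \<eta>" "\<eta> \<le> 1 / 4" "0 \<le> M" "M \<le> 1 / 4" 
  shows "close (\<eta> + 3 * M) b b'"
proof -
  have *: "y \<le> y' * (1 + (\<eta> + 3 * M))"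
    if "x' \<le> x * (1 + \<eta>)" "0 < x" "0 < x'" "0 < y" "0 < y'" "x * y \<le> 1" "1 - M \<le> x' * y'" for x x' y y'
  proof -
    have "x * y * (1 - M) \<le> 1 * (x' * y')"
      using that \<eta> by (intro mult_mono) auto
    also have "1 * (x' * y') \<le> (x * (1 + \<eta>)) * y'" using that by simp
    finally have "x * (y * (1 - M)) \<le> x * ((1 + \<eta>) * y')" by (simp add: algebra_simps)
    then have "y * (1 - M) \<le> (1 + \<eta>) * y'" using that by simp
    also have "\<dots> \<le> ((1 + (\<eta> + 3 * M)) * (1 - M)) * y'"
    proof (intro mult_right_mono)
      have "(\<eta> + 3 * M) * M \<le> 1 * M" using \<eta> by (intro mult_right_mono) auto
      then show "1 + \<eta> \<le> (1 + (\<eta> + 3 * M)) * (1 - M)" using \<eta> by (simp add: algebra_simps)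
    qed (use that in auto)
    finally have "y * (1 - M) \<le> (y' * (1 + (\<eta> + 3 * M))) * (1 - M)" by (simp add: algebra_simps)
    then show ?thesis by (rule mult_right_le_imp_le) (use \<eta> in simp)
  qed
  show ?thesis
    unfolding close_def using *[of a' a b b'] *[of a a' b' b] c pos p by (auto simp: close_def)
qed

text \<open>Scaling the coordinates shifts the logarithmic slope by \<open>ln (s / r)\<close>, and
  by \<open>arctan_exp_lipschitz\<close> the angle moves by no more than that.\<close>

lemma unit_vector_rescale:
  fixes \<phi> r s \<eta> :: real
  assumes \<phi>: "0 < \<phi>" "\<phi> < pi / 2" and \<eta>: "0 \<le> \<eta>" and r: "close \<eta> r 1" and s: "close \<eta> s 1"
    and pos: "0 < r" "0 < s"
  shows "\<exists>\<psi> \<rho>. 0 < \<psi> \<and> \<psi> < pi / 2 \<and> \<bar>\<psi> - \<phi>\<bar> \<le> 2 * \<eta> \<and> close \<eta> \<rho> 1 \<and> \<rho> > 0 \<and>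
    r * cos \<phi> = \<rho> * cos \<psi> \<and> s * sin \<phi> = \<rho> * sin \<psi>"
proof -
  have cp: "cos \<phi> > 0" "sin \<phi> > 0" using \<phi> by (auto intro!: cos_gt_zero sin_gt_zero)
  then have tp: "tan \<phi> > 0" by (simp add: tan_def)
  define x y where "x = r * cos \<phi>" and "y = s * sin \<phi>"
  have xy: "x > 0" "y > 0" using pos cp by (simp_all add: x_def y_def)
  define \<rho> where "\<rho> = sqrt (x\<^sup>2 + y\<^sup>2)"
  define \<psi> where "\<psi> = arctan (y / x)"
  have \<rho>0: "\<rho> > 0" using xy by (simp add: \<rho>_def add_pos_pos)
  have \<rho>x: "sqrt (1 + (y / x)\<^sup>2) = \<rho> / x"
  proof -
    have "1 + (y / x)\<^sup>2 = (x\<^sup>2 + y\<^sup>2) / x\<^sup>2" using xy by (simp add: field_simps)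
    then show ?thesis using xy by (simp add: \<rho>_def real_sqrt_divide)
  qed
  have 1: "x = \<rho> * cos \<psi>" "y = \<rho> * sin \<psi>"
    using \<rho>0 xy by (simp_all add: \<psi>_def cos_arctan sin_arctan \<rho>x)
  have "y / x = tan \<phi> * (s / r)" by (simp add: x_def y_def tan_def mult.commute)
  then have "y / x = exp (ln (tan \<phi>) + ln (s / r))" using tp pos by (simp add: exp_add)
  moreover have "\<phi> = arctan (exp (ln (tan \<phi>)))" using \<phi> tp by (simp add: arctan_tan)
  ultimately have "\<bar>\<psi> - \<phi>\<bar> \<le> \<bar>ln (s / r)\<bar>"
    using arctan_exp_lipschitz[of "ln (tan \<phi>) + ln (s / r)" "ln (tan \<phi>)"] by (simp add: \<psi>_def)
  moreover have "\<bar>ln (s / r)\<bar> \<le> 2 * \<eta>"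
  proof -
    have *: "\<bar>ln t\<bar> \<le> \<eta>" if "close \<eta> t 1" "t > 0" for t
    proof -
      have "ln t \<le> ln (1 + \<eta>)" using that \<eta> by (simp add: close_def)
      moreover have "ln (1 + \<eta>) \<le> \<eta>" using \<eta> by (simp add: ln_add_one_self_le_self)
      moreover have "ln 1 \<le> ln (t * (1 + \<eta>))" using that \<eta> by (subst ln_le_cancel_iff) (auto simp: close_def)
      moreover have "ln (t * (1 + \<eta>)) = ln t + ln (1 + \<eta>)" using that \<eta> by (simp add: ln_mult)
      ultimately show ?thesis by auto
    qed
    have "ln (s / r) = ln s - ln r" using pos by (simp add: ln_div)
    then show ?thesis using *[OF r pos(1)] *[OF s pos(2)] by linarith
  qed
  ultimately have 2: "\<bar>\<psi> - \<phi>\<bar> \<le> 2 * \<eta>" by linarith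
  have "close \<eta> \<rho> 1"
  proof -
    have \<rho>2: "\<rho>\<^sup>2 = r\<^sup>2 * (cos \<phi>)\<^sup>2 + s\<^sup>2 * (sin \<phi>)\<^sup>2"
      by (simp add: \<rho>_def x_def y_def power_mult_distrib)
    also have "\<dots> \<le> (1 + \<eta>)\<^sup>2 * (cos \<phi>)\<^sup>2 + (1 + \<eta>)\<^sup>2 * (sin \<phi>)\<^sup>2"
      using r s pos by (intro add_mono mult_right_mono power_mono) (auto simp: close_def)
    also have "\<dots> = (1 + \<eta>)\<^sup>2" by (simp flip: distrib_left)
    finally have "\<rho> \<le> 1 + \<eta>" by (rule power2_le_imp_le) (use \<eta> in simp)
    moreover have "1 \<le> \<rho> * (1 + \<eta>)"
    proof (rule power2_le_imp_le)
      have "1\<^sup>2 * (cos \<phi>)\<^sup>2 + 1\<^sup>2 * (sin \<phi>)\<^sup>2 \<le> (r * (1 + \<eta>))\<^sup>2 * (cos \<phi>)\<^sup>2 + (s * (1 + \<eta>))\<^sup>2 * (sin \<phi>)\<^sup>2"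
        using r s by (intro add_mono mult_right_mono power_mono) (auto simp: close_def)
      also have "\<dots> = (\<rho> * (1 + \<eta>))\<^sup>2"
        unfolding power_mult_distrib \<rho>2 by (simp add: algebra_simps)
      finally show "1\<^sup>2 \<le> (\<rho> * (1 + \<eta>))\<^sup>2" by simp
    qed (use \<rho>0 \<eta> in simp)
    ultimately show ?thesis by (simp add: close_def)
  qed
  moreover have "0 < \<psi>" "\<psi> < pi / 2" using xy arctan_ubound[of "y / x"] by (simp_all add: \<psi>_def)
  ultimately show ?thesis using 1 2 \<rho>0 unfolding x_def y_def by blast
qed

lemma close_mono: "close \<eta> x y \<Longrightarrow> \<eta> \<le> \<eta>' \<Longrightarrow> 0 < x \<Longrightarrow> 0 < y \<Longrightarrow> close \<eta>' x y"
  unfolding close_def by (meson add_left_mono less_imp_le mult_left_mono order_trans)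

text \<open>Passage from the parameters of a quadrant to common reference parameters. Of the
  \<open>12 * m\<close>, up to \<open>6 * m\<close> moves \<open>\<theta>\<close> away from the
  axes, \<open>5 * m\<close> is the gap between good points, and the remaining \<open>m\<close>
  covers the rescaling.\<close>

lemma near_ellipse_dense:
  assumes N: "sublinear N" and m: "0 < m" "m \<le> 1 / 1000000"
    and g: "near_ellipse N m a' b'" and pos: "0 < a" "0 < b"
    and c: "close (80000 * m\<^sup>2) a a'" "close (80000 * m\<^sup>2) b b'"
    and \<theta>: "0 \<le> \<theta>" "\<theta> \<le> pi / 2"
  shows "\<exists>\<psi>. \<bar>\<psi> - \<theta>\<bar> \<le> 12 * m \<and> \<bar>N (cos \<psi> / a) (sin \<psi> / b) - 1\<bar> \<le> 80100 * m\<^sup>2"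
proof -
  define M where "M = m\<^sup>2"
  have M: "0 < M" "M \<le> 1 / 1000000000000" using small_square[OF m] by (simp_all add: M_def)
  have Mm: "M \<le> m / 1000000" using m by (simp add: M_def power2_eq_square)
  define \<eta> where "\<eta> = 80000 * M"
  have \<eta>: "0 \<le> \<eta>" "\<eta> \<le> 1 / 100" using M by (simp_all add: \<eta>_def)
  have pos': "a' > 0" "b' > 0" using g by (auto simp: near_ellipse_def)
  define \<theta>' where "\<theta>' = max (6 * m) (min (pi / 2 - 6 * m) \<theta>)"
  have \<theta>': "6 * m \<le> \<theta>'" "\<theta>' \<le> pi / 2 - 6 * m" "\<bar>\<theta>' - \<theta>\<bar> \<le> 6 * m"
    using \<theta> m pi_gt3 by (auto simp: \<theta>'_def max_def min_def)
  obtain \<phi> where \<phi>: "0 < \<phi>" "\<phi> < pi / 2" "\<bar>\<phi> - \<theta>'\<bar> \<le> 5 * m" "\<bar>N (cos \<phi> / a') (sin \<phi> / b') - 1\<bar> \<le> 25 * M"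
    using g \<theta>' unfolding near_ellipse_def M_def by blast
  have "close \<eta> (a / a') 1" "close \<eta> (b / b') 1"
    using c pos pos' by (auto simp: close_def \<eta>_def M_def field_simps)
  then obtain \<psi> \<rho> where \<psi>: "0 < \<psi>" "\<psi> < pi / 2" "\<bar>\<psi> - \<phi>\<bar> \<le> 2 * \<eta>" and \<rho>: "close \<eta> \<rho> 1" "\<rho> > 0"
    and eq: "a / a' * cos \<phi> = \<rho> * cos \<psi>" "b / b' * sin \<phi> = \<rho> * sin \<psi>"
    using unit_vector_rescale[OF \<phi>(1,2) \<eta>(1), of "a / a'" "b / b'"] pos pos' by auto
  define T where "T = N (cos \<psi> / a) (sin \<psi> / b)"
  have "cos \<phi> / a' = \<rho> * (cos \<psi> / a)" "sin \<phi> / b' = \<rho> * (sin \<psi> / b)"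
    using eq pos by (simp_all add: field_simps)
  then have "N (cos \<phi> / a') (sin \<phi> / b') = \<rho> * T"
    using sublinear.hom[OF N, of \<rho> "cos \<psi> / a" "sin \<psi> / b"] \<rho> by (simp only: T_def)
  then have T: "1 - 25 * M \<le> \<rho> * T" "\<rho> * T \<le> 1 + 25 * M" using \<phi>(4) by (auto simp: abs_le_iff)
  have T0: "T > 0"
  proof -
    have "0 < \<rho> * T" using T M by linarith
    then show ?thesis using \<rho> by (simp add: zero_less_mult_iff)
  qed
  have \<eta>M: "\<eta> * M \<le> M / 100" using mult_right_mono[OF \<eta>(2), of M] M by simp
  have "T \<le> 1 + (\<eta> + 100 * M)"
  proof -
    have "1 * T \<le> (\<rho> * (1 + \<eta>)) * T" using \<rho> T0 by (intro mult_right_mono) (auto simp: close_def)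
    also have "\<dots> = (\<rho> * T) * (1 + \<eta>)" by simp
    also have "\<dots> \<le> (1 + 25 * M) * (1 + \<eta>)" using T \<eta> by (intro mult_right_mono) auto
    also have "\<dots> \<le> 1 + (\<eta> + 100 * M)" using \<eta>M M by (simp add: algebra_simps)
    finally show ?thesis by simp
  qed
  moreover have "T \<ge> 1 - (\<eta> + 100 * M)"
  proof -
    have "\<rho> * T \<le> (1 + \<eta>) * T" using \<rho> T0 by (intro mult_right_mono) (auto simp: close_def)
    then have "1 - 25 * M \<le> (1 + \<eta>) * T" using T by linarith
    moreover have "(1 + \<eta>) * (1 - (\<eta> + 100 * M)) \<le> 1 - 25 * M"
      using \<eta>M M \<eta> by (simp add: algebra_simps)
    ultimately have "(1 + \<eta>) * (1 - (\<eta> + 100 * M)) \<le> (1 + \<eta>) * T" by linarith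
    then show ?thesis by (rule mult_left_le_imp_le) (use \<eta> in simp)
  qed
  ultimately have "\<bar>T - 1\<bar> \<le> 80100 * M" by (simp add: \<eta>_def abs_le_iff)
  moreover have "\<bar>\<psi> - \<theta>\<bar> \<le> 12 * m"
    using \<psi>(3) \<phi>(3) \<theta>'(3) Mm m unfolding \<eta>_def by linarith
  ultimately show ?thesis unfolding T_def M_def by blast
qed

lemma near_ellipse_glue:
  assumes N: "sublinear N" and m: "0 < m" "m \<le> 1 / 1000000"
    and g1: "near_ellipse N m a1 b1"
    and g2: "near_ellipse (\<lambda>x y. N (- x) y) m a2 b2"
    and g3: "near_ellipse (\<lambda>x y. N (- x) (- y)) m a3 b3"
    and g4: "near_ellipse (\<lambda>x y. N x (- y)) m a4 b4"
    and p1: "1 - m\<^sup>2 \<le> a1 * b1" "a1 * b1 \<le> 1" and p2: "1 - m\<^sup>2 \<le> a2 * b2" "a2 * b2 \<le> 1"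
    and p3: "1 - m\<^sup>2 \<le> a3 * b3" "a3 * b3 \<le> 1" and p4: "1 - m\<^sup>2 \<le> a4 * b4" "a4 * b4 \<le> 1"
  shows "\<bar>N (cos \<theta> / a1) (sin \<theta> / b1) - 1\<bar> \<le> 1000000 * m\<^sup>2"
proof -
  define M where "M = m\<^sup>2"
  have M: "0 < M" "M \<le> 1 / 1000000000000" using small_square[OF m] by (simp_all add: M_def)
  have MM: "M * M \<le> M * (1 / 1000000000000)" using M by (intro mult_left_mono) auto
  have pos: "a1 > 0" "b1 > 0" "a2 > 0" "b2 > 0" "a3 > 0" "b3 > 0" "a4 > 0" "b4 > 0"
    using g1 g2 g3 g4 by (auto simp: near_ellipse_def)
  note signs = sublinear.sublinear_signs[OF N]
  note p = p1[folded M_def] p2[folded M_def] p3[folded M_def] p4[folded M_def]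
  \<comment> \<open>The first and fourth quadrants share the positive first axis, the first and
    second the positive second axis, the second and third the negative first axis. The partner
    parameters follow from the products, and the third quadrant is compared with the first by way of
    the second.\<close>
  have a14: "close (35000 * M) a1 a4"
    unfolding M_def by (rule near_ellipse_adjacent[OF N m g1 g4 p1 p4])
  have b12: "close (35000 * M) b1 b2"
    unfolding M_def using p1 p2
    by (intro near_ellipse_adjacent[OF signs(4) m near_ellipse_swap[OF g1] near_ellipse_swap[OF g2]])
       (simp_all add: mult.commute)
  have a23: "close (35000 * M) a2 a3"
    unfolding M_def by (rule near_ellipse_adjacent[OF signs(2) m g2 _ p2 p3]) (use g3 in simp)
  have a12: "close (35000 * M + 3 * M) a1 a2"
    using close_partner[OF b12 pos(2,4,1,3), of M] p M by (simp add: mult.commute)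
  have b14: "close (35000 * M + 3 * M) b1 b4"
    using close_partner[OF a14 pos(1,7,2,8), of M] p M by simp
  have a13: "close (71000 * M) a1 a3"
    by (rule close_trans[OF a12 a23]) (use M MM pos in \<open>simp_all add: algebra_simps\<close>)
  have b13: "close (71000 * M + 3 * M) b1 b3"
    using close_partner[OF a13 pos(1,5,2,6), of M] p M by simp
  have refl: "close (80000 * M) x x" if "x > 0" for x
    using that M by (simp add: close_def)
  have dense: "\<exists>\<psi>. \<bar>\<psi> - \<theta>\<bar> \<le> 12 * m \<and> \<bar>N (cos \<psi> / a1) (sin \<psi> / b1) - 1\<bar> \<le> 80100 * m\<^sup>2"
    if \<theta>: "0 \<le> \<theta>" "\<theta> \<le> 2 * pi" for \<theta>
  proof -
    consider "\<theta> \<le> pi / 2" | "pi / 2 \<le> \<theta>" "\<theta> \<le> pi" | "pi \<le> \<theta>" "\<theta> \<le> 3 * pi / 2" | "3 * pi / 2 \<le> \<theta>"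
      by linarith
    then show ?thesis
    proof cases
      case 1
      then show ?thesis
        using near_ellipse_dense[OF N m g1 pos(1,2), of \<theta>] \<theta> refl pos by (simp add: M_def)
    next
      case 2
      have "\<exists>\<psi>. \<bar>\<psi> - (pi - \<theta>)\<bar> \<le> 12 * m \<and> \<bar>N (- (cos \<psi> / a1)) (sin \<psi> / b1) - 1\<bar> \<le> 80100 * m\<^sup>2"
        by (rule near_ellipse_dense[OF signs(2) m g2 pos(1,2)])
           (use close_mono[OF a12, of "80000 * M"] close_mono[OF b12, of "80000 * M"] M pos 2 in \<open>simp_all add: M_def\<close>)
      then obtain \<psi> where "\<bar>\<psi> - (pi - \<theta>)\<bar> \<le> 12 * m" "\<bar>N (- (cos \<psi> / a1)) (sin \<psi> / b1) - 1\<bar> \<le> 80100 * m\<^sup>2"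
        by blast
      then show ?thesis by (intro exI[of _ "pi - \<psi>"]) auto
    next
      case 3
      have "\<exists>\<psi>. \<bar>\<psi> - (\<theta> - pi)\<bar> \<le> 12 * m \<and> \<bar>N (- (cos \<psi> / a1)) (- (sin \<psi> / b1)) - 1\<bar> \<le> 80100 * m\<^sup>2"
        by (rule near_ellipse_dense[OF signs(3) m g3 pos(1,2)])
           (use close_mono[OF a13, of "80000 * M"] close_mono[OF b13, of "80000 * M"] M pos 3 in \<open>simp_all add: M_def\<close>)
      then obtain \<psi> where "\<bar>\<psi> - (\<theta> - pi)\<bar> \<le> 12 * m" "\<bar>N (- (cos \<psi> / a1)) (- (sin \<psi> / b1)) - 1\<bar> \<le> 80100 * m\<^sup>2"
        by blast
      then show ?thesis by (intro exI[of _ "\<psi> + pi"]) auto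
    next
      case 4
      have "\<exists>\<psi>. \<bar>\<psi> - (2 * pi - \<theta>)\<bar> \<le> 12 * m \<and> \<bar>N (cos \<psi> / a1) (- (sin \<psi> / b1)) - 1\<bar> \<le> 80100 * m\<^sup>2"
        by (rule near_ellipse_dense[OF signs(1) m g4 pos(1,2)])
           (use close_mono[OF a14, of "80000 * M"] close_mono[OF b14, of "80000 * M"] M pos 4 \<theta> in \<open>simp_all add: M_def\<close>)
      then obtain \<psi> where "\<bar>\<psi> - (2 * pi - \<theta>)\<bar> \<le> 12 * m" "\<bar>N (cos \<psi> / a1) (- (sin \<psi> / b1)) - 1\<bar> \<le> 80100 * m\<^sup>2"
        by blast
      then show ?thesis by (intro exI[of _ "2 * pi - \<psi>"]) (auto simp: cos_diff sin_diff)
    qed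
  qed
  have dense': "\<exists>\<psi>. \<bar>\<psi> - \<theta>\<bar> \<le> 12 * m \<and> \<bar>N (cos \<psi> / a1) (sin \<psi> / b1) - 1\<bar> \<le> 80100 * m\<^sup>2" for \<theta>
  proof -
    define k where "k = \<lfloor>\<theta> / (2 * pi)\<rfloor>"
    define \<theta>0 where "\<theta>0 = \<theta> - of_int k * (2 * pi)"
    have "of_int k \<le> \<theta> / (2 * pi)" "\<theta> / (2 * pi) \<le> of_int k + 1" by (simp_all add: k_def le_floor_iff[symmetric])
    then have "0 \<le> \<theta>0" "\<theta>0 \<le> 2 * pi" by (simp_all add: \<theta>0_def field_simps)
    then obtain \<psi> where "\<bar>\<psi> - \<theta>0\<bar> \<le> 12 * m" "\<bar>N (cos \<psi> / a1) (sin \<psi> / b1) - 1\<bar> \<le> 80100 * m\<^sup>2"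
      using dense by blast
    moreover have "cos (\<psi> + of_int k * (2 * pi)) = cos \<psi>" "sin (\<psi> + of_int k * (2 * pi)) = sin \<psi>"
      using cos.plus_of_int[of \<psi> k] sin.plus_of_int[of \<psi> k] by simp_all
    moreover have "(\<psi> + of_int k * (2 * pi)) - \<theta> = \<psi> - \<theta>0" by (simp add: \<theta>0_def)
    ultimately show ?thesis by (intro exI[of _ "\<psi> + of_int k * (2 * pi)"]) (simp only: simp_thms)
  qed
  \<comment> \<open>With gaps \<open>\<delta> = 12 * m\<close> and error
    \<open>e = 80100 * m\<^sup>2\<close> the bound is \<open>803880 * m\<^sup>2\<close>, rounded up
    afterwards.\<close>
  have "\<bar>N (cos \<theta> / a1) (sin \<theta> / b1) - 1\<bar> \<le> 20 * (12 * m)\<^sup>2 + 10 * (80100 * m\<^sup>2)"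
    by (rule sublinear.dense_directions[OF signs(5)[of a1 b1]])
       (use m M dense' in \<open>auto simp: M_def\<close>)
  also have "\<dots> \<le> 1000000 * m\<^sup>2" by (simp add: power_mult_distrib)
  finally show ?thesis .
qed

section \<open>Polar bodies and support functions\<close>

definition support :: "(real^2) set \<Rightarrow> real^2 \<Rightarrow> real" where
  "support M v = (SUP x\<in>M. x \<bullet> v)"

text \<open>These properties pass to the polar body, so every fact proved here can also be applied
  to \<open>polar M\<close>.\<close>

locale compact_nhd0 =
  fixes M :: "(real^2) set"
  assumes compact: "compact M" and zero: "0 \<in> interior M"
begin

lemma zero_mem: "0 \<in> M"
  using zero interior_subset by blast

lemma bdd_above_inner: "bdd_above ((\<lambda>x. x \<bullet> v) ` M)"
  by (intro bounded_imp_bdd_above compact_imp_bounded compact_continuous_image continuous_intros compact)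

lemma inner_le_support: "x \<in> M \<Longrightarrow> x \<bullet> v \<le> support M v"
  unfolding support_def by (intro cSUP_upper bdd_above_inner)

lemma support_least: "(\<And>x. x \<in> M \<Longrightarrow> x \<bullet> v \<le> c) \<Longrightarrow> support M v \<le> c"
  unfolding support_def using zero_mem by (intro cSUP_least) auto

lemma support_attained: "\<exists>x\<in>M. support M v = x \<bullet> v"
proof -
  have "M \<noteq> {}" "continuous_on M (\<lambda>x. x \<bullet> v)"
    using zero_mem by (auto intro!: continuous_intros)
  then obtain x where "x \<in> M" "\<And>y. y \<in> M \<Longrightarrow> y \<bullet> v \<le> x \<bullet> v"
    using continuous_attains_sup[OF compact] by blast
  then show ?thesis using support_least[of v "x \<bullet> v"] inner_le_support[of x v] by (intro bexI[of _ x]) auto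
qed

lemma support_0: "support M 0 = 0"
  using support_attained[of 0] by auto

lemma support_hom: 
  assumes "r \<ge> 0"
  shows "support M (r *\<^sub>R v) = r * support M v"
proof (rule antisym)
  show "support M (r *\<^sub>R v) \<le> r * support M v"
    using inner_le_support assms by (intro support_least) (simp add: mult_left_mono)
  obtain x where "x \<in> M" "support M v = x \<bullet> v" using support_attained by blast
  then show "r * support M v \<le> support M (r *\<^sub>R v)"
    using inner_le_support[of x "r *\<^sub>R v"] by simp
qed

lemma support_add: "support M (v + w) \<le> support M v + support M w"
  by (rule support_least) (use inner_le_support in \<open>simp add: inner_add_right add_mono\<close>)

lemma support_pos: 
  assumes "v \<noteq> 0"
  shows "support M v > 0"
proof -
  obtain e where e: "e > 0" "ball 0 e \<subseteq> M" using zero mem_interior by blast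
  define x where "x = (e / 2 / norm v) *\<^sub>R v"
  have "norm x < e" using e assms by (simp add: x_def)
  then have "x \<in> M" using e by auto
  moreover have "x \<bullet> v = e / 2 * norm v" using assms by (simp add: x_def dot_square_norm power2_eq_square)
  ultimately show ?thesis using inner_le_support[of x v] e assms
    by (smt (verit) half_gt_zero mult_pos_pos zero_less_norm_iff)
qed

lemma support_convex: "convex_on UNIV (support M)"
proof (rule convex_onI)
  fix t :: real and x y :: "real^2" assume "0 < t" "t < 1"
  then show "support M ((1 - t) *\<^sub>R x + t *\<^sub>R y) \<le> (1 - t) * support M x + t * support M y"
    using support_add[of "(1 - t) *\<^sub>R x" "t *\<^sub>R y"] support_hom[of t y] support_hom[of "1 - t" x] by simp
qed auto

lemma support_continuous: "continuous_on UNIV (support M)"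
  by (rule convex_on_continuous[OF open_UNIV support_convex])

lemma polar_eq: "polar M = {y. support M y \<le> 1}"
proof -
  have "(\<forall>x\<in>M. y \<bullet> x \<le> 1) \<longleftrightarrow> support M y \<le> 1" for y
    using inner_le_support[of _ y] support_least[of y 1] by (auto simp: inner_commute intro: order_trans)
  then show ?thesis by (simp add: polar_def)
qed

lemma polar_convex: "convex (polar M)"
  unfolding polar_def convex_def
  by (auto simp: inner_add_left intro!: convex_bound_le)

lemma polar_compact_nhd0: "compact_nhd0 (polar M)"
proof
  have "closed (polar M)"
  proof -
    have "polar M = support M -` {..1}" by (auto simp: polar_eq)
    then show ?thesis
      using support_continuous by (simp add: closed_vimage)
  qed
  moreover have "bounded (polar M)"
  proof -
    obtain e where e: "e > 0" "ball 0 e \<subseteq> M" using zero mem_interior by blast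
    have "norm y \<le> 2 / e" if y: "y \<in> polar M" for y
    proof (cases "y = 0")
      case False
      define x where "x = (e / 2 / norm y) *\<^sub>R y"
      have "norm x < e" using e False by (simp add: x_def)
      then have "x \<in> M" using e by auto
      then have "y \<bullet> x \<le> 1" using y by (simp add: polar_def)
      moreover have "y \<bullet> x = e / 2 * norm y" using False by (simp add: x_def dot_square_norm power2_eq_square)
      ultimately show ?thesis using e by (simp add: field_simps)
    qed (use e in simp)
    then show ?thesis by (auto simp: bounded_iff)
  qed
  ultimately show "compact (polar M)" by (simp add: compact_eq_bounded_closed)
  obtain R where R: "R > 0" "\<And>x. x \<in> M \<Longrightarrow> norm x \<le> R"
    using compact_imp_bounded[OF compact] bounded_pos by blast
  have "ball 0 (1 / R) \<subseteq> polar M"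
  proof
    fix y :: "real^2" assume "y \<in> ball 0 (1 / R)"
    then have y: "norm y \<le> 1 / R" by simp
    have "y \<bullet> x \<le> 1" if "x \<in> M" for x
    proof -
      have "y \<bullet> x \<le> norm y * norm x" by (rule norm_cauchy_schwarz)
      also have "\<dots> \<le> (1 / R) * R" using y R(2)[OF that] R(1) by (intro mult_mono) auto
      finally show ?thesis using R by simp
    qed
    then show "y \<in> polar M" by (simp add: polar_def)
  qed
  then show "0 \<in> interior (polar M)" using R by (meson mem_interior zero_less_divide_1_iff)
qed

text \<open>A point outside \<open>M\<close> is strictly separated from \<open>M\<close>. As 0 lies
  in \<open>M\<close>, the level \<open>b\<close> is negative, so dividing by it reverses the
  inequality and places the normal in the polar body.\<close>

lemma bipolar:
  assumes "convex M"
  shows "polar (polar M) = M"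
proof
  show "M \<subseteq> polar (polar M)" by (auto simp: polar_def inner_commute)
  show "polar (polar M) \<subseteq> M"
  proof (rule ccontr)
    assume "\<not> ?thesis"
    then obtain x where x: "x \<in> polar (polar M)" "x \<notin> M" by blast
    obtain a b where ab: "a \<bullet> x < b" "\<forall>y\<in>M. b < a \<bullet> y"
      using separating_hyperplane_closed_point[OF assms compact_imp_closed[OF compact] x(2)] by blast
    have b: "b < 0" using ab(2) zero_mem by force
    have "(a /\<^sub>R b) \<in> polar M"
      unfolding polar_def
    proof (intro CollectI ballI)
      fix y assume "y \<in> M"
      then have "b \<le> a \<bullet> y" using ab(2) by force
      then have "(a \<bullet> y) / b \<le> b / b" using b by (intro divide_right_mono_neg) auto
      then show "(a /\<^sub>R b) \<bullet> y \<le> 1" using b by (simp add: field_simps)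
    qed
    then have "x \<bullet> (a /\<^sub>R b) \<le> 1"
      using x(1) unfolding polar_def[of "polar M"] by blast
    then have "(a \<bullet> x) / b \<le> 1" by (simp add: inner_commute field_simps)
    then have "b \<le> a \<bullet> x" using b by (simp add: divide_le_eq)
    then show False using ab(1) by simp
  qed
qed

text \<open>Hence the support function of the polar body is the gauge of \<open>M\<close>.\<close>

lemma eq_support_polar: "convex M \<Longrightarrow> M = {x. support (polar M) x \<le> 1}"
  using compact_nhd0.polar_eq[OF polar_compact_nhd0] bipolar by simp

text \<open>The Cauchy-Schwarz inequality for a gauge and its support function, by scaling
  \<open>x\<close> to gauge 1. It supplies the duality hypothesis of the transport.\<close>

lemma inner_le_support_mult:
  assumes "convex M"
  shows "x \<bullet> y \<le> support (polar M) x * support M y"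
proof (cases "x = 0")
  case True
  then show ?thesis using compact_nhd0.support_0[OF polar_compact_nhd0] by simp
next
  case False
  define k where "k = support (polar M) x"
  have k: "k > 0" unfolding k_def by (rule compact_nhd0.support_pos[OF polar_compact_nhd0 False])
  have "support (polar M) (x /\<^sub>R k) = 1"
    using compact_nhd0.support_hom[OF polar_compact_nhd0, of "inverse k" x] k by (simp add: k_def)
  then have "x /\<^sub>R k \<in> {x. support (polar M) x \<le> 1}" by simp
  then have "x /\<^sub>R k \<in> M" by (simp only: eq_support_polar[OF assms, symmetric])
  then have "(x /\<^sub>R k) \<bullet> y \<le> support M y" by (rule inner_le_support)
  then show ?thesis using k by (simp add: k_def[symmetric] field_simps)
qed

text \<open>\<open>support M\<close> is the gauge of the polar body. Applied to
  \<open>polar M\<close>, this also gives the quadrant areas of \<open>M\<close>, by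
  \<open>bipolar\<close>.\<close>

lemma area_polar_quadrant:
  assumes "\<bar>\<sigma>\<bar> = 1" "\<bar>\<tau>\<bar> = 1"
  shows "area {v \<in> polar M. \<sigma> * v $ 1 > 0 \<and> \<tau> * v $ 2 > 0}
       = integral {0..1} (\<lambda>s. 1 / (2 * (support M (v2 (\<sigma> * (1 - s)) (\<tau> * s)))\<^sup>2))"
  using area_quadrant[OF support_continuous support_pos support_hom assms] by (simp add: polar_eq)

end

section \<open>Cutting areas along lines parallel to the axes\<close>

lemma lmeasurable_component_halves:
  fixes A :: "(real^2) set"
  assumes "A \<in> lmeasurable"
  shows "{v\<in>A. v $ i > c} \<in> lmeasurable" "{v\<in>A. v $ i < c} \<in> lmeasurable"
proof -
  have "{v :: real^2. v $ i > c} \<in> sets borel" "{v :: real^2. v $ i < c} \<in> sets borel"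
    by (simp_all add: open_halfspace_component_gt_cart open_halfspace_component_lt_cart borel_open)
  then have "{v :: real^2. v $ i > c} \<in> sets lebesgue" "{v :: real^2. v $ i < c} \<in> sets lebesgue"
    by (simp_all add: sets_completionI_sets)
  then have "A \<inter> {v. v $ i > c} \<in> lmeasurable" "A \<inter> {v. v $ i < c} \<in> lmeasurable"
    using assms by (auto intro: fmeasurable_Int_fmeasurable)
  moreover have "A \<inter> {v. v $ i > c} = {v\<in>A. v $ i > c}" "A \<inter> {v. v $ i < c} = {v\<in>A. v $ i < c}" by auto
  ultimately show "{v\<in>A. v $ i > c} \<in> lmeasurable" "{v\<in>A. v $ i < c} \<in> lmeasurable" by simp_all
qed

lemma negligible_component: "negligible {v\<in>A. v $ i = (c::real)}" for A :: "(real^2) set"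
proof (rule negligible_subset)
  have "axis i (1::real) \<in> (Basis :: (real^2) set)" by (simp add: axis_in_Basis_iff)
  then have "negligible {v :: real^2. v \<bullet> axis i 1 = c}" by (rule negligible_standard_hyperplane)
  then show "negligible {v :: real^2. v $ i = c}" by (simp add: inner_axis)
qed auto

lemma area_split_component:
  fixes A :: "(real^2) set"
  assumes A: "A \<in> lmeasurable"
  shows "area A = area {v\<in>A. v $ i > c} + area {v\<in>A. v $ i < c}"
proof -
  note h = lmeasurable_component_halves[OF A, where i = i and c = c]
  have "area ({v\<in>A. v $ i > c} \<union> {v\<in>A. v $ i < c}) = area {v\<in>A. v $ i > c} + area {v\<in>A. v $ i < c}"
  proof -
    have "{v\<in>A. v $ i > c} \<inter> {v\<in>A. v $ i < c} = {}" by auto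
    then show ?thesis using measure_Un3[OF h] by simp
  qed
  moreover have "area ({v\<in>A. v $ i > c} \<union> {v\<in>A. v $ i < c}) = area A"
  proof (rule measure_negligible_symdiff[OF A])
    show "negligible (sym_diff A ({v\<in>A. v $ i > c} \<union> {v\<in>A. v $ i < c}))"
      by (rule negligible_subset[OF negligible_component[where i = i and c = c]]) auto
  qed
  ultimately show ?thesis by simp
qed

lemma area_eq_sum_quadrants:
  fixes M :: "(real^2) set"
  assumes "compact M"
  shows "area M = area {v \<in> M. 1 * v $ 1 > 0 \<and> 1 * v $ 2 > 0} + area {v \<in> M. -1 * v $ 1 > 0 \<and> 1 * v $ 2 > 0}
     + area {v \<in> M. -1 * v $ 1 > 0 \<and> -1 * v $ 2 > 0} + area {v \<in> M. 1 * v $ 1 > 0 \<and> -1 * v $ 2 > 0}"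
proof -
  have M: "M \<in> lmeasurable" using assms by (rule lmeasurable_compact)
  note h = lmeasurable_component_halves[OF M, where i = 1 and c = 0]
  have "area M = area {v\<in>M. v $ 1 > 0} + area {v\<in>M. v $ 1 < 0}" by (rule area_split_component[OF M])
  also have "area {v\<in>M. v $ 1 > 0} = area {v\<in>M. v $ 1 > 0 \<and> v $ 2 > 0} + area {v\<in>M. v $ 1 > 0 \<and> v $ 2 < 0}"
    using area_split_component[OF h(1), where i = 2 and c = 0] by (simp add: conj_assoc)
  also have "area {v\<in>M. v $ 1 < 0} = area {v\<in>M. v $ 1 < 0 \<and> v $ 2 > 0} + area {v\<in>M. v $ 1 < 0 \<and> v $ 2 < 0}"
    using area_split_component[OF h(2), where i = 2 and c = 0] by (simp add: conj_assoc)
  finally show ?thesis by simp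
qed

section \<open>Stability for quadrisected bodies\<close>

lemma banach_mazur_le:
  assumes "t \<ge> 1" "linear \<Phi>" "inj \<Phi>"
    and "K \<ominus> x \<subseteq> \<Phi> ` (M \<ominus> y)" "\<Phi> ` (M \<ominus> y) \<subseteq> (\<lambda>p. t *\<^sub>R p) ` (K \<ominus> x)"
  shows "banach_mazur K M \<le> t"
  unfolding banach_mazur_def
proof (rule cInf_lower)
  show "t \<in> {t. t \<ge> 1 \<and> (\<exists>x y \<Phi>. linear \<Phi> \<and> inj \<Phi> \<and>
     K \<ominus> x \<subseteq> \<Phi> ` (M \<ominus> y) \<and> \<Phi> ` (M \<ominus> y) \<subseteq> (\<lambda>p. t *\<^sub>R p) ` (K \<ominus> x))}"
    using assms by blast
  show "bdd_below {t. t \<ge> 1 \<and> (\<exists>x y \<Phi>. linear \<Phi> \<and> inj \<Phi> \<and>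
     K \<ominus> x \<subseteq> \<Phi> ` (M \<ominus> y) \<and> \<Phi> ` (M \<ominus> y) \<subseteq> (\<lambda>p. t *\<^sub>R p) ` (K \<ominus> x))}"
    by (rule bdd_belowI[of _ 1]) auto
qed

lemma translate_by_0 [simp]: "K \<ominus> 0 = K"
  by (simp add: translate_by_def)

lemma banach_mazur_ellipse_le:
  fixes \<Phi> :: "real^2 \<Rightarrow> real^2"
  assumes "t \<ge> 1" "linear \<Phi>" "inj \<Phi>" "K \<ominus> x \<subseteq> \<Phi> ` cball 0 1"
    "\<Phi> ` cball 0 1 \<subseteq> (\<lambda>p. t *\<^sub>R p) ` (K \<ominus> x)"
  shows "banach_mazur_ellipse K \<le> t"
  using banach_mazur_le[of t \<Phi> K x "cball 0 1" 0] assms by simp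

lemma norm_ball_near_ellipse:
  fixes N :: "real^2 \<Rightarrow> real" and a b \<kappa> :: real
  assumes hom: "\<And>r v. r \<ge> 0 \<Longrightarrow> N (r *\<^sub>R v) = r * N v"
    and pos: "a > 0" "b > 0" and \<kappa>: "0 \<le> \<kappa>" "\<kappa> < 1"
    and close: "\<And>\<theta>. \<bar>N (v2 (cos \<theta> / a) (sin \<theta> / b)) - 1\<bar> \<le> \<kappa>"
  shows "\<exists>\<Phi> :: real^2 \<Rightarrow> real^2. linear \<Phi> \<and> inj \<Phi> \<and> {v. N v \<le> 1} \<subseteq> \<Phi> ` cball 0 1 \<and>
    \<Phi> ` cball 0 1 \<subseteq> (\<lambda>p. ((1 + \<kappa>) / (1 - \<kappa>)) *\<^sub>R p) ` {v. N v \<le> 1}"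
proof -
  \<comment> \<open>The image of the disc is the ellipse enlarged by
    \<open>1 / (1 - \<kappa>)\<close>, just enough to contain the ball of \<open>N\<close>. On it
    \<open>N\<close> is at most \<open>(1 + \<kappa>) / (1 - \<kappa>)\<close>.\<close>
  define \<Phi> :: "real^2 \<Rightarrow> real^2" where "\<Phi> w = v2 (w $ 1 / (a * (1 - \<kappa>))) (w $ 2 / (b * (1 - \<kappa>)))" for w
  have lin: "linear \<Phi>"
    by (rule linearI) (simp_all add: \<Phi>_def v2_algebra add_divide_distrib)
  have inj: "inj \<Phi>"
    using pos \<kappa> by (intro injI) (simp add: \<Phi>_def vec_eq_iff forall_2)
  have polar_form: "\<exists>r \<theta>. r \<ge> 0 \<and> r = norm w \<and> w = v2 (r * cos \<theta>) (r * sin \<theta>)" for w :: "real^2"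
  proof -
    obtain \<theta> where \<theta>: "w $ 1 = norm w * cos \<theta>" "w $ 2 = norm w * sin \<theta>"
    proof (cases "w = 0")
      case False
      have "(norm w)\<^sup>2 = (w $ 1)\<^sup>2 + (w $ 2)\<^sup>2"
        using norm_v2[of "w $ 1" "w $ 2"] by simp
      moreover have "(w $ 1 / norm w)\<^sup>2 + (w $ 2 / norm w)\<^sup>2 = ((w $ 1)\<^sup>2 + (w $ 2)\<^sup>2) / (norm w)\<^sup>2"
        by (simp add: power_divide add_divide_distrib)
      ultimately have "(w $ 1 / norm w)\<^sup>2 + (w $ 2 / norm w)\<^sup>2 = (norm w)\<^sup>2 / (norm w)\<^sup>2"
        by (simp only:)
      then have "(w $ 1 / norm w)\<^sup>2 + (w $ 2 / norm w)\<^sup>2 = 1"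
        using False by (simp only: divide_self_if power_eq_0_iff norm_eq_zero) simp
      then obtain t where "w $ 1 / norm w = cos t" "w $ 2 / norm w = sin t"
        using sincos_total_2pi by metis
      then show ?thesis using that[of t] False by (simp add: field_simps)
    qed (use that in simp)
    have "w = v2 (norm w * cos \<theta>) (norm w * sin \<theta>)"
      by (simp only: \<theta>[symmetric] v2_eta)
    then show ?thesis using norm_ge_zero by blast
  qed
  have N\<Phi>: "N (\<Phi> (v2 (r * cos \<theta>) (r * sin \<theta>))) = r / (1 - \<kappa>) * N (v2 (cos \<theta> / a) (sin \<theta> / b))"
    if "r \<ge> 0" for r \<theta>
  proof -
    have "\<Phi> (v2 (r * cos \<theta>) (r * sin \<theta>)) = (r / (1 - \<kappa>)) *\<^sub>R v2 (cos \<theta> / a) (sin \<theta> / b)"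
      by (simp add: \<Phi>_def v2_algebra mult.commute)
    then show ?thesis using hom that \<kappa> by simp
  qed
  have 1: "{v. N v \<le> 1} \<subseteq> \<Phi> ` cball 0 1"
  proof
    fix v assume v: "v \<in> {v. N v \<le> 1}"
    define w where "w = v2 (v $ 1 * (a * (1 - \<kappa>))) (v $ 2 * (b * (1 - \<kappa>)))"
    have vw: "v = \<Phi> w" using pos \<kappa> by (simp add: \<Phi>_def w_def)
    obtain r \<theta> where r: "r \<ge> 0" "r = norm w" "w = v2 (r * cos \<theta>) (r * sin \<theta>)" using polar_form by blast
    have "r / (1 - \<kappa>) * (1 - \<kappa>) \<le> r / (1 - \<kappa>) * N (v2 (cos \<theta> / a) (sin \<theta> / b))"
      using close[of \<theta>] r(1) \<kappa> by (intro mult_left_mono) auto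
    also have "\<dots> \<le> 1" using v unfolding N\<Phi>[OF r(1), symmetric] r(3)[symmetric] vw by simp
    finally have "norm w \<le> 1" using r(2) \<kappa> by simp
    then show "v \<in> \<Phi> ` cball 0 1" using vw by auto
  qed
  have 2: "\<Phi> ` cball 0 1 \<subseteq> (\<lambda>p. ((1 + \<kappa>) / (1 - \<kappa>)) *\<^sub>R p) ` {v. N v \<le> 1}"
  proof
    fix v assume "v \<in> \<Phi> ` cball 0 1"
    then obtain w where w: "norm w \<le> 1" "v = \<Phi> w" by auto
    obtain r \<theta> where r: "r \<ge> 0" "r = norm w" "w = v2 (r * cos \<theta>) (r * sin \<theta>)" using polar_form by blast
    define t where "t = (1 + \<kappa>) / (1 - \<kappa>)"
    have t: "t > 0" using \<kappa> by (simp add: t_def)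
    have "N v = N (\<Phi> (v2 (r * cos \<theta>) (r * sin \<theta>)))"
      by (simp only: w(2) r(3)[symmetric])
    also have "\<dots> = r / (1 - \<kappa>) * N (v2 (cos \<theta> / a) (sin \<theta> / b))"
      by (rule N\<Phi>[OF r(1)])
    also have "\<dots> \<le> (1 / (1 - \<kappa>)) * (1 + \<kappa>)"
      using close[of \<theta>] r(1) r(2) w(1) \<kappa> by (intro mult_mono' divide_right_mono) auto
    finally have "N v \<le> t" by (simp add: t_def)
    moreover have "N (v /\<^sub>R t) = N v * inverse t" using hom[of "inverse t" v] t by simp
    ultimately have "N (v /\<^sub>R t) \<le> 1" using t by (simp add: divide_inverse[symmetric])
    moreover have "v = t *\<^sub>R (v /\<^sub>R t)" using t by simp
    ultimately show "v \<in> (\<lambda>p. ((1 + \<kappa>) / (1 - \<kappa>)) *\<^sub>R p) ` {v. N v \<le> 1}"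
      unfolding t_def[symmetric] by blast
  qed
  show ?thesis by (intro exI[of _ \<Phi>] conjI lin inj 1 2)
qed

lemma quadrisected_stability:
  fixes M :: "(real^2) set"
  assumes M: "compact_nhd0 M" "convex M"
    and quarters: "\<And>\<sigma> \<tau>. \<bar>\<sigma>\<bar> = 1 \<Longrightarrow> \<bar>\<tau>\<bar> = 1 \<Longrightarrow> area {v \<in> M. \<sigma> * v $ 1 > 0 \<and> \<tau> * v $ 2 > 0} = area M / 4"
    and m: "0 < m" "m \<le> 1 / 1000000"
    and \<delta>: "8 * (1 - area M * area (polar M) / pi\<^sup>2) \<le> m ^ 5"
  shows "\<exists>\<Phi> :: real^2 \<Rightarrow> real^2. linear \<Phi> \<and> inj \<Phi> \<and> M \<subseteq> \<Phi> ` cball 0 1 \<and>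
    \<Phi> ` cball 0 1 \<subseteq> (\<lambda>p. ((1 + 1000000 * m\<^sup>2) / (1 - 1000000 * m\<^sup>2)) *\<^sub>R p) ` M"
proof -
  interpret M: compact_nhd0 M by (rule M)
  interpret P: compact_nhd0 "polar M" by (rule M.polar_compact_nhd0)
  define k where "k = support (polar M)"
  define l where "l = support M"
  have Mk: "M = {v. k v \<le> 1}" unfolding k_def by (rule M.eq_support_polar[OF M(2)])
  define S where "S = area M / 4"
  define S' where "S' \<sigma> \<tau> = area {v \<in> polar M. \<sigma> * v $ 1 > 0 \<and> \<tau> * v $ 2 > 0}" for \<sigma> \<tau>
  have k: "continuous_on UNIV k" "v \<noteq> 0 \<Longrightarrow> k v > 0" "r \<ge> 0 \<Longrightarrow> k (r *\<^sub>R v) = r * k v" for r v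
    unfolding k_def using P.support_continuous P.support_pos P.support_hom by auto
  have l: "continuous_on UNIV l" "v \<noteq> 0 \<Longrightarrow> l v > 0" "r \<ge> 0 \<Longrightarrow> l (r *\<^sub>R v) = r * l v" for r v
    unfolding l_def using M.support_continuous M.support_pos M.support_hom by auto
  have nz: "v2 (\<sigma> * (1 - s)) (\<tau> * s) \<noteq> 0" if "\<bar>\<sigma>\<bar> = 1" "\<bar>\<tau>\<bar> = 1" for \<sigma> \<tau> s :: real
    using that by auto
  have S_eq: "S = integral {0..1} (\<lambda>s. 1 / (2 * (k (v2 (\<sigma> * (1 - s)) (\<tau> * s)))\<^sup>2))"
    if st: "\<bar>\<sigma>\<bar> = 1" "\<bar>\<tau>\<bar> = 1" for \<sigma> \<tau>
    using P.area_polar_quadrant[OF st] quarters[OF st] M.bipolar[OF M(2)] by (simp add: S_def k_def)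
  have S'_eq: "S' \<sigma> \<tau> = integral {0..1} (\<lambda>s. 1 / (2 * (l (v2 (\<sigma> * (1 - s)) (\<tau> * s)))\<^sup>2))"
    if st: "\<bar>\<sigma>\<bar> = 1" "\<bar>\<tau>\<bar> = 1" for \<sigma> \<tau>
    using M.area_polar_quadrant[OF st] by (simp add: S'_def l_def)
  have kl: "k (v2 (\<sigma> * (1 - s)) (\<tau> * s)) * l (v2 (\<sigma> * (1 - r)) (\<tau> * r)) \<ge> (1 - s) * (1 - r) + s * r"
    if st: "\<bar>\<sigma>\<bar> = 1" "\<bar>\<tau>\<bar> = 1" for \<sigma> \<tau> s r
  proof -
    have ss: "\<sigma> * \<sigma> = 1" "\<tau> * \<tau> = 1" using st by (metis abs_mult_self_eq mult_1)+
    have "v2 (\<sigma> * (1 - s)) (\<tau> * s) \<bullet> v2 (\<sigma> * (1 - r)) (\<tau> * r) = (\<sigma> * \<sigma>) * ((1 - s) * (1 - r)) + (\<tau> * \<tau>) * (s * r)"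
      by (simp add: mult_ac)
    then show ?thesis using M.inner_le_support_mult[OF M(2)] unfolding ss k_def l_def by (metis mult_1)
  qed
  have contk: "continuous_on {0..1} (\<lambda>s. k (v2 (\<sigma> * (1 - s)) (\<tau> * s)))"
    and contl: "continuous_on {0..1} (\<lambda>s. l (v2 (\<sigma> * (1 - s)) (\<tau> * s)))" for \<sigma> \<tau>
    by (auto intro!: continuous_intros continuous_on_compose2[OF k(1)] continuous_on_compose2[OF l(1)])
  have S0: "S > 0"
    using transport_map(1)[OF contk[of 1 1] k(2)[OF nz] S_eq] by simp
  have S'0: "S' \<sigma> \<tau> > 0" if st: "\<bar>\<sigma>\<bar> = 1" "\<bar>\<tau>\<bar> = 1" for \<sigma> \<tau>
    using transport_map(1)[OF contl[of \<sigma> \<tau>] l(2)[OF nz[OF st]] S'_eq[OF st]] by simp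
  have le: "S * S' \<sigma> \<tau> \<le> (pi / 4)\<^sup>2" if st: "\<bar>\<sigma>\<bar> = 1" "\<bar>\<tau>\<bar> = 1" for \<sigma> \<tau>
    unfolding S_eq[OF st] S'_eq[OF st]
    by (rule quadrant_santalo[OF contk _ contl]) (use k(2)[OF nz[OF st]] l(2)[OF nz[OF st]] kl[OF st] in auto)
  have sum: "area (polar M) = S' 1 1 + S' (-1) 1 + S' (-1) (-1) + S' 1 (-1)"
    unfolding S'_def by (rule area_eq_sum_quadrants[OF P.compact])
  \<comment> \<open>The quadrant product relative to its upper bound. All four values are at most 1
    and they average to the relative volume product, so each misses 1 by at most four times the
    deficit, that is by \<open>m ^ 5 / 2\<close>.\<close>
  define x where "x \<sigma> \<tau> = S * S' \<sigma> \<tau> / (pi / 4)\<^sup>2" for \<sigma> \<tau>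
  have pi0: "(pi / 4)\<^sup>2 > 0" by simp
  have x: "x \<sigma> \<tau> \<le> 1" "x \<sigma> \<tau> > 0" if st: "\<bar>\<sigma>\<bar> = 1" "\<bar>\<tau>\<bar> = 1" for \<sigma> \<tau>
    using le[OF st] S0 S'0[OF st] by (simp_all add: x_def divide_le_eq)
  have avg: "area M * area (polar M) / pi\<^sup>2 = (x 1 1 + x (-1) 1 + x (-1) (-1) + x 1 (-1)) / 4"
    unfolding sum by (simp add: x_def S_def power_divide field_simps)
  have "8 * (1 - (x 1 1 + x (-1) 1 + x (-1) (-1) + x 1 (-1)) / 4) \<le> m ^ 5"
    using \<delta> unfolding avg .
  then have sum_x: "8 - 2 * x 1 1 - 2 * x (-1) 1 - 2 * x (-1) (-1) - 2 * x 1 (-1) \<le> m ^ 5"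
    by (simp add: field_simps)
  have x_ge: "x \<sigma> \<tau> \<ge> 1 - m ^ 5 / 2" if "\<bar>\<sigma>\<bar> = 1" "\<bar>\<tau>\<bar> = 1" for \<sigma> \<tau>
  proof -
    have le1: "x 1 1 \<le> 1" "x (-1) 1 \<le> 1" "x (-1) (-1) \<le> 1" "x 1 (-1) \<le> 1"
      by (simp_all add: x)
    have "\<sigma> = 1 \<or> \<sigma> = -1" "\<tau> = 1 \<or> \<tau> = -1" using that by auto
    moreover have "2 - 2 * x 1 1 \<le> m ^ 5" using sum_x le1 by linarith
    moreover have "2 - 2 * x (-1) 1 \<le> m ^ 5" using sum_x le1 by linarith
    moreover have "2 - 2 * x (-1) (-1) \<le> m ^ 5" using sum_x le1 by linarith
    moreover have "2 - 2 * x 1 (-1) \<le> m ^ 5" using sum_x le1 by linarith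
    ultimately have "2 - 2 * x \<sigma> \<tau> \<le> m ^ 5" by auto
    then show ?thesis by (simp add: field_simps)
  qed
  define y where "y \<sigma> \<tau> = sqrt (x \<sigma> \<tau>)" for \<sigma> \<tau>
  have y: "1 - m ^ 5 / 2 \<le> y \<sigma> \<tau>" "y \<sigma> \<tau> \<le> 1" "sqrt (S * S' \<sigma> \<tau>) = pi / 4 * y \<sigma> \<tau>"
    if st: "\<bar>\<sigma>\<bar> = 1" "\<bar>\<tau>\<bar> = 1" for \<sigma> \<tau>
  proof -
    have "x \<sigma> \<tau> \<le> y \<sigma> \<tau>"
    proof (unfold y_def, rule real_le_rsqrt)
      show "(x \<sigma> \<tau>)\<^sup>2 \<le> x \<sigma> \<tau>"
        using mult_left_mono[OF x(1)[OF st], of "x \<sigma> \<tau>"] x(2)[OF st] by (simp add: power2_eq_square)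
    qed
    then show "1 - m ^ 5 / 2 \<le> y \<sigma> \<tau>" using x_ge[OF st] by linarith
    show "y \<sigma> \<tau> \<le> 1" using x[OF st] by (simp add: y_def)
    have "S * S' \<sigma> \<tau> = (pi / 4)\<^sup>2 * x \<sigma> \<tau>" using pi0 by (simp add: x_def)
    then show "sqrt (S * S' \<sigma> \<tau>) = pi / 4 * y \<sigma> \<tau>"
      by (simp add: y_def real_sqrt_mult)
  qed
  have m52: "m ^ 5 \<le> m\<^sup>2"
    using m by (intro power_decreasing) auto
  \<comment> \<open>Division by \<open>lam\<close> gives the body the area of the unit disc. A
    single factor serves all quadrants because their areas agree, and it turns \<open>a * b\<close>
    into \<open>y\<close>, which is close to 1.\<close>
  define lam where "lam = sqrt (4 * S / pi)"
  have lam: "lam > 0" "lam\<^sup>2 = 4 * S / pi" using S0 by (simp_all add: lam_def)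
  define N where "N x y = k (v2 (x * lam) (y * lam))" for x y
  have N: "sublinear N"
  proof
    show "N (r * x) (r * y) = r * N x y" if "r \<ge> 0" for r x y
      using k(3)[OF that, of "v2 (x * lam) (y * lam)"] by (simp add: N_def v2_algebra mult_ac)
    show "N (x + x') (y + y') \<le> N x y + N x' y'" for x y x' y'
      using P.support_add[of "v2 (x * lam) (y * lam)" "v2 (x' * lam) (y' * lam)"]
      by (simp add: N_def k_def v2_algebra algebra_simps)
  qed
  have near: "\<exists>a b. near_ellipse (\<lambda>x y. N (\<sigma> * x) (\<tau> * y)) m a b \<and> 1 - m\<^sup>2 \<le> a * b \<and> a * b \<le> 1"
    if st: "\<bar>\<sigma>\<bar> = 1" "\<bar>\<tau>\<bar> = 1" for \<sigma> \<tau>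
  proof -
    have "pi / 2 - 2 * sqrt (S * S' \<sigma> \<tau>) = pi / 2 * (1 - y \<sigma> \<tau>)" by (simp add: y(3)[OF st] algebra_simps)
    also have "\<dots> \<le> 2 * (m ^ 5 / 2)" using y[OF st] pi_less_4 by (intro mult_mono) auto
    finally have d: "pi / 2 - 2 * sqrt (S * S' \<sigma> \<tau>) \<le> m ^ 5" by simp
    have "\<exists>a b. a > 0 \<and> b > 0 \<and> a * b = sqrt (S * S' \<sigma> \<tau>) / S \<and>
     (\<forall>\<theta>. 6 * m \<le> \<theta> \<and> \<theta> \<le> pi / 2 - 6 * m \<longrightarrow>
       (\<exists>\<phi>. 0 < \<phi> \<and> \<phi> < pi / 2 \<and> \<bar>\<phi> - \<theta>\<bar> \<le> 5 * m \<and>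
          \<bar>k (v2 (\<sigma> * (cos \<phi> / a)) (\<tau> * (sin \<phi> / b))) - 1\<bar> \<le> 25 * m\<^sup>2))"
    proof (rule quadrant_stability[where N = "\<lambda>x y. k (v2 (\<sigma> * x) (\<tau> * y))" and L = "\<lambda>x y. l (v2 (\<sigma> * x) (\<tau> * y))"])
      show "k (v2 (\<sigma> * (r * x)) (\<tau> * (r * y))) = r * k (v2 (\<sigma> * x) (\<tau> * y))" if "r \<ge> 0" for r x y
        using k(3)[OF that, of "v2 (\<sigma> * x) (\<tau> * y)"] by (simp add: v2_algebra mult_ac)
    qed (use contk contl k(2)[OF nz[OF st]] l(2)[OF nz[OF st]] kl[OF st] S_eq[OF st] S'_eq[OF st] m d in auto)
    then obtain a b where ab: "a > 0" "b > 0" "a * b = sqrt (S * S' \<sigma> \<tau>) / S"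
      and good: "\<forall>\<theta>. 6 * m \<le> \<theta> \<and> \<theta> \<le> pi / 2 - 6 * m \<longrightarrow>
       (\<exists>\<phi>. 0 < \<phi> \<and> \<phi> < pi / 2 \<and> \<bar>\<phi> - \<theta>\<bar> \<le> 5 * m \<and>
          \<bar>k (v2 (\<sigma> * (cos \<phi> / a)) (\<tau> * (sin \<phi> / b))) - 1\<bar> \<le> 25 * m\<^sup>2)"
      by blast
    have Nab: "N (\<sigma> * (c / (a * lam))) (\<tau> * (s / (b * lam))) = k (v2 (\<sigma> * (c / a)) (\<tau> * (s / b)))" for c s
      using lam by (simp add: N_def)
    have "near_ellipse (\<lambda>x y. N (\<sigma> * x) (\<tau> * y)) m (a * lam) (b * lam)"
      unfolding near_ellipse_def Nab using good ab lam by simp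
    moreover have "(a * lam) * (b * lam) = y \<sigma> \<tau>"
    proof -
      have "(a * lam) * (b * lam) = (a * b) * lam\<^sup>2" by (simp add: power2_eq_square)
      also have "\<dots> = y \<sigma> \<tau>" using S0 by (simp add: ab(3) lam(2) y(3)[OF st])
      finally show ?thesis .
    qed
    moreover have "1 - m\<^sup>2 \<le> y \<sigma> \<tau>" using y(1)[OF st] m52 zero_le_power[of m 5] m by linarith
    ultimately show ?thesis using y(2)[OF st] by metis
  qed
  obtain a1 b1 where 1: "near_ellipse N m a1 b1" "1 - m\<^sup>2 \<le> a1 * b1" "a1 * b1 \<le> 1"
    using near[of 1 1] by auto
  obtain a2 b2 where 2: "near_ellipse (\<lambda>x y. N (- x) y) m a2 b2" "1 - m\<^sup>2 \<le> a2 * b2" "a2 * b2 \<le> 1"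
    using near[of "-1" 1] by auto
  obtain a3 b3 where 3: "near_ellipse (\<lambda>x y. N (- x) (- y)) m a3 b3" "1 - m\<^sup>2 \<le> a3 * b3" "a3 * b3 \<le> 1"
    using near[of "-1" "-1"] by auto
  obtain a4 b4 where 4: "near_ellipse (\<lambda>x y. N x (- y)) m a4 b4" "1 - m\<^sup>2 \<le> a4 * b4" "a4 * b4 \<le> 1"
    using near[of 1 "-1"] by auto
  have close: "\<bar>N (cos \<theta> / a1) (sin \<theta> / b1) - 1\<bar> \<le> 1000000 * m\<^sup>2" for \<theta>
    by (rule near_ellipse_glue[OF N m 1(1) 2(1) 3(1) 4(1) 1(2,3) 2(2,3) 3(2,3) 4(2,3)])
  note m2 = small_square(2)[OF m]
  have ab1: "a1 > 0" "b1 > 0" using 1 by (auto simp: near_ellipse_def)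
  have "\<bar>k (v2 (cos \<theta> / (a1 / lam)) (sin \<theta> / (b1 / lam))) - 1\<bar> \<le> 1000000 * m\<^sup>2" for \<theta>
    using close[of \<theta>] by (simp add: N_def)
  then show ?thesis
    unfolding Mk using k(3) ab1 lam m2 m
    by (intro norm_ball_near_ellipse[where a = "a1 / lam" and b = "b1 / lam"]) (auto simp: power2_eq_square)
qed

section \<open>Quadrisection by two lines\<close>

text \<open>Keeps areas and the second coordinate, and makes lines of direction
  \<open>v2 p 1\<close> vertical. A horizontal and a slanted cutting line can thus become the
  coordinate axes.\<close>

definition shear :: "real \<Rightarrow> real^2 \<Rightarrow> real^2" where
  "shear p v = v2 (v $ 1 - p * v $ 2) (v $ 2)"

lemma shear_nth [simp]: "shear p v $ 1 = v $ 1 - p * v $ 2" "shear p v $ 2 = v $ 2"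
  by (simp_all add: shear_def)

lemma linear_shear: "linear (shear p)"
  by (rule linearI) (simp_all add: vec_eq_iff forall_2 algebra_simps)

lemma shear_shear [simp]: "shear p (shear (- p) v) = v" "shear (- p) (shear p v) = v"
  by (simp_all add: vec_eq_iff forall_2)

lemma inj_shear: "inj (shear p)"
  by (metis injI shear_shear(2))

lemma det_matrix_2: "det (matrix f) = f (axis 1 1) $ 1 * f (axis 2 1) $ 2 - f (axis 2 1) $ 1 * f (axis 1 1) $ 2"
  for f :: "real^2 \<Rightarrow> real^2"
  by (simp add: det_2 matrix_def)

lemma lmeasurable_shear: "A \<in> lmeasurable \<Longrightarrow> shear p ` A \<in> lmeasurable"
  by (rule measurable_linear_image[OF linear_shear])

lemma area_shear: "A \<in> lmeasurable \<Longrightarrow> area (shear p ` A) = area A"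
  using measure_linear_image[OF linear_shear, of A p] by (simp add: det_matrix_2 axis_def)

text \<open>The added part fits into a rectangle with sides \<open>t2 - t1\<close> and
  \<open>2 * R\<close>. Areas below a moving line are therefore Lipschitz, and can be halved
  exactly.\<close>

lemma area_slab_le:
  fixes B :: "(real^2) set"
  assumes B: "B \<in> lmeasurable" "\<And>v i. v \<in> B \<Longrightarrow> \<bar>v $ i\<bar> \<le> R" and t: "t1 \<le> t2" and R: "R \<ge> 0"
  shows "area {v\<in>B. v $ i \<le> t2} \<le> area {v\<in>B. v $ i \<le> t1} + 2 * R * (t2 - t1)"
proof -
  have meas: "{v\<in>B. v $ i \<le> t} \<in> lmeasurable" for t
  proof -
    have "{v\<in>B. v $ i \<le> t} = B - {v\<in>B. v $ i > t}" by auto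
    then show ?thesis using B(1) lmeasurable_component_halves(1)[OF B(1), of t i] by auto
  qed
  define Q where "Q = (if i = 1 then cbox (v2 t1 (- R)) (v2 t2 R) else cbox (v2 (- R) t1) (v2 R t2))"
  have "\<exists>p q. Q = cbox p q" by (auto simp: Q_def)
  then have Qm: "Q \<in> lmeasurable" by auto
  have Q: "area Q = 2 * R * (t2 - t1)"
  proof (cases "i = 1")
    case True
    have "measure lborel (cbox (v2 t1 (- R)) (v2 t2 R)) = (\<Prod>i\<in>UNIV. v2 t2 R $ i - v2 t1 (- R) $ i)"
      using t R by (intro content_cbox_cart) (simp add: interval_ne_empty_cart forall_2)
    then show ?thesis using True by (simp add: Q_def UNIV_2 measure_completion)
  next
    case False
    have "measure lborel (cbox (v2 (- R) t1) (v2 R t2)) = (\<Prod>i\<in>UNIV. v2 R t2 $ i - v2 (- R) t1 $ i)"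
      using t R by (intro content_cbox_cart) (simp add: interval_ne_empty_cart forall_2)
    then show ?thesis using False by (simp add: Q_def UNIV_2 measure_completion)
  qed
  have "{v\<in>B. v $ i \<le> t2} \<subseteq> {v\<in>B. v $ i \<le> t1} \<union> Q"
  proof
    fix v assume v: "v \<in> {v\<in>B. v $ i \<le> t2}"
    then have "\<bar>v $ 1\<bar> \<le> R" "\<bar>v $ 2\<bar> \<le> R" using B(2) by auto
    moreover have "i = 1 \<or> i = 2" using exhaust_2 by blast
    ultimately show "v \<in> {v\<in>B. v $ i \<le> t1} \<union> Q"
      using v by (auto simp: Q_def mem_box_cart forall_2 abs_le_iff)
  qed
  then have "area {v\<in>B. v $ i \<le> t2} \<le> area ({v\<in>B. v $ i \<le> t1} \<union> Q)"
    using meas Qm by (intro measure_mono_fmeasurable) auto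
  also have "\<dots> \<le> area {v\<in>B. v $ i \<le> t1} + area Q"
    using meas Qm by (intro measure_Un_le) auto
  finally show ?thesis by (simp add: Q)
qed

section \<open>Halving lines of prescribed direction\<close>

definition below :: "(real^2) set \<Rightarrow> real \<Rightarrow> real \<Rightarrow> (real^2) set" where
  "below A p t = {v\<in>A. v $ 1 - p * v $ 2 \<le> t}"

text \<open>The infimum makes the halving offset a function of the direction, even if several
  offsets halve the area.\<close>

definition median :: "(real^2) set \<Rightarrow> real \<Rightarrow> real" where
  "median A p = Inf {t. area A / 2 \<le> area (below A p t)}"

locale bounded_area =
  fixes A :: "(real^2) set" and R :: real
  assumes A: "A \<in> lmeasurable" "area A > 0" and bound: "\<And>v i. v \<in> A \<Longrightarrow> \<bar>v $ i\<bar> \<le> R" and R: "R > 0"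
begin

lemma below_eq: "shear p ` below A p t = {w\<in>shear p ` A. w $ 1 \<le> t}"
  by (auto simp: below_def)

lemma below_lmeasurable: "below A p t \<in> lmeasurable"
proof -
  have "{w\<in>shear p ` A. w $ 1 \<le> t} = shear p ` A - {w\<in>shear p ` A. w $ 1 > t}" by auto
  then have "{w\<in>shear p ` A. w $ 1 \<le> t} \<in> lmeasurable"
    using lmeasurable_shear[OF A(1), of p] lmeasurable_component_halves(1)[of "shear p ` A" t 1] by auto
  then have "shear (- p) ` {w\<in>shear p ` A. w $ 1 \<le> t} \<in> lmeasurable" by (rule lmeasurable_shear)
  then show ?thesis unfolding below_eq[symmetric] by (simp add: image_image)
qed

lemma area_below: "area (below A p t) = area {w\<in>shear p ` A. w $ 1 \<le> t}"
  using area_shear[OF below_lmeasurable, of p p t] by (simp add: below_eq)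

lemma area_below_mono: "t \<le> t' \<Longrightarrow> area (below A p t) \<le> area (below A p t')"
  by (rule measure_mono_fmeasurable) (use below_lmeasurable in \<open>auto simp: below_def\<close>)

lemma slanted_coordinate_bound: "v \<in> A \<Longrightarrow> \<bar>v $ 1 - p * v $ 2\<bar> \<le> R * (1 + \<bar>p\<bar>)"
proof -
  assume v: "v \<in> A"
  have "\<bar>p * v $ 2\<bar> \<le> \<bar>p\<bar> * R" unfolding abs_mult using bound[OF v] by (intro mult_left_mono) auto
  moreover have "\<bar>v $ 1\<bar> \<le> R" using bound[OF v] by auto
  moreover have "\<bar>v $ 1 - p * v $ 2\<bar> \<le> \<bar>v $ 1\<bar> + \<bar>p * v $ 2\<bar>" by (rule abs_triangle_ineq4)
  moreover have "R * (1 + \<bar>p\<bar>) = R + \<bar>p\<bar> * R" by (simp add: algebra_simps)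
  ultimately show ?thesis by linarith
qed

lemma area_below_lipschitz:
  assumes "t \<le> t'"
  shows "area (below A p t') \<le> area (below A p t) + 2 * (R * (1 + \<bar>p\<bar>)) * (t' - t)"
  unfolding area_below
proof (rule area_slab_le[OF lmeasurable_shear[OF A(1)] _ assms])
  fix w and i :: 2 assume "w \<in> shear p ` A"
  then obtain v where v: "v \<in> A" "w = shear p v" by auto
  have "R * 1 \<le> R * (1 + \<bar>p\<bar>)" using R by (intro mult_left_mono) auto
  then have "\<bar>v $ 2\<bar> \<le> R * (1 + \<bar>p\<bar>)" using bound[OF v(1), of 2] by simp
  moreover have "\<bar>v $ 1 - p * v $ 2\<bar> \<le> R * (1 + \<bar>p\<bar>)" by (rule slanted_coordinate_bound[OF v(1)])
  moreover have "i = 1 \<or> i = 2" using exhaust_2 by blast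
  ultimately show "\<bar>w $ i\<bar> \<le> R * (1 + \<bar>p\<bar>)" using v(2) by auto
qed (use R in simp)

lemma median_set:
  shows "R * (1 + \<bar>p\<bar>) \<in> {t. area A / 2 \<le> area (below A p t)}"
    and "bdd_below {t. area A / 2 \<le> area (below A p t)}"
proof -
  have "below A p (R * (1 + \<bar>p\<bar>)) = A" using slanted_coordinate_bound by (auto simp: below_def abs_le_iff)
  then show "R * (1 + \<bar>p\<bar>) \<in> {t. area A / 2 \<le> area (below A p t)}" using A by simp
  show "bdd_below {t. area A / 2 \<le> area (below A p t)}"
  proof (rule bdd_belowI)
    fix t assume t: "t \<in> {t. area A / 2 \<le> area (below A p t)}"
    show "- (R * (1 + \<bar>p\<bar>)) \<le> t"
    proof (rule ccontr)
      assume "\<not> ?thesis"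
      then have "below A p t = {}" using slanted_coordinate_bound[of _ p] by (fastforce simp: below_def abs_le_iff)
      then show False using t A by simp
    qed
  qed
qed

lemma median_le: "area A / 2 \<le> area (below A p t) \<Longrightarrow> median A p \<le> t"
  unfolding median_def by (rule cInf_lower) (use median_set in auto)

lemma median_ge: 
  assumes "\<And>t. t < s \<Longrightarrow> area (below A p t) < area A / 2"
  shows "s \<le> median A p"
  unfolding median_def
proof (rule cInf_greatest)
  show "{t. area A / 2 \<le> area (below A p t)} \<noteq> {}" using median_set(1) by blast
  show "s \<le> x" if "x \<in> {t. area A / 2 \<le> area (below A p t)}" for x
    using assms[of x] that by force
qed

text \<open>By the Lipschitz bound, a surplus or shortage of \<open>C * e\<close> could not be made
  up by moving the offset by less than \<open>e\<close>, which contradicts the choice of the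
  infimum.\<close>

lemma below_median: "area (below A p (median A p)) = area A / 2"
proof (rule antisym)
  define C where "C = 2 * (R * (1 + \<bar>p\<bar>))"
  have C: "C > 0" using R by (simp add: C_def add_pos_nonneg)
  show "area (below A p (median A p)) \<le> area A / 2"
  proof (rule ccontr)
    assume *: "\<not> ?thesis"
    define e where "e = (area (below A p (median A p)) - area A / 2) / C"
    have e: "e > 0" using * C by (simp add: e_def)
    have "area (below A p (median A p)) \<le> area (below A p (median A p - e)) + C * e"
      using area_below_lipschitz[of "median A p - e" "median A p" p] e by (simp add: C_def)
    then have "area A / 2 \<le> area (below A p (median A p - e))" using C by (simp add: e_def)
    then have "median A p \<le> median A p - e" by (rule median_le)
    then show False using e by simp
  qed
  show "area A / 2 \<le> area (below A p (median A p))"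
  proof (rule ccontr)
    assume *: "\<not> ?thesis"
    define e where "e = (area A / 2 - area (below A p (median A p))) / C"
    have e: "e > 0" using * C by (simp add: e_def)
    have "median A p + e \<le> median A p"
    proof (rule median_ge)
      fix t assume t: "t < median A p + e"
      show "area (below A p t) < area A / 2"
      proof (cases "t \<le> median A p")
        case True
        then show ?thesis using area_below_mono[OF True, of p] * by simp
      next
        case False
        then have "area (below A p t) \<le> area (below A p (median A p)) + C * (t - median A p)"
          using area_below_lipschitz[of "median A p" t p] by (simp add: C_def)
        also have "\<dots> < area (below A p (median A p)) + C * e" using t C by simp
        finally show ?thesis using C by (simp add: e_def)
      qed
    qed
    then show False using e by simp
  qed
qed

text \<open>On \<open>A\<close>, exchanging \<open>p\<close> for \<open>p'\<close> alters
  \<open>v $ 1 - p * v $ 2\<close> by at most \<open>R * \<bar>p - p'\<bar>\<close>.\<close>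

lemma median_lipschitz: "median A p' \<le> median A p + R * \<bar>p - p'\<bar>"
proof (rule median_le)
  have "below A p (median A p) \<subseteq> below A p' (median A p + R * \<bar>p - p'\<bar>)"
  proof
    fix v assume "v \<in> below A p (median A p)"
    then have v: "v \<in> A" "v $ 1 - p * v $ 2 \<le> median A p" by (auto simp: below_def)
    have "(p - p') * v $ 2 \<le> \<bar>p - p'\<bar> * \<bar>v $ 2\<bar>" by (metis abs_ge_self abs_mult)
    also have "\<dots> \<le> \<bar>p - p'\<bar> * R" using bound[OF v(1)] by (intro mult_left_mono) auto
    finally show "v \<in> below A p' (median A p + R * \<bar>p - p'\<bar>)"
      using v by (simp add: below_def algebra_simps)
  qed
  then show "area A / 2 \<le> area (below A p' (median A p + R * \<bar>p - p'\<bar>))"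
    unfolding below_median[of p, symmetric]
    by (intro measure_mono_fmeasurable) (use below_lmeasurable in auto)
qed

lemma median_continuous: "continuous_on UNIV (median A)"
proof (rule continuous_onI)
  fix p e :: real assume "e > 0"
  then show "\<exists>d>0. \<forall>p'\<in>UNIV. dist p' p < d \<longrightarrow> dist (median A p') (median A p) \<le> e"
  proof (intro exI[of _ "e / R"] conjI ballI impI)
    fix p' assume "dist p' p < e / R"
    then have "R * \<bar>p - p'\<bar> \<le> e" using R by (simp add: dist_real_def field_simps abs_minus_commute)
    then show "dist (median A p') (median A p) \<le> e"
      using median_lipschitz[of p' p] median_lipschitz[of p p'] by (simp add: dist_real_def abs_le_iff abs_minus_commute)
  qed (use R in simp)
qed

lemma area_above_median:
  shows "area {w\<in>shear p ` A. w $ 1 < median A p} = area A / 2"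
    and "area {w\<in>shear p ` A. w $ 1 > median A p} = area A / 2"
proof -
  let ?B = "shear p ` A" and ?c = "median A p"
  have B: "?B \<in> lmeasurable" by (rule lmeasurable_shear[OF A(1)])
  have "area {w\<in>?B. w $ 1 < ?c} = area {w\<in>?B. w $ 1 \<le> ?c}"
  proof (rule measure_negligible_symdiff[symmetric])
    show "negligible (sym_diff {w\<in>?B. w $ 1 < ?c} {w\<in>?B. w $ 1 \<le> ?c})"
      by (rule negligible_subset[OF negligible_component[where i = 1 and c = ?c and A = ?B]]) auto
    show "{w\<in>?B. w $ 1 < ?c} \<in> lmeasurable"
      by (rule lmeasurable_component_halves[OF B])
  qed
  also have "\<dots> = area A / 2" using below_median[of p] by (simp add: area_below)
  finally show 1: "area {w\<in>?B. w $ 1 < ?c} = area A / 2" .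
  show "area {w\<in>?B. w $ 1 > ?c} = area A / 2"
    using area_split_component[OF B, where i = 1 and c = ?c] 1 area_shear[OF A(1)] by simp
qed

text \<open>More than half of the area lies further than \<open>\<eta>\<close> from the horizontal
  axis, and a strong shear carries all of it to one side. This yields the sign change for the
  intermediate value theorem; \<open>s\<close> treats the upper and the lower half together.\<close>

lemma median_bounds:
  assumes p: "p \<ge> 0" and \<eta>: "area {v\<in>A. s * v $ 2 \<le> \<eta>} < area A / 2" and s: "\<bar>s\<bar> = 1"
  shows "median A (s * p) \<le> R - p * \<eta>" "median A (- s * p) \<ge> - (R - p * \<eta>)"
proof -
  have ss: "s * s = 1" using s by (metis abs_mult_self_eq mult_1)
  have meas: "{v\<in>A. s * v $ 2 \<le> \<eta>} \<in> lmeasurable" "{v\<in>A. s * v $ 2 > \<eta>} \<in> lmeasurable"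
  proof -
    have "s = 1 \<or> s = -1" using s by auto
    then show 1: "{v\<in>A. s * v $ 2 > \<eta>} \<in> lmeasurable"
      using lmeasurable_component_halves[OF A(1), where i = 2 and c = \<eta>]
        lmeasurable_component_halves[OF A(1), where i = 2 and c = "- \<eta>"]
      by (auto simp: less_minus_iff)
    have "{v\<in>A. s * v $ 2 \<le> \<eta>} = A - {v\<in>A. s * v $ 2 > \<eta>}" by auto
    then show "{v\<in>A. s * v $ 2 \<le> \<eta>} \<in> lmeasurable" using 1 A(1) by auto
  qed
  have "{v\<in>A. s * v $ 2 \<le> \<eta>} \<inter> {v\<in>A. s * v $ 2 > \<eta>} = {}" by auto
  moreover have "{v\<in>A. s * v $ 2 \<le> \<eta>} \<union> {v\<in>A. s * v $ 2 > \<eta>} = A" by auto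
  ultimately have "area A = area {v\<in>A. s * v $ 2 \<le> \<eta>} + area {v\<in>A. s * v $ 2 > \<eta>}"
    using measure_Un3[OF meas] by simp
  then have big: "area {v\<in>A. s * v $ 2 > \<eta>} \<ge> area A / 2" using \<eta> by simp
  show "median A (s * p) \<le> R - p * \<eta>"
  proof (rule median_le)
    have "{v\<in>A. s * v $ 2 > \<eta>} \<subseteq> below A (s * p) (R - p * \<eta>)"
    proof
      fix v assume "v \<in> {v\<in>A. s * v $ 2 > \<eta>}"
      then have v: "v \<in> A" "s * v $ 2 > \<eta>" by auto
      have "p * \<eta> \<le> p * (s * v $ 2)" using v p by (intro mult_left_mono) auto
      moreover have "v $ 1 \<le> R" using bound[OF v(1), of 1] by simp
      ultimately show "v \<in> below A (s * p) (R - p * \<eta>)" using v by (simp add: below_def mult_ac)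
    qed
    then have "area {v\<in>A. s * v $ 2 > \<eta>} \<le> area (below A (s * p) (R - p * \<eta>))"
      by (intro measure_mono_fmeasurable) (use below_lmeasurable meas in auto)
    then show "area A / 2 \<le> area (below A (s * p) (R - p * \<eta>))" using big by simp
  qed
  show "median A (- s * p) \<ge> - (R - p * \<eta>)"
  proof (rule median_ge)
    fix t assume t: "t < - (R - p * \<eta>)"
    have "below A (- s * p) t \<subseteq> {v\<in>A. s * v $ 2 \<le> \<eta>}"
    proof
      fix v assume "v \<in> below A (- s * p) t"
      then have v: "v \<in> A" "v $ 1 + p * (s * v $ 2) \<le> t" by (auto simp: below_def mult_ac)
      have "- R \<le> v $ 1" using bound[OF v(1), of 1] by (simp add: abs_le_iff)
      then have "p * (s * v $ 2) < p * \<eta>" using v t by linarith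
      then have "s * v $ 2 < \<eta>" using p by (metis mult_left_mono not_less)
      then show "v \<in> {v\<in>A. s * v $ 2 \<le> \<eta>}" using v by simp
    qed
    then have "area (below A (- s * p) t) \<le> area {v\<in>A. s * v $ 2 \<le> \<eta>}"
      by (intro measure_mono_fmeasurable) (use below_lmeasurable meas in auto)
    then show "area (below A (- s * p) t) < area A / 2" using \<eta> by simp
  qed
qed

end


lemma convex_body_area_pos:
  assumes "convex_body K"
  shows "area K > 0"
proof -
  obtain x e where e: "e > 0" "cball x e \<subseteq> K"
    using assms unfolding convex_body_def by (metis ex_in_conv mem_interior_cball)
  have "0 < area (cball x e)" using e by (simp add: content_cball_pos)
  also have "\<dots> \<le> area K"
    using e assms by (intro measure_mono_fmeasurable) (auto simp: convex_body_def intro: lmeasurable_compact)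
  finally show ?thesis .
qed

text \<open>Otherwise \<open>M\<close> would lie in a half-plane through 0, which is disjoint from
  some open quadrant: the one whose signs oppose the inner normal.\<close>

lemma zero_in_interior_quadrants:
  fixes M :: "(real^2) set"
  assumes M: "convex M" "interior M \<noteq> {}"
    and q: "\<And>\<sigma> \<tau> :: real. \<bar>\<sigma>\<bar> = 1 \<Longrightarrow> \<bar>\<tau>\<bar> = 1 \<Longrightarrow> \<exists>v\<in>M. \<sigma> * v $ 1 > 0 \<and> \<tau> * v $ 2 > 0"
  shows "0 \<in> interior M"
proof (rule ccontr)
  assume "0 \<notin> interior M"
  then obtain a where a: "a \<noteq> 0" "\<forall>x\<in>interior M. 0 \<le> a \<bullet> x"
    using separating_hyperplane_set_0[OF convex_interior[OF M(1)]] by blast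
  have "closure (interior M) \<subseteq> {x. 0 \<le> a \<bullet> x}"
    using a(2) by (intro closure_minimal closed_halfspace_ge) auto
  then have ge: "0 \<le> a \<bullet> x" if "x \<in> M" for x
    using convex_closure_interior[OF M] closure_subset[of M] that by auto
  define \<sigma> where "\<sigma> = (if a $ 1 > 0 then -1 else 1 :: real)"
  define \<tau> where "\<tau> = (if a $ 2 > 0 then -1 else 1 :: real)"
  obtain v where v: "v \<in> M" "\<sigma> * v $ 1 > 0" "\<tau> * v $ 2 > 0"
  proof -
    have "\<bar>\<sigma>\<bar> = 1" "\<bar>\<tau>\<bar> = 1" by (simp_all add: \<sigma>_def \<tau>_def)
    then show ?thesis using q that by blast
  qed
  have "a $ 1 \<noteq> 0 \<or> a $ 2 \<noteq> 0" using a(1) by (auto simp: vec_eq_iff forall_2)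
  moreover have "a $ 1 * v $ 1 \<le> 0" "a $ 1 \<noteq> 0 \<Longrightarrow> a $ 1 * v $ 1 < 0"
    using v(2) by (auto simp: \<sigma>_def mult_le_0_iff mult_less_0_iff split: if_splits)
  moreover have "a $ 2 * v $ 2 \<le> 0" "a $ 2 \<noteq> 0 \<Longrightarrow> a $ 2 * v $ 2 < 0"
    using v(3) by (auto simp: \<tau>_def mult_le_0_iff mult_less_0_iff split: if_splits)
  ultimately have "a \<bullet> v < 0" by (auto simp: inner_vec_def sum_2)
  then show False using ge[OF v(1)] by simp
qed

lemma quadrisection:
  assumes K: "convex_body K"
  obtains z p where "\<And>\<sigma> \<tau> :: real. \<bar>\<sigma>\<bar> = 1 \<Longrightarrow> \<bar>\<tau>\<bar> = 1 \<Longrightarrow>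
    area {v \<in> shear p ` (K \<ominus> z). \<sigma> * v $ 1 > 0 \<and> \<tau> * v $ 2 > 0} = area K / 4"
proof -
  have Kc: "compact K" using K by (simp add: convex_body_def)
  then have Km: "K \<in> lmeasurable" by (rule lmeasurable_compact)
  have K0: "area K > 0" by (rule convex_body_area_pos[OF K])
  obtain R0 where R0: "R0 > 0" "\<And>v. v \<in> K \<Longrightarrow> norm v \<le> R0"
    using compact_imp_bounded[OF Kc] bounded_pos by blast
  have cmp: "\<bar>v $ i\<bar> \<le> R0" if "v \<in> K" for v i
    using component_le_norm_cart[of v i] R0(2)[OF that] by simp
  \<comment> \<open>After exchanging the coordinates, the horizontal halving line is the halving
    line for \<open>p = 0\<close>.\<close>
  define sw :: "real^2 \<Rightarrow> real^2" where "sw v = v2 (v $ 2) (v $ 1)" for v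
  have sw_lin: "linear sw" by (rule linearI) (simp_all add: sw_def v2_algebra)
  have sw_sw: "sw (sw v) = v" for v by (simp add: sw_def)
  have sw_meas: "sw ` A \<in> lmeasurable" "area (sw ` A) = area A" if "A \<in> lmeasurable" for A
    using measurable_linear_image[OF sw_lin that] measure_linear_image[OF sw_lin that]
    by (simp_all add: det_matrix_2 sw_def axis_def)
  have cmp_sw: "\<bar>w $ i\<bar> \<le> R0" if w: "w \<in> sw ` K" for w i
  proof -
    obtain v where v: "v \<in> K" "w = sw v" using w by blast
    have "i = 1 \<or> i = 2" by (rule exhaust_2)
    then show ?thesis using cmp[OF v(1)] v(2) by (auto simp: sw_def)
  qed
  interpret S: bounded_area "sw ` K" R0
    using sw_meas[OF Km] K0 cmp_sw R0 by unfold_locales simp_all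
  define c0 where "c0 = median (sw ` K) 0"
  have shear0: "shear 0 ` A = A" for A by (auto simp: shear_def image_def)
  have half: "area {v\<in>K. v $ 2 < c0} = area K / 2" "area {v\<in>K. v $ 2 > c0} = area K / 2"
  proof -
    have eq: "sw ` {v\<in>K. v $ 2 < c0} = {w\<in>sw ` K. w $ 1 < c0}" "sw ` {v\<in>K. v $ 2 > c0} = {w\<in>sw ` K. w $ 1 > c0}"
      by (auto simp: sw_def)
    show "area {v\<in>K. v $ 2 < c0} = area K / 2" "area {v\<in>K. v $ 2 > c0} = area K / 2"
      using S.area_above_median[of 0] sw_meas(2)[OF Km]
        sw_meas(2)[OF lmeasurable_component_halves(1)[OF Km, where i = 2 and c = c0]]
        sw_meas(2)[OF lmeasurable_component_halves(2)[OF Km, where i = 2 and c = c0]]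
      unfolding shear0 c0_def[symmetric] eq by simp_all
  qed
  define K' where "K' = K \<ominus> v2 0 c0"
  have K'c: "compact K'" unfolding K'_def translate_by_def by (rule compact_translation_subtract[OF Kc])
  have K'm: "K' \<in> lmeasurable" using K'c by (rule lmeasurable_compact)
  define R where "R = R0 + \<bar>c0\<bar>"
  have R: "R > 0" using R0 by (simp add: R_def)
  have cmp': "\<bar>v $ i\<bar> \<le> R" if v: "v \<in> K'" for v i
  proof -
    obtain w where w: "w \<in> K" "v = w - v2 0 c0" using v unfolding K'_def translate_by_def by blast
    have "i = 1 \<or> i = 2" using exhaust_2 by blast
    then show ?thesis using cmp[OF w(1), of i] w(2) by (auto simp: R_def)
  qed
  define U where "U \<tau> = {v\<in>K'. \<tau> * v $ 2 > 0}" for \<tau> :: real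
  have U: "U \<tau> \<in> lmeasurable" "area (U \<tau>) = area K / 2" if "\<bar>\<tau>\<bar> = 1" for \<tau>
  proof -
    have t: "\<tau> = 1 \<or> \<tau> = -1" using that by auto
    show "U \<tau> \<in> lmeasurable"
      using t lmeasurable_component_halves[OF K'm, where i = 2 and c = 0] by (auto simp: U_def)
    have "U 1 = (\<lambda>x. x - v2 0 c0) ` {v\<in>K. v $ 2 > c0}" "U (-1) = (\<lambda>x. x - v2 0 c0) ` {v\<in>K. v $ 2 < c0}"
      by (auto simp: U_def K'_def translate_by_def image_iff)
    then show "area (U \<tau>) = area K / 2"
      using t half by (auto simp: measure_translation_subtract)
  qed
  have B: "bounded_area (U \<tau>) R" if "\<bar>\<tau>\<bar> = 1" for \<tau>
    using U[OF that] K0 R cmp' by unfold_locales (auto simp: U_def)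
  \<comment> \<open>A strip of height \<open>\<eta>\<close> inside the bounding square has area
    \<open>2 * R * \<eta> = area K / 8\<close>, which is below half of
    \<open>area (U \<tau>)\<close>.\<close>
  define \<eta> where "\<eta> = area K / (16 * R)"
  have \<eta>0: "\<eta> > 0" using K0 R by (simp add: \<eta>_def)
  have thin: "area {v\<in>U \<tau>. \<tau> * v $ 2 \<le> \<eta>} < area (U \<tau>) / 2" if "\<bar>\<tau>\<bar> = 1" for \<tau>
  proof -
    define f where "f v = \<tau> *\<^sub>R v" for v :: "real^2"
    have t: "\<tau> = 1 \<or> \<tau> = -1" using that by auto
    then have tt: "\<tau> * \<tau> = 1" by auto
    have f: "linear f" by (simp add: f_def[abs_def] linear_scaleR)
    have fm: "f ` A \<in> lmeasurable" "area (f ` A) = area A" if "A \<in> lmeasurable" for A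
      using measurable_linear_image[OF f that] measure_linear_image[OF f that] tt
      by (simp_all add: det_matrix_2 f_def axis_def)
    have cm: "\<bar>w $ i\<bar> \<le> R" if "w \<in> f ` U \<tau>" for w i
      using that cmp' t by (auto simp: f_def U_def)
    have "area {w\<in>f ` U \<tau>. w $ 2 \<le> \<eta>} \<le> area {w\<in>f ` U \<tau>. w $ 2 \<le> 0} + 2 * R * (\<eta> - 0)"
      using \<eta>0 R by (intro area_slab_le[OF fm(1)[OF U(1)[OF that]] cm]) auto
    also have "{w\<in>f ` U \<tau>. w $ 2 \<le> 0} = {}" by (auto simp: f_def U_def)
    finally have "area {w\<in>f ` U \<tau>. w $ 2 \<le> \<eta>} \<le> area K / 8" using R by (simp add: \<eta>_def)
    moreover have "{w\<in>f ` U \<tau>. w $ 2 \<le> \<eta>} = f ` {v\<in>U \<tau>. \<tau> * v $ 2 \<le> \<eta>}" by (auto simp: f_def)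
    moreover have "{v\<in>U \<tau>. \<tau> * v $ 2 \<le> \<eta>} \<in> lmeasurable"
    proof -
      have "{v\<in>U \<tau>. \<tau> * v $ 2 \<le> \<eta>} = U \<tau> - {v\<in>U \<tau>. \<tau> * v $ 2 > \<eta>}" by auto
      moreover have "{v\<in>U \<tau>. \<tau> * v $ 2 > \<eta>} \<in> lmeasurable"
        using t lmeasurable_component_halves[OF U(1)[OF that], where i = 2 and c = \<eta>]
          lmeasurable_component_halves[OF U(1)[OF that], where i = 2 and c = "- \<eta>"]
        by (auto simp: less_minus_iff)
      ultimately show ?thesis using U(1)[OF that] by auto
    qed
    ultimately show ?thesis using fm(2) U(2)[OF that] K0 by simp
  qed
  \<comment> \<open>Here the bound \<open>R - p * \<eta>\<close> of \<open>median_bounds\<close>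
    vanishes, so at \<open>p0\<close> and at \<open>- p0\<close> the offsets of the two halves have
    opposite signs, in opposite order. In between, some slanted line halves both parts at
    once.\<close>
  define p0 where "p0 = R / \<eta>"
  have p0: "p0 \<ge> 0" "R - p0 * \<eta> = 0" using R \<eta>0 by (simp_all add: p0_def)
  have one: "\<bar>1::real\<bar> = 1" "\<bar>-1::real\<bar> = 1" by auto
  note mb1 = bounded_area.median_bounds[OF B[OF one(1)] p0(1) thin[OF one(1)] one(1)]
  note mb2 = bounded_area.median_bounds[OF B[OF one(2)] p0(1) thin[OF one(2)] one(2)]
  define g where "g p = median (U (-1)) p - median (U 1) p" for p
  have "continuous_on {-p0..p0} g"
    unfolding g_def
    by (intro continuous_intros continuous_on_subset[OF bounded_area.median_continuous[OF B[OF one(1)]]]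
       continuous_on_subset[OF bounded_area.median_continuous[OF B[OF one(2)]]]) auto
  moreover have "g (-p0) \<le> 0" "0 \<le> g p0" using mb1 mb2 p0(2) by (simp_all add: g_def)
  ultimately obtain p where p: "g p = 0"
    using IVT'[of g "-p0" 0 p0] p0 by auto
  define c where "c = median (U 1) p"
  have med: "median (U \<tau>) p = c" if "\<bar>\<tau>\<bar> = 1" for \<tau>
  proof -
    have "\<tau> = 1 \<or> \<tau> = -1" using that by auto
    then show ?thesis using p by (auto simp: g_def c_def)
  qed
  define z where "z = v2 c c0"
  have "area {v \<in> shear p ` (K \<ominus> z). \<sigma> * v $ 1 > 0 \<and> \<tau> * v $ 2 > 0} = area K / 4"
    if st: "\<bar>\<sigma>\<bar> = 1" "\<bar>\<tau>\<bar> = 1" for \<sigma> \<tau> :: real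
  proof -
    have sh: "shear p (v - z) = shear p (v - v2 0 c0) - v2 c 0" for v
      by (simp add: z_def vec_eq_iff forall_2 algebra_simps)
    have "{v \<in> shear p ` (K \<ominus> z). \<sigma> * v $ 1 > 0 \<and> \<tau> * v $ 2 > 0}
      = (\<lambda>x. x - v2 c 0) ` {w \<in> shear p ` U \<tau>. \<sigma> * (w $ 1 - c) > 0}"
      by (auto simp: translate_by_def U_def K'_def sh image_iff) (rule_tac x = "xa - v2 0 c0" in exI, auto)
    then have "area {v \<in> shear p ` (K \<ominus> z). \<sigma> * v $ 1 > 0 \<and> \<tau> * v $ 2 > 0} = area {w \<in> shear p ` U \<tau>. \<sigma> * (w $ 1 - c) > 0}"
      by (simp add: measure_translation_subtract)
    also have "\<dots> = area (U \<tau>) / 2"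
    proof -
      have "\<sigma> = 1 \<or> \<sigma> = -1" using st by auto
      then show ?thesis
        using bounded_area.area_above_median[OF B[OF st(2)], of p] med[OF st(2)] by auto
    qed
    finally show ?thesis using U(2)[OF st(2)] by simp
  qed
  then show ?thesis using that by blast
qed

section \<open>The Santalo point\<close>

lemma compact_nhd0_translate:
  assumes "compact K" "z \<in> interior K"
  shows "compact_nhd0 (K \<ominus> z)"
proof
  show "compact (K \<ominus> z)"
    unfolding translate_by_def by (rule compact_translation_subtract[OF assms(1)])
  have "interior (K \<ominus> z) = (\<lambda>p. p - z) ` interior K"
    unfolding translate_by_def by (rule interior_translation_subtract)
  then show "0 \<in> interior (K \<ominus> z)" using assms(2) by force
qed

lemma convex_translate: "convex K \<Longrightarrow> convex (K \<ominus> z)"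
  unfolding translate_by_def by (rule convex_translation_subtract)

text \<open>The support function of the translate is affine in \<open>z\<close>; this is the source
  of the convexity of \<open>F\<close>.\<close>

lemma support_translate:
  assumes "compact K" "z \<in> interior K"
  shows "support (K \<ominus> z) v = support K v - z \<bullet> v"
proof -
  interpret T: compact_nhd0 "K \<ominus> z" by (rule compact_nhd0_translate[OF assms])
  obtain y where y: "y \<in> K \<ominus> z" "support (K \<ominus> z) v = y \<bullet> v" using T.support_attained by blast
  have "support K v = (y + z) \<bullet> v"
    unfolding support_def
  proof (rule cSup_eq_maximum)
    show "(y + z) \<bullet> v \<in> (\<lambda>x. x \<bullet> v) ` K" using y(1) by (auto simp: translate_by_def)
    fix r assume "r \<in> (\<lambda>x. x \<bullet> v) ` K"
    then obtain x where x: "x \<in> K" "r = x \<bullet> v" by blast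
    then have "(x - z) \<bullet> v \<le> y \<bullet> v"
      using T.inner_le_support[of "x - z" v] y(2) by (simp add: translate_by_def)
    then show "r \<le> (y + z) \<bullet> v" using x by (simp add: inner_diff_left inner_add_left)
  qed
  then show ?thesis using y(2) by (simp add: inner_add_left)
qed

lemma polar_uminus: "polar (uminus ` A) = uminus ` polar A"
proof (rule set_eqI)
  fix x :: "real^2"
  have "x \<in> polar (uminus ` A) \<longleftrightarrow> - x \<in> polar A" by (simp add: polar_def)
  moreover have "x \<in> uminus ` polar A \<longleftrightarrow> - x \<in> polar A" by (metis image_iff minus_minus)
  ultimately show "x \<in> polar (uminus ` A) \<longleftrightarrow> x \<in> uminus ` polar A" by simp
qed

lemma inverse_square_strict_convex:
  fixes a b t :: real
  assumes "a > 0" "b > 0" "0 < t" "t < 1"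
  shows "1 / (2 * ((1 - t) * a + t * b)\<^sup>2) \<le> (1 - t) * (1 / (2 * a\<^sup>2)) + t * (1 / (2 * b\<^sup>2))"
    and "a \<noteq> b \<Longrightarrow> 1 / (2 * ((1 - t) * a + t * b)\<^sup>2) < (1 - t) * (1 / (2 * a\<^sup>2)) + t * (1 / (2 * b\<^sup>2))"
proof -
  define c where "c = (1 - t) * a + t * b"
  have c: "c > 0" using assms by (simp add: c_def add_pos_pos)
  text \<open>The graph of \<open>1 / x\<^sup>2\<close> lies above its tangent at \<open>c\<close>.\<close>
  have tangent: "1 / x\<^sup>2 - (3 / c\<^sup>2 - 2 * x / c ^ 3) = (x - c)\<^sup>2 * (2 * x + c) / (x\<^sup>2 * c ^ 3)" if "x > 0" for x
  proof -
    have "(x - c)\<^sup>2 * (2 * x + c) = c ^ 3 - 3 * c * x\<^sup>2 + 2 * x ^ 3"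
      by (simp add: power2_eq_square power3_eq_cube algebra_simps)
    moreover have "1 / x\<^sup>2 - (3 / c\<^sup>2 - 2 * x / c ^ 3) = (c ^ 3 - 3 * c * x\<^sup>2 + 2 * x ^ 3) / (x\<^sup>2 * c ^ 3)"
      using that c by (simp add: field_simps power2_eq_square power3_eq_cube)
    ultimately show ?thesis by simp
  qed
  have sum: "(1 - t) * (3 / c\<^sup>2 - 2 * a / c ^ 3) + t * (3 / c\<^sup>2 - 2 * b / c ^ 3) = 1 / c\<^sup>2"
  proof -
    have "(1 - t) * (3 / c\<^sup>2 - 2 * a / c ^ 3) + t * (3 / c\<^sup>2 - 2 * b / c ^ 3) = 3 / c\<^sup>2 - 2 * c / c ^ 3"
      by (simp add: c_def algebra_simps add_divide_distrib[symmetric] diff_divide_distrib[symmetric])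
         (simp add: add_divide_distrib diff_divide_distrib algebra_simps)?
    also have "\<dots> = 1 / c\<^sup>2" using c by (simp add: field_simps power2_eq_square power3_eq_cube)
    finally show ?thesis .
  qed
  define Da where "Da = (a - c)\<^sup>2 * (2 * a + c) / (a\<^sup>2 * c ^ 3)"
  define Db where "Db = (b - c)\<^sup>2 * (2 * b + c) / (b\<^sup>2 * c ^ 3)"
  have ea: "1 / a\<^sup>2 = (3 / c\<^sup>2 - 2 * a / c ^ 3) + Da" and eb: "1 / b\<^sup>2 = (3 / c\<^sup>2 - 2 * b / c ^ 3) + Db"
    using tangent[OF assms(1)] tangent[OF assms(2)] by (simp_all add: Da_def Db_def)
  have eq: "(1 - t) * (1 / a\<^sup>2) + t * (1 / b\<^sup>2) = 1 / c\<^sup>2 + ((1 - t) * Da + t * Db)"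
    unfolding ea eb sum[symmetric] by (simp add: algebra_simps)
  have D0: "Da \<ge> 0" "Db \<ge> 0" using assms c by (simp_all add: Da_def Db_def)
  have half: "(1 - t) * (1 / (2 * a\<^sup>2)) + t * (1 / (2 * b\<^sup>2)) = ((1 - t) * (1 / a\<^sup>2) + t * (1 / b\<^sup>2)) / 2"
    by (simp add: add_divide_distrib)
  have "1 / (2 * c\<^sup>2) \<le> (1 - t) * (1 / (2 * a\<^sup>2)) + t * (1 / (2 * b\<^sup>2))"
    unfolding half eq using D0 assms by simp
  then show "1 / (2 * ((1 - t) * a + t * b)\<^sup>2) \<le> (1 - t) * (1 / (2 * a\<^sup>2)) + t * (1 / (2 * b\<^sup>2))"
    by (simp add: c_def)
  assume "a \<noteq> b"
  then have "a \<noteq> c" using assms(3) by (auto simp: c_def algebra_simps)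
  then have "Da > 0" using assms c by (simp add: Da_def)
  then have "(1 - t) * Da + t * Db > 0" using D0 assms by (simp add: add_pos_nonneg)
  then have "1 / (2 * c\<^sup>2) < (1 - t) * (1 / (2 * a\<^sup>2)) + t * (1 / (2 * b\<^sup>2))"
    unfolding half eq by simp
  then show "1 / (2 * ((1 - t) * a + t * b)\<^sup>2) < (1 - t) * (1 / (2 * a\<^sup>2)) + t * (1 / (2 * b\<^sup>2))"
    by (simp add: c_def)
qed

locale planar_body =
  fixes K :: "(real^2) set"
  assumes body: "convex_body K"
begin

lemma K: "compact K" "convex K" "interior K \<noteq> {}"
  using body by (auto simp: convex_body_def)

definition F :: "real^2 \<Rightarrow> real" where "F z = area (polar (K \<ominus> z))"

text \<open>The area of \<open>polar (K \<ominus> z)\<close> in one quadrant, written so that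
  \<open>z\<close> enters only through an affine expression in the denominator.\<close>

definition quarter :: "real \<Rightarrow> real \<Rightarrow> real^2 \<Rightarrow> real" where
  "quarter \<sigma> \<tau> z = integral {0..1}
     (\<lambda>s. 1 / (2 * (support K (v2 (\<sigma> * (1 - s)) (\<tau> * s)) - z \<bullet> v2 (\<sigma> * (1 - s)) (\<tau> * s))\<^sup>2))"

lemma F_eq:
  assumes "z \<in> interior K"
  shows "F z = quarter 1 1 z + quarter (-1) 1 z + quarter (-1) (-1) z + quarter 1 (-1) z"
proof -
  interpret T: compact_nhd0 "K \<ominus> z" by (rule compact_nhd0_translate[OF K(1) assms])
  interpret P: compact_nhd0 "polar (K \<ominus> z)" by (rule T.polar_compact_nhd0)
  have q: "area {v \<in> polar (K \<ominus> z). \<sigma> * v $ 1 > 0 \<and> \<tau> * v $ 2 > 0} = quarter \<sigma> \<tau> z"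
    if "\<bar>\<sigma>\<bar> = 1" "\<bar>\<tau>\<bar> = 1" for \<sigma> \<tau>
    using T.area_polar_quadrant[OF that] by (simp add: quarter_def support_translate[OF K(1) assms])
  show ?thesis
    unfolding F_def area_eq_sum_quadrants[OF P.compact] by (simp only: q abs_1 abs_neg_one)
qed

lemma gap_pos: "z \<in> interior K \<Longrightarrow> v \<noteq> 0 \<Longrightarrow> support K v - z \<bullet> v > 0"
  using compact_nhd0.support_pos[OF compact_nhd0_translate[OF K(1)], of z v] by (simp add: support_translate[OF K(1)])

lemma support_K_continuous: "continuous_on UNIV (support K)"
proof -
  obtain z where z: "z \<in> interior K" using K(3) by blast
  have "support K = (\<lambda>v. support (K \<ominus> z) v + z \<bullet> v)"
    by (simp add: support_translate[OF K(1) z])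
  moreover have "continuous_on UNIV (\<lambda>v. support (K \<ominus> z) v + z \<bullet> v)"
    by (intro continuous_intros compact_nhd0.support_continuous[OF compact_nhd0_translate[OF K(1) z]])
  ultimately show ?thesis by simp
qed

lemma quarter_strict_convex:
  assumes z: "z \<in> interior K" and w: "w \<in> interior K" and ne: "z \<noteq> w" and t: "0 < t" "t < 1"
    and st: "\<bar>\<sigma>\<bar> = 1" "\<bar>\<tau>\<bar> = 1"
  shows "quarter \<sigma> \<tau> ((1 - t) *\<^sub>R z + t *\<^sub>R w) < (1 - t) * quarter \<sigma> \<tau> z + t * quarter \<sigma> \<tau> w"
proof -
  define e where "e s = v2 (\<sigma> * (1 - s)) (\<tau> * s)" for s
  have e0: "e s \<noteq> 0" for s using st by (auto simp: e_def)
  have ce: "continuous_on {0..1} e" unfolding e_def by (intro continuous_intros)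
  define g where "g y s = support K (e s) - y \<bullet> e s" for y s
  have cg: "continuous_on {0..1} (g y)" for y
    unfolding g_def by (intro continuous_intros continuous_on_compose2[OF support_K_continuous ce] ce) auto
  define y where "y = (1 - t) *\<^sub>R z + t *\<^sub>R w"
  have y: "y \<in> interior K"
    unfolding y_def using convex_interior[OF K(2)] z w t by (intro convexD) auto
  have gpos: "g z s > 0" "g w s > 0" "g y s > 0" for s
    using gap_pos[OF z e0] gap_pos[OF w e0] gap_pos[OF y e0] by (auto simp: g_def)
  have gy: "g y s = (1 - t) * g z s + t * g w s" for s
    by (simp add: g_def y_def inner_add_left algebra_simps)
  define \<phi> where "\<phi> x s = 1 / (2 * (g x s)\<^sup>2)" for x s
  have c\<phi>: "continuous_on {0..1} (\<phi> z)" "continuous_on {0..1} (\<phi> w)" "continuous_on {0..1} (\<phi> y)"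
    unfolding \<phi>_def using gpos by (auto intro!: continuous_intros cg simp: less_imp_neq[symmetric])
  define D where "D s = ((1 - t) * \<phi> z s + t * \<phi> w s) - \<phi> y s" for s
  have cD: "continuous_on {0..1} D" unfolding D_def by (intro continuous_intros c\<phi>)
  have D0: "D s \<ge> 0" for s
    using inverse_square_strict_convex(1)[OF gpos(1,2) t, of s s] by (simp add: D_def \<phi>_def gy)
  \<comment> \<open>Distinct \<open>z\<close> and \<open>w\<close> differ in a coordinate, which
    shows at an endpoint of the segment. By continuity, strictness at one \<open>s\<close> makes the
    integral strict.\<close>
  have "\<exists>s\<in>{0..1}. D s \<noteq> 0"
  proof -
    have "z $ 1 \<noteq> w $ 1 \<or> z $ 2 \<noteq> w $ 2" using ne by (auto simp: vec_eq_iff forall_2)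
    then have "\<exists>s\<in>{0..1}. g z s \<noteq> g w s"
    proof
      assume "z $ 1 \<noteq> w $ 1"
      then show ?thesis using st
        by (intro bexI[of _ 0]) (auto simp: g_def e_def inner_vec_def sum_2)
    next
      assume "z $ 2 \<noteq> w $ 2"
      then show ?thesis using st
        by (intro bexI[of _ 1]) (auto simp: g_def e_def inner_vec_def sum_2)
    qed
    then obtain s where s: "s \<in> {0..1}" "g z s \<noteq> g w s" by blast
    then have "D s > 0"
      using inverse_square_strict_convex(2)[OF gpos(1,2) t s(2)] by (simp add: D_def \<phi>_def gy)
    then show ?thesis using s by force
  qed
  then have "integral {0..1} D \<noteq> 0" using D0 by (subst integral_eq_0_iff[OF cD]) auto
  moreover have "integral {0..1} D \<ge> 0"
    by (intro integral_nonneg integrable_continuous_real cD) (use D0 in auto)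
  ultimately have pos: "integral {0..1} D > 0" by simp
  have int: "\<phi> z integrable_on {0..1}" "\<phi> w integrable_on {0..1}" "\<phi> y integrable_on {0..1}"
    by (intro integrable_continuous_real c\<phi>)+
  have "integral {0..1} D = ((1 - t) * integral {0..1} (\<phi> z) + t * integral {0..1} (\<phi> w)) - integral {0..1} (\<phi> y)"
    unfolding D_def
    by (intro integral_unique has_integral_diff has_integral_add has_integral_mult_right integrable_integral int)
  moreover have "quarter \<sigma> \<tau> x = integral {0..1} (\<phi> x)" for x
    by (simp add: quarter_def \<phi>_def[abs_def] g_def e_def)
  ultimately show ?thesis using pos unfolding y_def by simp
qed

lemma F_strict_convex:
  assumes "z \<in> interior K" "w \<in> interior K" "z \<noteq> w" "0 < t" "t < 1"
  shows "F ((1 - t) *\<^sub>R z + t *\<^sub>R w) < (1 - t) * F z + t * F w"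
proof -
  have "(1 - t) *\<^sub>R z + t *\<^sub>R w \<in> interior K"
    using convex_interior[OF K(2)] assms by (intro convexD) auto
  then show ?thesis
    using quarter_strict_convex[OF assms, of 1 1] quarter_strict_convex[OF assms, of "-1" 1]
      quarter_strict_convex[OF assms, of "-1" "-1"] quarter_strict_convex[OF assms, of 1 "-1"] assms
    by (simp add: F_eq distrib_left)
qed

lemma F_continuous: "continuous_on (interior K) F"
proof (rule convex_on_continuous[OF open_interior])
  show "convex_on (interior K) F"
  proof (rule convex_onI)
    fix t and x y assume t: "(0::real) < t" "t < 1" and xy: "x \<in> interior K" "y \<in> interior K"
    show "F ((1 - t) *\<^sub>R x + t *\<^sub>R y) \<le> (1 - t) * F x + t * F y"
    proof (cases "x = y")
      case True
      then have "(1 - t) *\<^sub>R x + t *\<^sub>R y = y" "(1 - t) * F x + t * F y = F y"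
        by (simp_all add: algebra_simps)
      then show ?thesis by simp
    next
      case False
      then show ?thesis using F_strict_convex[OF xy False t] by simp
    qed
  qed (use K convex_interior in auto)
qed

text \<open>The polar body contains the disc of radius \<open>1 / D\<close> and a point at distance
  \<open>1 / (support K \<nu> - z \<bullet> \<nu>)\<close> in direction \<open>\<nu>\<close>, hence
  a triangle with base \<open>2 / D\<close> and that height. So \<open>F\<close> blows up as
  \<open>z\<close> approaches the boundary.\<close>

lemma F_ge:
  assumes z: "z \<in> interior K" and D: "D > 0" "\<And>x. x \<in> K \<Longrightarrow> norm (x - z) \<le> D" and \<nu>: "norm \<nu> = 1"
  shows "1 / (D * (support K \<nu> - z \<bullet> \<nu>)) \<le> F z"
proof -
  interpret T: compact_nhd0 "K \<ominus> z" by (rule compact_nhd0_translate[OF K(1) z])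
  interpret P: compact_nhd0 "polar (K \<ominus> z)" by (rule T.polar_compact_nhd0)
  define r where "r = support K \<nu> - z \<bullet> \<nu>"
  have "\<nu> \<noteq> 0" using \<nu> by auto
  then have r: "r > 0" using gap_pos[OF z] by (simp add: r_def)
  define a where "a = v2 (- (\<nu> $ 2) / D) (\<nu> $ 1 / D)"
  have \<nu>2: "\<nu> $ 1 * \<nu> $ 1 + \<nu> $ 2 * \<nu> $ 2 = 1"
    using \<nu> norm_v2[of "\<nu> $ 1" "\<nu> $ 2"] by (simp add: power2_eq_square)
  have na: "norm a = 1 / D"
  proof -
    have "a = (1 / D) *\<^sub>R v2 (- (\<nu> $ 2)) (\<nu> $ 1)" by (simp add: a_def v2_algebra)
    moreover have "norm (v2 (- (\<nu> $ 2)) (\<nu> $ 1)) = 1"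
      using \<nu>2 by (simp add: norm_v2 power2_eq_square add.commute)
    ultimately show ?thesis using D by simp
  qed
  have small: "b \<in> polar (K \<ominus> z)" if "norm b = 1 / D" for b
    unfolding polar_def
  proof (intro CollectI ballI)
    fix x assume "x \<in> K \<ominus> z"
    then have "norm x \<le> D" using D(2) by (auto simp: translate_by_def)
    then have "norm b * norm x \<le> (1 / D) * D" using that D by (intro mult_mono) auto
    then show "b \<bullet> x \<le> 1" using norm_cauchy_schwarz[of b x] D by simp
  qed
  have "\<nu> /\<^sub>R r \<in> polar (K \<ominus> z)"
    unfolding T.polar_eq using T.support_hom[of "inverse r" \<nu>] r
    by (simp add: support_translate[OF K(1) z] r_def)
  then have "convex hull {a, - a, \<nu> /\<^sub>R r} \<subseteq> polar (K \<ominus> z)"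
    using small na by (intro hull_minimal T.polar_convex) auto
  moreover have Hc: "compact (convex hull {a, - a, \<nu> /\<^sub>R r})"
    by (rule finite_imp_compact_convex_hull) simp
  ultimately have "area (convex hull {a, - a, \<nu> /\<^sub>R r}) \<le> F z"
    unfolding F_def using lmeasurable_compact[OF Hc] lmeasurable_compact[OF P.compact]
    by (intro measure_mono_fmeasurable) auto
  moreover have "area (convex hull {a, - a, \<nu> /\<^sub>R r}) = 1 / (D * r)"
  proof -
    have "convex hull {a, - a, \<nu> /\<^sub>R r} \<in> sets borel" using Hc by (intro borel_closed compact_imp_closed)
    then have "area (convex hull {a, - a, \<nu> /\<^sub>R r}) = measure lborel (convex hull {a, - a, \<nu> /\<^sub>R r})"
      by (simp add: measure_completion)
    also have "\<dots> = \<bar>- (2 / (D * r))\<bar> / 2"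
    proof -
      have c: "a $ 1 = - (\<nu> $ 2 / D)" "a $ 2 = \<nu> $ 1 / D" "(- a) $ 1 = \<nu> $ 2 / D" "(- a) $ 2 = - (\<nu> $ 1 / D)"
        "(\<nu> /\<^sub>R r) $ 1 = \<nu> $ 1 / r" "(\<nu> /\<^sub>R r) $ 2 = \<nu> $ 2 / r"
        by (simp_all add: a_def divide_inverse mult.commute)
      have alg: "(p / r - - (q / D)) * (- (p / D) - p / D) - (q / D - - (q / D)) * (q / r - p / D)
          = - (2 * (p * p + q * q) / (D * r))" for p q :: real
        using D r by (simp add: field_simps)
      show ?thesis unfolding content_triangle c alg \<nu>2 by simp
    qed
    also have "\<dots> = 1 / (D * r)" using D r by simp
    finally show ?thesis .
  qed
  ultimately show ?thesis by (simp add: r_def)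
qed

lemma santalo_exists_unique: "\<exists>!z. z \<in> interior K \<and> (\<forall>w\<in>interior K. F z \<le> F w)"
proof -
  obtain z1 where z1: "z1 \<in> interior K" using K(3) by blast
  obtain R where R: "R > 0" "\<And>x. x \<in> K \<Longrightarrow> norm x \<le> R"
    using compact_imp_bounded[OF K(1)] bounded_pos by blast
  define D where "D = 2 * R"
  have D: "D > 0" using R by (simp add: D_def)
  have diam: "norm (x - z) \<le> D" if "x \<in> K" "z \<in> K" for x z
    using norm_triangle_ineq4[of x z] R(2)[OF that(1)] R(2)[OF that(2)] by (simp add: D_def)
  have intK: "z \<in> K" if "z \<in> interior K" for z using that interior_subset by blast
  \<comment> \<open>\<open>F_ge\<close> keeps every \<open>z\<close> with
    \<open>F z \<le> F z1\<close> at least this far from all supporting lines; adding 1 keeps the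
    denominator positive.\<close>
  define \<eta> where "\<eta> = 1 / (D * (F z1 + 1))"
  have F0: "F z \<ge> 0" for z by (simp add: F_def)
  have \<eta>: "\<eta> > 0" using D F0[of z1] by (simp add: \<eta>_def add_nonneg_pos)
  \<comment> \<open>Closed, inside the interior, and containing the sublevel set of
    \<open>F z1\<close>: a minimum over this compact set is a minimum over the whole
    interior.\<close>
  define C where "C = {z\<in>K. \<forall>\<nu>. norm \<nu> = 1 \<longrightarrow> \<nu> \<bullet> z \<le> support K \<nu> - \<eta>}"
  have mem_C: "z \<in> C" if z: "z \<in> interior K" and Fz: "F z \<le> F z1" for z
    unfolding C_def
  proof (intro CollectI conjI allI impI)
    show "z \<in> K" using intK z .
    fix \<nu> :: "real^2" assume \<nu>: "norm \<nu> = 1"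
    define g where "g = support K \<nu> - z \<bullet> \<nu>"
    have "\<nu> \<noteq> 0" using \<nu> by auto
    then have g: "g > 0" using gap_pos[OF z] by (simp add: g_def)
    have "1 / (D * g) \<le> F z1 + 1"
      using F_ge[OF z D diam[OF _ intK[OF z]] \<nu>] Fz by (simp add: g_def)
    then have "1 \<le> (F z1 + 1) * (D * g)" using g D by (simp add: divide_le_eq)
    then have "\<eta> \<le> g" using D F0[of z1] by (simp add: \<eta>_def divide_le_eq mult_ac add_nonneg_pos)
    then show "\<nu> \<bullet> z \<le> support K \<nu> - \<eta>" by (simp add: g_def inner_commute)
  qed
  have C_int: "C \<subseteq> interior K"
  proof
    fix z assume z: "z \<in> C"
    have "ball z \<eta> \<subseteq> K"
    proof (rule ccontr)
      assume "\<not> ?thesis"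
      then obtain y where "y \<in> ball z \<eta>" and y2: "y \<notin> K" by blast
      then have y: "dist z y < \<eta>" "y \<notin> K" by (simp_all add: y2)
      obtain a b where ab: "a \<bullet> y < b" "\<forall>x\<in>K. b < a \<bullet> x"
        using separating_hyperplane_closed_point[OF K(2) compact_imp_closed[OF K(1)] y(2)] by blast
      have "a \<noteq> 0" using ab z1 intK by force
      define \<nu> where "\<nu> = - (a /\<^sub>R norm a)"
      have \<nu>: "norm \<nu> = 1" using \<open>a \<noteq> 0\<close> by (simp add: \<nu>_def)
      have "support K \<nu> \<le> y \<bullet> \<nu>"
        unfolding support_def
      proof (rule cSUP_least)
        fix x assume "x \<in> K"
        then have "a \<bullet> y \<le> a \<bullet> x" using ab by force
        then have "(a \<bullet> y) / norm a \<le> (a \<bullet> x) / norm a" by (intro divide_right_mono) auto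
        then show "x \<bullet> \<nu> \<le> y \<bullet> \<nu>" by (simp add: \<nu>_def inner_commute divide_inverse mult.commute)
      qed (use z1 intK in blast)
      moreover have "\<nu> \<bullet> z \<le> support K \<nu> - \<eta>" using z \<nu> by (simp add: C_def)
      moreover have "(y - z) \<bullet> \<nu> \<le> norm (y - z)" using norm_cauchy_schwarz[of "y - z" \<nu>] \<nu> by simp
      moreover have "(y - z) \<bullet> \<nu> = y \<bullet> \<nu> - \<nu> \<bullet> z"
        using inner_commute[of z \<nu>] by (simp add: inner_diff_left)
      moreover have "norm (y - z) < \<eta>" using y(1) by (simp add: dist_norm norm_minus_commute)
      ultimately show False by linarith
    qed
    then show "z \<in> interior K" using \<eta> by (meson mem_interior)
  qed
  have "compact C"
  proof -
    have "closed {z. \<forall>\<nu>. norm \<nu> = 1 \<longrightarrow> \<nu> \<bullet> z \<le> support K \<nu> - \<eta>}"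
      by (intro closed_Collect_all closed_Collect_imp open_Collect_const closed_halfspace_le)
    moreover have "C = K \<inter> {z. \<forall>\<nu>. norm \<nu> = 1 \<longrightarrow> \<nu> \<bullet> z \<le> support K \<nu> - \<eta>}" by (auto simp: C_def)
    ultimately show ?thesis using K(1) by (simp add: compact_Int_closed)
  qed
  moreover have "C \<noteq> {}" using mem_C[OF z1] by auto
  moreover have "continuous_on C F" by (rule continuous_on_subset[OF F_continuous C_int])
  ultimately obtain z where z: "z \<in> C" "\<And>w. w \<in> C \<Longrightarrow> F z \<le> F w"
    using continuous_attains_inf[of C F] by blast
  have zi: "z \<in> interior K" using z C_int by blast
  have min: "F z \<le> F w" if w: "w \<in> interior K" for w
  proof (cases "F w \<le> F z1")
    case True
    then show ?thesis using z(2)[OF mem_C[OF w]] by simp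
  next
    case False
    then show ?thesis using z(2)[OF mem_C[OF z1]] by simp
  qed
  show ?thesis
  proof (rule ex1I[of _ z])
    show "z \<in> interior K \<and> (\<forall>w\<in>interior K. F z \<le> F w)" using zi min by blast
    fix y assume y: "y \<in> interior K \<and> (\<forall>w\<in>interior K. F y \<le> F w)"
    show "y = z"
    proof (rule ccontr)
      assume "y \<noteq> z"
      define w where "w = (1 - 1/2) *\<^sub>R y + (1/2) *\<^sub>R z"
      have w: "w \<in> interior K"
        unfolding w_def using convex_interior[OF K(2)] y zi by (intro convexD) auto
      have "F w < (1 - 1/2) * F y + (1/2) * F z"
        unfolding w_def using y zi \<open>y \<noteq> z\<close> by (intro F_strict_convex) auto
      moreover have "F y \<le> F w" "F z \<le> F w" using y min w by auto
      ultimately show False by simp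
    qed
  qed
qed

lemma santalo_point:
  shows "santalo_point K \<in> interior K"
    and "w \<in> interior K \<Longrightarrow> area (polar (K \<ominus> santalo_point K)) \<le> area (polar (K \<ominus> w))"
  using theI'[OF santalo_exists_unique] unfolding santalo_point_def F_def by blast+

text \<open>Reflection in the origin preserves \<open>K\<close> and areas, so the negative of the
  Santalo point is a minimiser too, and uniqueness makes them equal.\<close>

lemma santalo_point_symmetric:
  assumes sym: "o_symmetric K"
  shows "santalo_point K = 0"
proof -
  define s where "s = santalo_point K"
  have K': "uminus ` K = K" using sym by (simp add: o_symmetric_def)
  have "uminus ` interior K = interior (uminus ` K)"
    by (intro interior_injective_linear_image[symmetric]) (auto simp: linear_uminus bounded_linear.linear bounded_linear_minus inj_on_def)
  then have int: "- s \<in> interior K" using santalo_point(1) unfolding K' s_def by (metis imageI)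
  have "K \<ominus> (- s) = uminus ` (K \<ominus> s)"
  proof -
    have "uminus ` (K \<ominus> s) = (\<lambda>x. - x + s) ` K" by (simp add: translate_by_def image_image)
    also have "\<dots> = (\<lambda>x. x + s) ` (uminus ` K)" by (simp add: image_image)
    finally show ?thesis by (simp add: K' translate_by_def)
  qed
  then have "polar (K \<ominus> (- s)) = uminus ` polar (K \<ominus> s)"
    by (simp add: polar_uminus)
  moreover have "area (uminus ` polar (K \<ominus> s)) = area (polar (K \<ominus> s))"
  proof -
    interpret T: compact_nhd0 "K \<ominus> s" by (rule compact_nhd0_translate[OF K(1)]) (simp add: s_def santalo_point)
    interpret P: compact_nhd0 "polar (K \<ominus> s)" by (rule T.polar_compact_nhd0)
    have "linear (uminus :: real^2 \<Rightarrow> real^2)" by (simp add: linear_iff)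
    then show ?thesis
      using measure_linear_image[of uminus "polar (K \<ominus> s)"] lmeasurable_compact[OF P.compact]
      by (simp add: det_matrix_2 axis_def)
  qed
  ultimately have "F (- s) = F s" by (simp add: F_def)
  then have "- s \<in> interior K \<and> (\<forall>w\<in>interior K. F (- s) \<le> F w)"
    using int santalo_point(2) by (simp add: F_def s_def)
  moreover have "s \<in> interior K \<and> (\<forall>w\<in>interior K. F s \<le> F w)"
    using santalo_point by (simp add: F_def s_def)
  ultimately have "- s = s" using santalo_exists_unique by blast
  then have "- (s $ i) = s $ i" for i by (metis vector_uminus_component)
  then have "s = 0" by (simp add: vec_eq_iff)
  then show ?thesis by (simp add: s_def)
qed

end

section \<open>The volume product\<close>

text \<open>Twice the signed area of the triangle with vertices \<open>0\<close>, \<open>u\<close>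
  and \<open>w\<close>.\<close>

definition cross2 :: "real^2 \<Rightarrow> real^2 \<Rightarrow> real" where
  "cross2 u w = u $ 1 * w $ 2 - u $ 2 * w $ 1"

text \<open>In the coordinates of a triangle of maximal area inscribed in \<open>K\<close>, with one vertex at the
  origin, \<open>K\<close> lies in the square \<open>[-1, 1]\<^sup>2\<close>.\<close>

lemma banach_mazur_ellipse_le_16:
  assumes K: "convex_body K"
  shows "banach_mazur_ellipse K \<le> 16"
proof -
  have Kc: "compact K" "convex K" using K by (auto simp: convex_body_def)
  define f where "f = (\<lambda>(p, q, r). \<bar>cross2 (q - p) (r - p)\<bar>)"
  have cf: "continuous_on (K \<times> K \<times> K) f"
    unfolding f_def cross2_def case_prod_unfold
    by (intro continuous_intros)
  obtain c e where e: "e > 0" "cball c e \<subseteq> K"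
    using K unfolding convex_body_def by (metis ex_in_conv mem_interior_cball)
  have in_K: "c \<in> K" "c + v2 e 0 \<in> K" "c + v2 0 e \<in> K"
    using e by (auto simp: norm_v2 dist_norm intro!: subsetD[OF e(2)])
  have "compact (K \<times> K \<times> K)" "K \<times> K \<times> K \<noteq> {}" using Kc in_K by (auto intro!: compact_Times)
  then obtain t where t: "t \<in> K \<times> K \<times> K" "\<And>s. s \<in> K \<times> K \<times> K \<Longrightarrow> f s \<le> f t"
    using continuous_attains_sup[OF _ _ cf] by blast
  obtain p q r where tpqr: "t = (p, q, r)" by (cases t)
  then have pqr: "p \<in> K" "q \<in> K" "r \<in> K" using t by auto
  define u w where "u = q - p" and "w = r - p"
  define \<Delta> where "\<Delta> = cross2 u w"
  have max: "\<bar>cross2 (q' - p') (r' - p')\<bar> \<le> \<bar>\<Delta>\<bar>" if "p' \<in> K" "q' \<in> K" "r' \<in> K" for p' q' r'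
    using t(2)[of "(p', q', r')"] that by (simp add: f_def tpqr \<Delta>_def u_def w_def)
  have "e * e \<le> \<bar>\<Delta>\<bar>" using max[OF in_K] by (simp add: cross2_def)
  moreover have "e * e > 0" using e by simp
  ultimately have \<Delta>: "\<bar>\<Delta>\<bar> > 0" by linarith
  define T where "T y = (y $ 1) *\<^sub>R u + (y $ 2) *\<^sub>R w" for y :: "real^2"
  have linT: "linear T" by (rule linearI) (simp_all add: T_def algebra_simps)
  have coord: "x = T (v2 (cross2 x w / \<Delta>) (cross2 u x / \<Delta>))" for x
  proof -
    have "x $ 1 * \<Delta> = cross2 x w * u $ 1 + cross2 u x * w $ 1" "x $ 2 * \<Delta> = cross2 x w * u $ 2 + cross2 u x * w $ 2"
      by (simp_all add: \<Delta>_def cross2_def algebra_simps)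
    then show ?thesis using \<Delta> by (simp add: T_def vec_eq_iff forall_2 add_divide_distrib[symmetric] eq_divide_eq)
  qed
  have crossT: "cross2 (T y) w = y $ 1 * \<Delta>" "cross2 u (T y) = y $ 2 * \<Delta>" for y
    by (simp_all add: T_def cross2_def \<Delta>_def algebra_simps)
  have injT: "inj T"
  proof (rule injI)
    fix y y' assume "T y = T y'"
    then have "y $ 1 * \<Delta> = y' $ 1 * \<Delta>" "y $ 2 * \<Delta> = y' $ 2 * \<Delta>" using crossT by metis+
    then show "y = y'" using \<Delta> by (simp add: vec_eq_iff forall_2)
  qed
  \<comment> \<open>Seen from this point the square lies in the disc of radius 2, and the disc of
    radius \<open>1 / 8\<close> about it lies in the triangle with vertices \<open>v2 0 0\<close>,
    \<open>v2 1 0\<close> and \<open>v2 0 1\<close>. The quotient of the radii is 16.\<close>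
  define g where "g = v2 (1/4) (1/4)"
  define x0 where "x0 = p + T g"
  define \<Phi> where "\<Phi> v = T (2 *\<^sub>R v)" for v
  have lin\<Phi>: "linear \<Phi>"
    unfolding \<Phi>_def using linT by (intro linearI) (simp_all add: linear_add linear_scale scaleR_add_right)
  have inj\<Phi>: "inj \<Phi>"
    by (rule injI) (use injD[OF injT] in \<open>force simp: \<Phi>_def\<close>)
  have "K \<ominus> x0 \<subseteq> \<Phi> ` cball 0 1"
  proof
    fix y assume "y \<in> K \<ominus> x0"
    then obtain x where x: "x \<in> K" "y = x - x0" by (auto simp: translate_by_def)
    define \<alpha> \<beta> where "\<alpha> = cross2 (x - p) w / \<Delta>" and "\<beta> = cross2 u (x - p) / \<Delta>"
    have "\<bar>cross2 (x - p) w\<bar> \<le> \<bar>\<Delta>\<bar>" "\<bar>cross2 u (x - p)\<bar> \<le> \<bar>\<Delta>\<bar>"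
      using max[OF pqr(1) x(1) pqr(3)] max[OF pqr(1,2) x(1)] by (simp_all add: u_def w_def)
    then have ab: "\<bar>\<alpha>\<bar> \<le> 1" "\<bar>\<beta>\<bar> \<le> 1" using \<Delta> by (simp_all add: \<alpha>_def \<beta>_def abs_divide divide_le_eq)
    have "y = T (v2 \<alpha> \<beta>) - T g" using coord[of "x - p"] by (simp add: x(2) x0_def \<alpha>_def \<beta>_def algebra_simps)
    also have "\<dots> = T (v2 (\<alpha> - 1/4) (\<beta> - 1/4))"
      using linear_diff[OF linT, of "v2 \<alpha> \<beta>" g] by (simp add: g_def v2_algebra)
    also have "\<dots> = \<Phi> (v2 ((\<alpha> - 1/4) / 2) ((\<beta> - 1/4) / 2))"
      unfolding \<Phi>_def by (rule arg_cong[where f = T]) (simp add: vec_eq_iff forall_2)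
    finally have y: "y = \<Phi> (v2 ((\<alpha> - 1/4) / 2) ((\<beta> - 1/4) / 2))" .
    have "\<bar>\<alpha> - 1/4\<bar> \<le> 5/4" "\<bar>\<beta> - 1/4\<bar> \<le> 5/4" using ab by linarith+
    then have "\<bar>(\<alpha> - 1/4) / 2\<bar> \<le> 5/8" "\<bar>(\<beta> - 1/4) / 2\<bar> \<le> 5/8" unfolding abs_divide by simp_all
    then have "((\<alpha> - 1/4) / 2)\<^sup>2 \<le> (5/8)\<^sup>2" "((\<beta> - 1/4) / 2)\<^sup>2 \<le> (5/8)\<^sup>2"
      by (metis abs_le_square_iff abs_of_nonneg divide_nonneg_nonneg zero_le_numeral)+
    then have "((\<alpha> - 1/4) / 2)\<^sup>2 + ((\<beta> - 1/4) / 2)\<^sup>2 \<le> (5/8)\<^sup>2 + (5/8)\<^sup>2" by (rule add_mono)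
    also have "\<dots> \<le> (1::real)" by (simp add: power2_eq_square)
    finally have "norm (v2 ((\<alpha> - 1/4) / 2) ((\<beta> - 1/4) / 2)) \<le> 1" by (simp add: norm_v2)
    then show "y \<in> \<Phi> ` cball 0 1" using y by auto
  qed
  moreover have "\<Phi> ` cball 0 1 \<subseteq> (\<lambda>p. 16 *\<^sub>R p) ` (K \<ominus> x0)"
  proof
    fix y assume "y \<in> \<Phi> ` cball 0 1"
    then obtain v where v: "norm v \<le> 1" "y = \<Phi> v" by auto
    have vi: "\<bar>v $ 1\<bar> \<le> 1" "\<bar>v $ 2\<bar> \<le> 1" using component_le_norm_cart[of v] v(1) by (meson order_trans)+
    define \<alpha> \<beta> where "\<alpha> = 1/4 + v $ 1 / 8" and "\<beta> = 1/4 + v $ 2 / 8"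
    have ab: "\<alpha> \<ge> 0" "\<beta> \<ge> 0" "\<alpha> + \<beta> \<le> 1" using vi by (auto simp: \<alpha>_def \<beta>_def abs_le_iff)
    have "(1 - \<alpha> - \<beta>) *\<^sub>R p + \<alpha> *\<^sub>R q + \<beta> *\<^sub>R r \<in> K"
    proof (cases "\<alpha> + \<beta> = 0")
      case True
      then show ?thesis using ab pqr by (simp add: add_nonneg_eq_0_iff)
    next
      case False
      have "(1 - (\<alpha> + \<beta>)) *\<^sub>R p + (\<alpha> + \<beta>) *\<^sub>R ((\<alpha> / (\<alpha> + \<beta>)) *\<^sub>R q + (\<beta> / (\<alpha> + \<beta>)) *\<^sub>R r) \<in> K"
        using Kc(2) pqr ab False by (intro convexD[OF Kc(2)]) (auto simp: add_divide_distrib[symmetric])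
      then show ?thesis using False by (simp add: scaleR_add_right diff_diff_eq add.assoc)
    qed
    moreover have "(1 - \<alpha> - \<beta>) *\<^sub>R p + \<alpha> *\<^sub>R q + \<beta> *\<^sub>R r = p + T (v2 \<alpha> \<beta>)"
      by (simp add: T_def u_def w_def algebra_simps)
    ultimately have "p + T (v2 \<alpha> \<beta>) - x0 \<in> K \<ominus> x0" by (auto simp: translate_by_def)
    moreover have "p + T (v2 \<alpha> \<beta>) - x0 = T (v2 (v $ 1 / 8) (v $ 2 / 8))"
      using linear_diff[OF linT, of "v2 \<alpha> \<beta>" g] by (simp add: x0_def g_def \<alpha>_def \<beta>_def v2_algebra)
    moreover have "y = 16 *\<^sub>R T (v2 (v $ 1 / 8) (v $ 2 / 8))"
      unfolding v(2) \<Phi>_def linear_scale[OF linT, symmetric]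
      by (rule arg_cong[where f = T]) (simp add: vec_eq_iff forall_2)
    ultimately show "y \<in> (\<lambda>p. 16 *\<^sub>R p) ` (K \<ominus> x0)" by auto
  qed
  ultimately show ?thesis
    by (intro banach_mazur_ellipse_le[OF _ lin\<Phi> inj\<Phi>, of 16 K x0]) auto
qed

text \<open>The polar body transforms by the inverse transpose of the shear, which again preserves
  areas.\<close>

lemma polar_shear:
  fixes A :: "(real^2) set"
  shows "polar (shear p ` A) = (\<lambda>y. v2 (y $ 1) (y $ 2 + p * y $ 1)) ` polar A"
proof (rule set_eqI)
  fix y :: "real^2"
  have "y \<in> polar (shear p ` A) \<longleftrightarrow> v2 (y $ 1) (y $ 2 - p * y $ 1) \<in> polar A"
    by (simp add: polar_def inner_vec_def sum_2 algebra_simps)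
  also have "\<dots> \<longleftrightarrow> y \<in> (\<lambda>y. v2 (y $ 1) (y $ 2 + p * y $ 1)) ` polar A"
  proof
    assume "v2 (y $ 1) (y $ 2 - p * y $ 1) \<in> polar A"
    then show "y \<in> (\<lambda>y. v2 (y $ 1) (y $ 2 + p * y $ 1)) ` polar A"
      by (intro image_eqI[of _ _ "v2 (y $ 1) (y $ 2 - p * y $ 1)"]) simp_all
  next
    assume "y \<in> (\<lambda>y. v2 (y $ 1) (y $ 2 + p * y $ 1)) ` polar A"
    then show "v2 (y $ 1) (y $ 2 - p * y $ 1) \<in> polar A" by auto
  qed
  finally show "y \<in> polar (shear p ` A) \<longleftrightarrow> y \<in> (\<lambda>y. v2 (y $ 1) (y $ 2 + p * y $ 1)) ` polar A" .
qed

lemma area_polar_shear: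
  assumes "polar A \<in> lmeasurable"
  shows "area (polar (shear p ` A)) = area (polar A)"
proof -
  have "linear (\<lambda>y. v2 (y $ 1) (y $ 2 + p * y $ 1))"
    by (rule linearI) (simp_all add: vec_eq_iff forall_2 algebra_simps)
  from measure_linear_image[OF this assms] show ?thesis
    by (simp add: polar_shear det_matrix_2 axis_def)
qed

lemma santalo_stability:
  assumes Kb: "convex_body K" and m: "0 < m" "m \<le> 1 / 1000000"
    and \<delta>: "8 * (1 - area K * area (polar (K \<ominus> santalo_point K)) / pi\<^sup>2) \<le> m ^ 5"
  shows "banach_mazur_ellipse K \<le> (1 + 1000000 * m\<^sup>2) / (1 - 1000000 * m\<^sup>2)"
proof -
  interpret planar_body K using Kb by unfold_locales
  obtain z p where quarters: "\<And>\<sigma> \<tau> :: real. \<bar>\<sigma>\<bar> = 1 \<Longrightarrow> \<bar>\<tau>\<bar> = 1 \<Longrightarrow>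
    area {v \<in> shear p ` (K \<ominus> z). \<sigma> * v $ 1 > 0 \<and> \<tau> * v $ 2 > 0} = area K / 4"
    using quadrisection[OF Kb] by blast
  define L where "L = K \<ominus> z"
  define M where "M = shear p ` L"
  have Lc: "compact L" "convex L"
    unfolding L_def using convex_translate[OF K(2)] compact_translation_subtract[OF K(1)]
    by (auto simp: translate_by_def)
  have Mc: "compact M" "convex M"
    unfolding M_def
    by (rule compact_continuous_image[OF linear_continuous_on[OF linear_conv_bounded_linear[THEN iffD1, OF linear_shear]] Lc(1)])
       (rule convex_linear_image[OF linear_shear Lc(2)])
  have intL: "interior L = (\<lambda>x. x - z) ` interior K"
    unfolding L_def translate_by_def by (rule interior_translation_subtract)
  have intM: "interior M = shear p ` interior L"
    unfolding M_def by (rule interior_injective_linear_image[OF linear_shear inj_shear])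
  have M0: "0 \<in> interior M"
  proof (rule zero_in_interior_quadrants[OF Mc(2)])
    show "interior M \<noteq> {}" using K(3) by (simp add: intM intL)
    fix \<sigma> \<tau> :: real assume st: "\<bar>\<sigma>\<bar> = 1" "\<bar>\<tau>\<bar> = 1"
    have "area {v \<in> M. \<sigma> * v $ 1 > 0 \<and> \<tau> * v $ 2 > 0} = area K / 4"
      using quarters[OF st] by (simp add: M_def L_def)
    then have "area {v \<in> M. \<sigma> * v $ 1 > 0 \<and> \<tau> * v $ 2 > 0} \<noteq> 0"
      using convex_body_area_pos[OF body] by simp
    then have "{v \<in> M. \<sigma> * v $ 1 > 0 \<and> \<tau> * v $ 2 > 0} \<noteq> {}" by (metis measure_empty)
    then show "\<exists>v\<in>M. \<sigma> * v $ 1 > 0 \<and> \<tau> * v $ 2 > 0" by blast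
  qed
  have "0 \<in> shear p ` interior L" using M0 intM by simp
  then have "0 \<in> interior L" by (metis imageE shear_shear(2) linear_0 linear_shear)
  then have z: "z \<in> interior K" unfolding intL by auto
  have Mn: "compact_nhd0 M" using Mc M0 by unfold_locales
  have areaM: "area M = area K"
    using area_shear[OF lmeasurable_compact[OF Lc(1)], of p]
    by (simp add: M_def L_def translate_by_def measure_translation_subtract)
  interpret L: compact_nhd0 L unfolding L_def by (rule compact_nhd0_translate[OF K(1) z])
  interpret PL: compact_nhd0 "polar L" by (rule L.polar_compact_nhd0)
  have areaP: "area (polar M) = area (polar L)"
    unfolding M_def by (rule area_polar_shear[OF lmeasurable_compact[OF PL.compact]])
  \<comment> \<open>Minimality of the Santalo point: moving to the quadrisection point cannot lower
    the product, so the deficit only shrinks.\<close>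
  have "area K * area (polar (K \<ominus> santalo_point K)) \<le> area M * area (polar M)"
    unfolding areaM areaP L_def by (intro mult_left_mono santalo_point(2) z) simp
  then have "area K * area (polar (K \<ominus> santalo_point K)) / pi\<^sup>2 \<le> area M * area (polar M) / pi\<^sup>2"
    by (rule divide_right_mono) simp
  then have "8 * (1 - area M * area (polar M) / pi\<^sup>2)
    \<le> 8 * (1 - area K * area (polar (K \<ominus> santalo_point K)) / pi\<^sup>2)" by simp
  then have "8 * (1 - area M * area (polar M) / pi\<^sup>2) \<le> m ^ 5" using \<delta> by (rule order_trans)
  moreover have "area {v \<in> M. \<sigma> * v $ 1 > 0 \<and> \<tau> * v $ 2 > 0} = area M / 4" if "\<bar>\<sigma>\<bar> = 1" "\<bar>\<tau>\<bar> = 1" for \<sigma> \<tau>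
    using quarters[OF that] by (simp add: areaM) (simp add: M_def L_def)
  ultimately obtain \<Phi> :: "real^2 \<Rightarrow> real^2" where \<Phi>: "linear \<Phi>" "inj \<Phi>" "M \<subseteq> \<Phi> ` cball 0 1"
    "\<Phi> ` cball 0 1 \<subseteq> (\<lambda>p. ((1 + 1000000 * m\<^sup>2) / (1 - 1000000 * m\<^sup>2)) *\<^sub>R p) ` M"
    using quadrisected_stability[OF Mn Mc(2) _ m] by blast
  define t where "t = (1 + 1000000 * m\<^sup>2) / (1 - 1000000 * m\<^sup>2)"
  have t: "t \<ge> 1" using small_square(2)[OF m] by (simp add: t_def)
  have LM: "L = shear (- p) ` M" by (simp add: M_def image_image)
  show ?thesis unfolding t_def[symmetric]
  proof (rule banach_mazur_ellipse_le[OF t, of "shear (- p) \<circ> \<Phi>" K z, folded L_def])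
    show "linear (shear (- p) \<circ> \<Phi>)" using \<Phi>(1) linear_shear by (rule linear_compose)
    show "inj (shear (- p) \<circ> \<Phi>)" using \<Phi>(2) inj_shear by (simp add: inj_compose)
    show "L \<subseteq> (shear (- p) \<circ> \<Phi>) ` cball 0 1"
      unfolding LM image_comp[symmetric] by (rule image_mono[OF \<Phi>(3)])
    have "(shear (- p) \<circ> \<Phi>) ` cball 0 1 \<subseteq> shear (- p) ` (\<lambda>x. t *\<^sub>R x) ` M"
      unfolding image_comp[symmetric] t_def by (rule image_mono[OF \<Phi>(4)])
    also have "\<dots> = (\<lambda>x. t *\<^sub>R x) ` L"
      unfolding LM by (simp add: image_image linear_scale[OF linear_shear])
    finally show "(shear (- p) \<circ> \<Phi>) ` cball 0 1 \<subseteq> (\<lambda>x. t *\<^sub>R x) ` L" .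
  qed
qed

text \<open>The contrapositive of \<open>santalo_stability\<close>: with
  \<open>\<kappa> = 1000000 * m\<^sup>2\<close>, the factor
  \<open>(1 + \<kappa>) / (1 - \<kappa>)\<close> stays below
  \<open>1 + 4 * \<kappa>\<close>.\<close>

lemma volume_product_deficit:
  assumes K: "convex_body K" and m: "0 < m" "m \<le> 1 / 1000000"
    and bm: "banach_mazur_ellipse K \<ge> 1 + 4000000 * m\<^sup>2"
  shows "area K * area (polar (K \<ominus> santalo_point K)) \<le> pi\<^sup>2 * (1 - m ^ 5 / 8)"
proof (rule ccontr)
  define P where "P = area K * area (polar (K \<ominus> santalo_point K))"
  assume "\<not> ?thesis"
  then have "pi\<^sup>2 * (1 - m ^ 5 / 8) < P" by (simp add: P_def)
  then have "1 - m ^ 5 / 8 < P / pi\<^sup>2" by (simp add: pos_less_divide_eq mult.commute)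
  then have "8 * (1 - P / pi\<^sup>2) \<le> m ^ 5" by simp
  then have "banach_mazur_ellipse K \<le> (1 + 1000000 * m\<^sup>2) / (1 - 1000000 * m\<^sup>2)"
    unfolding P_def by (rule santalo_stability[OF K m])
  also have "\<dots> < 1 + 4000000 * m\<^sup>2"
  proof -
    define \<kappa> where "\<kappa> = 1000000 * m\<^sup>2"
    have \<kappa>: "0 < \<kappa>" "\<kappa> \<le> 1 / 1000" using small_square[OF m] by (simp_all add: \<kappa>_def)
    have "\<kappa> * \<kappa> \<le> \<kappa> * (1 / 1000)" using \<kappa> by (intro mult_left_mono) auto
    then have "1 + \<kappa> < (1 + 4 * \<kappa>) * (1 - \<kappa>)" using \<kappa> by (simp add: algebra_simps)
    then have "(1 + \<kappa>) / (1 - \<kappa>) < 1 + 4 * \<kappa>" using \<kappa> by (simp add: pos_divide_less_eq)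
    then show ?thesis by (simp add: \<kappa>_def)
  qed
  finally show False using bm by simp
qed

theorem theoremD:
  shows "(\<exists>c::real. c > 0 \<and>
      (\<forall>\<epsilon>>0. \<forall>K. convex_body K \<and> banach_mazur_ellipse K \<ge> 1 + \<epsilon> \<longrightarrow>
        area K * area (polar (K \<ominus> santalo_point K)) \<le> pi\<^sup>2 * (1 - c * \<epsilon> ^ 6)))
    \<and> (\<exists>\<eta> :: real \<Rightarrow> real. (\<eta> \<longlongrightarrow> 0) (at_right 0) \<and>
      (\<forall>\<epsilon>>0. \<forall>K. convex_body K \<and> banach_mazur_ellipse K \<ge> 1 + \<epsilon> \<and> o_symmetric K \<longrightarrow>
        area K * area (polar (K \<ominus> santalo_point K)) = area K * area (polar K) \<and>
        area K * area (polar K) \<le> pi\<^sup>2 * (1 - (8 + \<eta> \<epsilon>) * \<epsilon> ^ 3)))"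
proof -
  define m0 :: real where "m0 = 1 / 1000000"
  \<comment> \<open>\<open>8 * (E m) ^ 3 = 512 * 10 ^ 18 * m ^ 6\<close>, and for positive
    \<open>m\<close> this is at most \<open>m ^ 5 / 8\<close> precisely when
    \<open>m \<le> m1\<close>.\<close>
  define m1 :: real where "m1 = 1 / (4096 * 10 ^ 18)"
  define E where "E m = 4000000 * m\<^sup>2" for m :: real
  have m1: "0 < m1" "m1 \<le> m0" by (simp_all add: m1_def m0_def)
  have root: "\<exists>m. 0 < m \<and> m \<le> b \<and> \<epsilon> = E m" if "0 < \<epsilon>" "\<epsilon> \<le> E b" "0 < b" for \<epsilon> b :: real
  proof (intro exI conjI)
    show "0 < sqrt (\<epsilon> / 4000000)" using that by simp
    have "\<epsilon> / 4000000 \<le> b\<^sup>2" using that by (simp add: E_def)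
    then show "sqrt (\<epsilon> / 4000000) \<le> b" using that by (intro real_le_lsqrt) auto
    show "\<epsilon> = E (sqrt (\<epsilon> / 4000000))" using that by (simp add: E_def)
  qed
  have deficit: "area K * area (polar (K \<ominus> santalo_point K)) \<le> pi\<^sup>2 * (1 - x)"
    if "convex_body K" "banach_mazur_ellipse K \<ge> 1 + \<epsilon>" "0 < m" "m \<le> m0" "E m \<le> \<epsilon>" "x \<le> m ^ 5 / 8" for K \<epsilon> m x
  proof -
    have "area K * area (polar (K \<ominus> santalo_point K)) \<le> pi\<^sup>2 * (1 - m ^ 5 / 8)"
      using that by (intro volume_product_deficit) (auto simp: E_def m0_def)
    also have "\<dots> \<le> pi\<^sup>2 * (1 - x)" using that by (intro mult_left_mono) auto
    finally show ?thesis .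
  qed
  \<comment> \<open>The constant is generous: \<open>4000000 ^ 6 < 10 ^ 40\<close> for small
    \<open>\<epsilon>\<close>; for large \<open>\<epsilon>\<close>, \<open>15 ^ 6 < 10 ^ 8\<close>
    against \<open>m0 ^ 5 / 8 > 1 / 10 ^ 31\<close>.\<close>
  have part1: "area K * area (polar (K \<ominus> santalo_point K)) \<le> pi\<^sup>2 * (1 - 1 / 10 ^ 60 * \<epsilon> ^ 6)"
    if \<epsilon>: "\<epsilon> > 0" and K: "convex_body K" "banach_mazur_ellipse K \<ge> 1 + \<epsilon>" for \<epsilon> K
  proof (cases "\<epsilon> \<le> E m0")
    case True
    then obtain m where m: "0 < m" "m \<le> m0" "\<epsilon> = E m"
      using root[OF \<epsilon> True] by (auto simp: m0_def)
    have "m ^ 12 \<le> m ^ 5" using m by (intro power_decreasing) (auto simp: m0_def)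
    have "\<epsilon> ^ 6 = 4000000 ^ 6 * m ^ 12" by (simp add: m(3) E_def power_mult_distrib flip: power_mult)
    then have "1 / 10 ^ 60 * \<epsilon> ^ 6 \<le> m ^ 12 / 8" using m(1) by simp
    also have "\<dots> \<le> m ^ 5 / 8" using \<open>m ^ 12 \<le> m ^ 5\<close> by simp
    finally have "1 / 10 ^ 60 * \<epsilon> ^ 6 \<le> m ^ 5 / 8" .
    then show ?thesis using m by (intro deficit[OF K]) auto
  next
    case False
    \<comment> \<open>No planar body is far from the ellipses, so beyond \<open>E m0\<close> the
      fixed deficit belonging to \<open>m0\<close> suffices.\<close>
    have "\<epsilon> \<le> 15" using K banach_mazur_ellipse_le_16[OF K(1)] by linarith
    then have "\<epsilon> ^ 6 \<le> 15 ^ 6" using \<epsilon> by (intro power_mono) auto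
    then have "1 / 10 ^ 60 * \<epsilon> ^ 6 \<le> m0 ^ 5 / 8" by (simp add: m0_def power_divide)
    then show ?thesis using False by (intro deficit[OF K, of m0]) (auto simp: m0_def)
  qed
  \<comment> \<open>Away from 0, the value -8 cancels the cubic term and leaves the plain
    Blaschke-Santalo bound.\<close>
  define \<eta> where "\<eta> \<epsilon> = (if \<epsilon> < E m1 then 0 else -8 :: real)" for \<epsilon>
  have "E m1 > 0" using m1 by (simp add: E_def)
  then have "\<forall>\<^sub>F \<epsilon> in at_right 0. \<eta> \<epsilon> = 0"
    using order_tendstoD(2)[OF tendsto_ident_at] by (auto simp: \<eta>_def elim!: eventually_mono)
  then have \<eta>: "(\<eta> \<longlongrightarrow> 0) (at_right 0)" by (rule tendsto_eventually)
  have part2: "area K * area (polar (K \<ominus> santalo_point K)) = area K * area (polar K) \<and>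
      area K * area (polar K) \<le> pi\<^sup>2 * (1 - (8 + \<eta> \<epsilon>) * \<epsilon> ^ 3)"
    if \<epsilon>: "\<epsilon> > 0" and Kb: "convex_body K" "banach_mazur_ellipse K \<ge> 1 + \<epsilon>" and sym: "o_symmetric K" for \<epsilon> K
  proof -
    interpret planar_body K using Kb by unfold_locales
    have eq: "K \<ominus> santalo_point K = K" using santalo_point_symmetric[OF sym] by simp
    have "area K * area (polar (K \<ominus> santalo_point K)) \<le> pi\<^sup>2 * (1 - (8 + \<eta> \<epsilon>) * \<epsilon> ^ 3)"
    proof (cases "\<epsilon> < E m1")
      case True
      then obtain m where m: "0 < m" "m \<le> m1" "\<epsilon> = E m"
        using root[OF \<epsilon>, of m1] m1 by auto
      have "4096 * 10 ^ 18 * m \<le> 1" using m(2) by (simp add: m1_def)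
      then have "4096 * 10 ^ 18 * m * m ^ 5 \<le> 1 * m ^ 5" using m by (intro mult_right_mono) auto
      moreover have "8 * \<epsilon> ^ 3 = 512 * 10 ^ 18 * (m * m ^ 5)"
        by (simp add: m(3) E_def power_mult_distrib flip: power_mult) (simp add: eval_nat_numeral)
      ultimately have "(8 + \<eta> \<epsilon>) * \<epsilon> ^ 3 \<le> m ^ 5 / 8" using True by (simp add: \<eta>_def)
      then show ?thesis using m m1 by (intro deficit[OF Kb, of m]) auto
    next
      case False
      then have "(8 + \<eta> \<epsilon>) * \<epsilon> ^ 3 \<le> m1 ^ 5 / 8" using m1 by (simp add: \<eta>_def)
      then show ?thesis using m1 False by (intro deficit[OF Kb, of m1]) auto
    qed
    then show ?thesis unfolding eq by simp
  qed
  show ?thesis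
  proof (intro conjI exI[of _ \<eta>])
    show "\<exists>c::real. c > 0 \<and> (\<forall>\<epsilon>>0. \<forall>K. convex_body K \<and> banach_mazur_ellipse K \<ge> 1 + \<epsilon> \<longrightarrow>
        area K * area (polar (K \<ominus> santalo_point K)) \<le> pi\<^sup>2 * (1 - c * \<epsilon> ^ 6))"
      using part1 by (intro exI[of _ "1 / 10 ^ 60"]) auto
    show "(\<eta> \<longlongrightarrow> 0) (at_right 0)" by (rule \<eta>)
    show "\<forall>\<epsilon>>0. \<forall>K. convex_body K \<and> banach_mazur_ellipse K \<ge> 1 + \<epsilon> \<and> o_symmetric K \<longrightarrow>
        area K * area (polar (K \<ominus> santalo_point K)) = area K * area (polar K) \<and>
        area K * area (polar K) \<le> pi\<^sup>2 * (1 - (8 + \<eta> \<epsilon>) * \<epsilon> ^ 3)"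
      using part2 by blast
  qed
qed

end
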